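(* Let $m$ be a positive integer and let $G\subset SL(4,\mathbb{C})$ be the cyclic group generated by $g=\frac{1}{2m}(1,2m-1,m,m)$. Then $\mathrm{Hilb}^G(\mathbb{C}^4)$ has a singularity, i.e. it is not smooth.
   Context: Notation: for a positive integer $r$ and integers $a_1,\dots,a_n$, the symbol $\frac{1}{r}(a_1,\dots,a_n)$ denotes the diagonal matrix $\mathrm{diag}(\varepsilon_r^{a_1},\dots,\varepsilon_r^{a_n})$, where $\varepsilon_r$ is a fixed primitive $r$-th root of unity. A finite group $G\subset SL(n,\mathbb{C})$ acts linearly on $\mathbb{C}^n$, and $\mathbb{C}^n/G=\mathrm{Spec}\,\mathbb{C}[x_1,\dots,x_n]^G$ is the quotient variety. $G$-Hilbert scheme: let $N=|G|$ be the order of $G$, and let $\mathrm{Hilb}^{N}(\mathbb{C}^n)$ be the Hilbert scheme of $N$ points on $\mathbb{C}^n$ (parametrizing ideals $I\subset\mathbb{C}[x_1,\dots,x_n]$ of colength $N$). The group $G$ acts on $\mathrm{Hilb}^{N}(\mathbb{C}^n)$ and on the symmetric product $S^{N}(\mathbb{C}^n)$, and the Hilbert–Chow morphism $\mathrm{Hilb}^{N}(\mathbb{C}^n)\to S^{N}(\mathbb{C}^n)$ restricts to a morphism of fixed loci $\mathrm{Hilb}^{N}(\mathbb{C}^n)^G\to S^{N}(\mathbb{C}^n)^G$, where $\mathbb{C}^n/G\subset S^{N}(\mathbb{C}^n)^G$ via $G$-orbits. $\mathrm{Hilb}^G(\mathbb{C}^n)$ is the irreducible component of $\mathrm{Hilb}^{N}(\mathbb{C}^n)^G$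 which dominates $\mathbb{C}^n/G$; the natural morphism $\mathrm{Hilb}^G(\mathbb{C}^n)\to\mathbb{C}^n/G$ induced by the Hilbert–Chow morphism is birational.
   Formalization: The case m = 1 is excluded: there G = {1, -1} acts by 1/2(1,1,1,1) and Hilb^G(C^4) is the smooth blow-up of C^4/{1,-1} at the origin, so the claim fails; it is proved for every m ≥ 2. *)

theory Defs
  imports
    "HOL-Analysis.Analysis"
    "HOL-Algebra.Generated_Groups"
    "HOL-Library.Poly_Mapping"
    "HOL-Library.Extended_Nat"
begin

text \<open>
  All varieties below are reduced and are represented by their sets of closed points with the
  Zariski topology and their regular functions.
\<close>

section \<open>Polynomials\<close>

text \<open>The ring of complex polynomials in variables indexed by \<open>'i\<close>; the ring structure is the
  convolution structure of \<open>HOL-Library.Poly_Mapping\<close>, so \<open>single u c\<close> is the term \<open>c x^u\<close>.\<close>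

type_synonym 'i monomial = "'i \<Rightarrow>\<^sub>0 nat"
type_synonym 'i cpoly = "'i monomial \<Rightarrow>\<^sub>0 complex"

abbreviation constp :: "complex \<Rightarrow> 'i cpoly"
  where "constp c \<equiv> Poly_Mapping.single 0 c"

abbreviation monp :: "'i monomial \<Rightarrow> 'i cpoly"
  where "monp u \<equiv> Poly_Mapping.single u 1"

abbreviation varp :: "'i \<Rightarrow> 'i cpoly"
  where "varp i \<equiv> monp (Poly_Mapping.single i 1)"

definition substp :: "(complex \<Rightarrow> 'r::comm_ring_1) \<Rightarrow> ('i \<Rightarrow> 'r) \<Rightarrow> 'i cpoly \<Rightarrow> 'r"
  where "substp h a f =
    (\<Sum>u\<in>Poly_Mapping.keys f. h (Poly_Mapping.lookup f u) *
       (\<Prod>i\<in>Poly_Mapping.keys u. a i ^ Poly_Mapping.lookup u i))"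

definition evalp :: "('i \<Rightarrow> complex) \<Rightarrow> 'i cpoly \<Rightarrow> complex"
  where "evalp = substp (\<lambda>c. c)"

abbreviation ideal_of_polys :: "'i cpoly set \<Rightarrow> bool"
  where "ideal_of_polys \<equiv> module.subspace (*)"

abbreviation ideal_generated :: "'i cpoly set \<Rightarrow> 'i cpoly set"
  where "ideal_generated \<equiv> module.span (*)"

text \<open>For complex linear subspaces \<open>W \<subseteq> V\<close>: the classes of the elements of \<open>B\<close> are pairwise
  distinct and form a finite basis of \<open>V / W\<close>; and \<open>V / W\<close> has dimension \<open>d\<close>.\<close>

definition quotient_basis :: "'i cpoly set \<Rightarrow> 'i cpoly set \<Rightarrow> 'i cpoly set \<Rightarrow> bool"
  where "quotient_basis V W B \<longleftrightarrow> finite B \<and> B \<subseteq> V \<and>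
    (\<forall>f\<in>V. \<exists>!c :: 'i cpoly \<Rightarrow> complex.
       (\<forall>b. b \<notin> B \<longrightarrow> c b = 0) \<and> f - (\<Sum>b\<in>B. constp (c b) * b) \<in> W)"

definition has_quotient_dim :: "'i cpoly set \<Rightarrow> 'i cpoly set \<Rightarrow> nat \<Rightarrow> bool"
  where "has_quotient_dim V W d \<longleftrightarrow> (\<exists>B. quotient_basis V W B \<and> card B = d)"

section \<open>Irreducible closed sets\<close>

definition irreducible_in :: "'a topology \<Rightarrow> 'a set \<Rightarrow> bool"
  where "irreducible_in X S \<longleftrightarrow> S \<subseteq> topspace X \<and> S \<noteq> {} \<and>
    (\<forall>C D. closedin X C \<and> closedin X D \<and> S \<subseteq> C \<union> D \<longrightarrow> S \<subseteq> C \<or> S \<subseteq> D)"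

definition irreducible_component_of :: "'a topology \<Rightarrow> 'a set \<Rightarrow> bool"
  where "irreducible_component_of X S \<longleftrightarrow> irreducible_in X S \<and>
    (\<forall>T. irreducible_in X T \<and> S \<subseteq> T \<longrightarrow> T = S)"

text \<open>Supremum of the lengths \<open>k\<close> of chains \<open>Z 0 \<subset> \<dots> \<subset> Z k\<close> of irreducible closed sets through
  \<open>p\<close>. For a variety this is the Krull dimension of the local ring at \<open>p\<close>.\<close>

definition local_dim :: "'a topology \<Rightarrow> 'a \<Rightarrow> enat"
  where "local_dim X p = Sup {enat k | k. \<exists>Z :: nat \<Rightarrow> 'a set.
    (\<forall>i\<le>k. closedin X (Z i) \<and> irreducible_in X (Z i) \<and> p \<in> Z i) \<and>
    (\<forall>i<k. Z i \<subset> Z (Suc i))}"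

section \<open>The Hilbert scheme of points\<close>

definition Hilb :: "nat \<Rightarrow> ('n::finite) cpoly set set"
  where "Hilb N = {I. ideal_of_polys I \<and> has_quotient_dim UNIV I N}"

text \<open>The standard affine charts: for a set \<open>B\<close> of \<open>N\<close> monomials, the ideals modulo which \<open>B\<close> is a
  basis. The coordinate indexed by \<open>(u, b)\<close> is the coefficient of \<open>b\<close> in the expansion of the
  monomial \<open>u\<close> in this basis. Finitely many of these functions generate the coordinate ring of
  the chart, and the others are polynomials in them.\<close>

definition Hilb_chart :: "nat \<Rightarrow> ('n::finite) monomial set \<Rightarrow> 'n cpoly set set"
  where "Hilb_chart N B = {I \<in> Hilb N. finite B \<and> card B = N \<and> quotient_basis UNIV I (monp ` B)}"

definition chart_coord ::
    "('n::finite) monomial set \<Rightarrow> 'n cpoly set \<Rightarrow> 'n monomial \<times> 'n monomial \<Rightarrow> complex"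
  where "chart_coord B I = (\<lambda>(u, b).
    (THE c :: 'n monomial \<Rightarrow> complex. (\<forall>b. b \<notin> B \<longrightarrow> c b = 0) \<and>
       monp u - (\<Sum>b\<in>B. Poly_Mapping.single b (c b)) \<in> I) b)"

definition chart_fun ::
    "('n::finite) monomial set \<Rightarrow> ('n monomial \<times> 'n monomial) cpoly \<Rightarrow> 'n cpoly set \<Rightarrow> complex"
  where "chart_fun B F I = evalp (chart_coord B I) F"

definition zariski_Hilb :: "nat \<Rightarrow> ('n::finite) cpoly set topology"
  where "zariski_Hilb N =
    topology_generated_by {{I \<in> Hilb_chart N B. chart_fun B F I \<noteq> 0} | B F. True}"

text \<open>For a closed subvariety \<open>Z\<close> of the Hilbert scheme and a point \<open>I\<close> of \<open>Z\<close> in the chart of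
  \<open>B\<close>, the coordinate ring of \<open>Z\<close> in this chart is \<open>P / J\<close>, where \<open>P\<close> is the ring of polynomials
  in the chart coordinates and \<open>J\<close> the ideal of those vanishing on \<open>Z\<close>. With \<open>M\<close> the ideal of
  \<open>I\<close> in \<open>P\<close>, the cotangent space of \<open>Z\<close> at \<open>I\<close> is \<open>M / (M^2 + J)\<close>; it does not change under
  localization at \<open>M\<close>.\<close>

definition has_cotangent_dim ::
    "nat \<Rightarrow> ('n::finite) cpoly set set \<Rightarrow> 'n monomial set \<Rightarrow> 'n cpoly set \<Rightarrow> nat \<Rightarrow> bool"
  where "has_cotangent_dim N Z B I d \<longleftrightarrow>
    (let M = {F. chart_fun B F I = 0};
         J = {F. \<forall>I' \<in> Z \<inter> Hilb_chart N B. chart_fun B F I' = 0}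
     in has_quotient_dim M (ideal_generated ({F * F' | F F'. F \<in> M \<and> F' \<in> M} \<union> J)) d)"

text \<open>Regularity of the local ring at every closed point, which over the complex numbers is
  smoothness. The charts cover, and the condition does not depend on the chart.\<close>

definition smooth_subvariety :: "nat \<Rightarrow> ('n::finite) cpoly set set \<Rightarrow> bool"
  where "smooth_subvariety N Z \<longleftrightarrow>
    (\<forall>I\<in>Z. \<forall>B. I \<in> Hilb_chart N B \<longrightarrow>
       (\<exists>d. has_cotangent_dim N Z B I d \<and> local_dim (subtopology (zariski_Hilb N) Z) I = enat d))"

section \<open>The \<open>G\<close>-Hilbert scheme\<close>

text \<open>\<open>A \<cdot> f = f \<circ> A\<inverse>\<close>, so that the induced action on ideals moves the zero set by \<open>A\<close>.\<close>

definition act_poly :: "complex^'n^'n \<Rightarrow> ('n::finite) cpoly \<Rightarrow> 'n cpoly"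
  where "act_poly A = substp constp (\<lambda>i. \<Sum>j\<in>UNIV. constp (matrix_inv A $ i $ j) * varp j)"

definition Hilb_fixed :: "(complex^'n^'n) set \<Rightarrow> ('n::finite) cpoly set set"
  where "Hilb_fixed G = {I \<in> Hilb (card G). \<forall>g\<in>G. act_poly g ` I = I}"

text \<open>Points of the symmetric product are effective zero-cycles, encoded by their multiplicity
  functions. The multiplicity of the Hilbert-Chow cycle of \<open>I\<close> at \<open>p\<close> is the dimension of the
  localization of the quotient ring at \<open>p\<close>. The localization map from the polynomial ring is
  surjective, since the quotient is Artinian, and \<open>local_kernel I p\<close> is its kernel.\<close>

definition local_kernel :: "('n::finite) cpoly set \<Rightarrow> complex^'n \<Rightarrow> 'n cpoly set"
  where "local_kernel I p = {f. \<exists>s. evalp (($) p) s \<noteq> 0 \<and> s * f \<in> I}"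

definition hilbert_chow :: "('n::finite) cpoly set \<Rightarrow> complex^'n \<Rightarrow> nat"
  where "hilbert_chow I = (\<lambda>p. THE d. has_quotient_dim UNIV (local_kernel I p) d)"

text \<open>The point of \<open>\<complex>\<^sup>n / G\<close> under \<open>p\<close>, as the cycle \<open>\<Sum>g\<in>G. [g p]\<close> in the symmetric product.\<close>

definition orbit_cycle :: "(complex^'n^'n) set \<Rightarrow> complex^'n \<Rightarrow> complex^('n::finite) \<Rightarrow> nat"
  where "orbit_cycle G p = (\<lambda>q. card {g \<in> G. g *v p = q})"

definition zariski_affine :: "(complex^('n::finite)) topology"
  where "zariski_affine = topology_generated_by {{p. evalp (($) p) f \<noteq> 0} | f. True}"

text \<open>The Hilbert-Chow morphism maps \<open>Z\<close> into \<open>\<complex>\<^sup>n / G\<close> with dense image. The Zariski topology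
  on the closed points of \<open>\<complex>\<^sup>n / G\<close> is the quotient topology.\<close>

definition dominates_quotient ::
    "(complex^'n^'n) set \<Rightarrow> ('n::finite) cpoly set set \<Rightarrow> bool"
  where "dominates_quotient G Z \<longleftrightarrow>
    hilbert_chow ` Z \<subseteq> range (orbit_cycle G) \<and>
    (\<forall>C \<subseteq> range (orbit_cycle G).
       closedin zariski_affine {p. orbit_cycle G p \<in> C} \<and> hilbert_chow ` Z \<subseteq> C \<longrightarrow>
       C = range (orbit_cycle G))"

definition G_Hilb :: "(complex^'n^'n) set \<Rightarrow> ('n::finite) cpoly set set"
  where "G_Hilb G = (THE Z.
    irreducible_component_of (subtopology (zariski_Hilb (card G)) (Hilb_fixed G)) Z \<and>
    dominates_quotient G Z)"

section \<open>Cyclic diagonal groups\<close>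

definition SL :: "(complex^'n^'n) monoid"
  where "SL = \<lparr>carrier = {A. det A = 1}, mult = (**), one = mat 1\<rparr>"

definition primitive_root_of_unity :: "nat \<Rightarrow> complex \<Rightarrow> bool"
  where "primitive_root_of_unity r \<epsilon> \<longleftrightarrow> r > 0 \<and> \<epsilon> ^ r = 1 \<and> (\<forall>k. 0 < k \<and> k < r \<longrightarrow> \<epsilon> ^ k \<noteq> 1)"

text \<open>The matrix \<open>1/r (a\<^sub>1, \<dots>, a\<^sub>n)\<close> for a primitive \<open>r\<close>-th root of unity \<open>\<epsilon>\<close>.\<close>

definition diag_root :: "complex \<Rightarrow> int^'n \<Rightarrow> complex^'n^('n::finite)"
  where "diag_root \<epsilon> a = (\<chi> i j. if i = j then \<epsilon> powi (a $ i) else 0)"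

end

theory Submission
  imports Defs
begin

text \<open>
  Let \<open>N = 2m\<close> and let \<open>x\<close> be the variable of weight 1. The fixed ideals modulo which
  \<open>1, x, \<dots>, x^(N-1)\<close> is a basis form an open subset of the fixed locus, isomorphic to affine space, which
  contains all free orbits with \<open>x \<noteq> 0\<close>; hence its closure is the dominating component. All ideals \<open>I\<close>
  in the closure have one-dimensional weight spaces, so \<open>I\<close> is determined by a function \<open>\<phi>\<close> on
  monomials, unique up to a scalar in every weight, that records the relations \<open>\<phi>(v) u - \<phi>(u) v \<in> I\<close>
  for monomials \<open>u, v\<close> of equal weight. The coordinates of every chart are ratios of values of \<open>\<phi>\<close>.

  Near the ideal \<open>(x^m, y^m, w, xy, z^2, zx, zy)\<close> the component is the hypersurface \<open>a h = b f\<close> in the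
  coordinates defined by \<open>x^m = a z, y^m = b z, w = c z, z x = f y^(m-1), z y = h x^(m-1)\<close>. It contains the five
  coordinate axes, so the cotangent space has dimension at least 5, whereas five coordinate functions are
  algebraically dependent on affine 4-space, which bounds the local dimension by 4.
\<close>

section \<open>Polynomials and finite quotients\<close>

text \<open>The equation \<open>a h = b f\<close> is never derived. All structure constants near the
  singular point are monomials in five parameters, the image of the parameter space lies in the
  component by continuity, and it contains a curve along each of the axes a, b, f, h, c.
  Differentiation along such a curve annihilates products of two functions vanishing at the point
  and all functions vanishing on the component; this is what makes the five coordinates independent
  in the cotangent space.

  The case m = 1 is a genuine exception: then G consists of 1 and -1, and the G-Hilbert scheme is
  the total space of the line bundle O(-2) over projective 3-space, which is smooth. In the family
  the restriction appears as z^2 = s1^(m-2) s2^m (t1 t2)^(m-1), a monomial only for m >= 2.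

  Since the component is specified by domination of the quotient, Hilbert-Chow cycles are needed for
  all of its ideals, including those over points with nontrivial stabilizer; the multiplicity is the
  order of the stabilizer.\<close>

abbreviation (input) lk where "lk \<equiv> Poly_Mapping.lookup"
abbreviation (input) mkeys where "mkeys \<equiv> Poly_Mapping.keys"
abbreviation (input) mterm where "mterm \<equiv> Poly_Mapping.single"

definition monev :: "('i \<Rightarrow> 'a::comm_monoid_mult) \<Rightarrow> 'i monomial \<Rightarrow> 'a"
  where "monev a u = (\<Prod>i\<in>mkeys u. a i ^ lk u i)"

text \<open>Linear extension of a function on monomials. Evaluation at a point and the weight
  functionals \<open>wpart\<close> are both of this form, so they share one set of linearity
  lemmas.\<close>

definition linf :: "('b \<Rightarrow> complex) \<Rightarrow> ('b \<Rightarrow>\<^sub>0 complex) \<Rightarrow> complex"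
  where "linf \<psi> f = (\<Sum>u\<in>mkeys f. lk f u * \<psi> u)"

lemma monev_superset:
  assumes "finite A" "mkeys u \<subseteq> A"
  shows "monev a u = (\<Prod>i\<in>A. a i ^ lk u i)"
  unfolding monev_def
  by (rule prod.mono_neutral_left) (use assms in \<open>auto simp: in_keys_iff\<close>)

lemma monev_add: "monev a (u + v) = monev a u * monev a v"
proof -
  let ?A = "mkeys u \<union> mkeys v"
  have "mkeys (u + v) \<subseteq> ?A" by (rule keys_add)
  then have "monev a (u + v) = (\<Prod>i\<in>?A. a i ^ lk (u + v) i)"
    by (intro monev_superset) auto
  also have "\<dots> = (\<Prod>i\<in>?A. a i ^ lk u i) * (\<Prod>i\<in>?A. a i ^ lk v i)"
    by (simp add: lookup_add power_add prod.distrib)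
  also have "\<dots> = monev a u * monev a v"
    by (subst (1 2) monev_superset[of ?A]) auto
  finally show ?thesis .
qed

lemma monev_0 [simp]: "monev a 0 = 1"
  by (simp add: monev_def)

lemma monev_single: "monev a (mterm i n) = a i ^ n"
  by (simp add: monev_def)

lemma monev_UNIV: "monev a u = (\<Prod>i\<in>UNIV. a i ^ lk u i)" for a :: "'i::finite \<Rightarrow> _"
  by (rule monev_superset) auto

lemma linf_superset:
  assumes "finite A" "mkeys f \<subseteq> A"
  shows "linf \<psi> f = (\<Sum>u\<in>A. lk f u * \<psi> u)"
  unfolding linf_def
  by (rule sum.mono_neutral_left) (use assms in \<open>auto simp: in_keys_iff\<close>)

lemma linf_add: "linf \<psi> (f + g) = linf \<psi> f + linf \<psi> g"
proof -
  let ?A = "mkeys f \<union> mkeys g"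
  have "mkeys (f + g) \<subseteq> ?A" by (rule keys_add)
  then have "linf \<psi> (f + g) = (\<Sum>i\<in>?A. lk (f + g) i * \<psi> i)"
    by (intro linf_superset) auto
  also have "\<dots> = (\<Sum>i\<in>?A. lk f i * \<psi> i) + (\<Sum>i\<in>?A. lk g i * \<psi> i)"
    by (simp add: lookup_add algebra_simps sum.distrib)
  also have "\<dots> = linf \<psi> f + linf \<psi> g"
    by (subst (1 2) linf_superset[of ?A]) auto
  finally show ?thesis .
qed

lemma linf_zero [simp]: "linf \<psi> 0 = 0"
  by (simp add: linf_def)

lemma linf_single [simp]: "linf \<psi> (mterm u c) = c * \<psi> u"
  by (simp add: linf_def)

lemma linf_uminus: "linf \<psi> (- f) = - linf \<psi> f"
  using linf_add[of \<psi> f "-f"] by (simp add: add_eq_0_iff)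

lemma linf_diff: "linf \<psi> (f - g) = linf \<psi> f - linf \<psi> g"
  using linf_add[of \<psi> f "-g"] by (simp add: linf_uminus)

lemma linf_sum: "linf \<psi> (\<Sum>i\<in>A. f i) = (\<Sum>i\<in>A. linf \<psi> (f i))"
  by (induction A rule: infinite_finite_induct) (auto simp: linf_add)

lemma linf_cmult_fun: "linf (\<lambda>u. c * \<psi> u) f = c * linf \<psi> f"
  by (simp add: linf_def sum_distrib_left mult_ac)

lemma poly_eq_sum: "(f :: 'b \<Rightarrow>\<^sub>0 complex) = (\<Sum>u\<in>mkeys f. mterm u (lk f u))"
proof (rule poly_mapping_eqI)
  fix k
  show "lk f k = lk (\<Sum>u\<in>mkeys f. mterm u (lk f u)) k"
    by (cases "k \<in> mkeys f") (auto simp: lookup_sum lookup_single when_def in_keys_iff)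
qed

lemma poly_induct [case_names single add]:
  assumes "\<And>u c. P (mterm u c)" "\<And>f g. P f \<Longrightarrow> P g \<Longrightarrow> P (f + g)"
  shows "P (f :: 'b \<Rightarrow>\<^sub>0 complex)"
proof -
  have "P (\<Sum>u\<in>A. mterm u (lk f u))" if "finite A" for A
    using that by (induction A rule: finite_induct)
      (use assms(1)[of undefined 0] in \<open>auto intro: assms\<close>)
  from this[of "mkeys f"] show ?thesis
    using poly_eq_sum[of f] by simp
qed

text \<open>Multiplication by a term translates the functional. Multiplicativity of evaluation and
  the ideal property of \<open>gid\<close> both rest on this.\<close>

lemma linf_monom_mult:
  "linf \<psi> (mterm v c * f) = c * linf (\<lambda>u. \<psi> (v + u)) f"
  by (induction f rule: poly_induct) (simp_all add: mult_single distrib_left linf_add)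

lemma evalp_linf: "evalp a f = linf (monev a) f"
  by (simp add: evalp_def substp_def linf_def monev_def)

lemma evalp_single [simp]: "evalp a (mterm u c) = c * monev a u"
  by (simp add: evalp_linf)

lemma evalp_add: "evalp a (f + g) = evalp a f + evalp a g"
  by (simp add: evalp_linf linf_add)

lemma evalp_diff: "evalp a (f - g) = evalp a f - evalp a g"
  by (simp add: evalp_linf linf_diff)

lemma evalp_mult: "evalp a (f * g) = evalp a f * evalp a g"
proof (induction f rule: poly_induct)
  case (single u c)
  show ?case
    by (simp add: evalp_linf linf_monom_mult monev_add linf_cmult_fun)
next
  case (add f f')
  then show ?case by (simp add: distrib_right evalp_add)
qed

lemma evalp_1 [simp]: "evalp a 1 = 1"
  using evalp_single[of a 0 1] by simp

lemma evalp_0 [simp]: "evalp a 0 = 0"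
  by (simp add: evalp_linf)

lemma evalp_sum: "evalp a (\<Sum>i\<in>A. f i) = (\<Sum>i\<in>A. evalp a (f i))"
  by (simp add: evalp_linf linf_sum)

lemma evalp_prod: "evalp a (\<Prod>i\<in>A. f i) = (\<Prod>i\<in>A. evalp a (f i))"
  by (induction A rule: infinite_finite_induct) (auto simp: evalp_mult)

lemma evalp_power: "evalp a (f ^ n) = evalp a f ^ n"
  by (induction n) (auto simp: evalp_mult)

lemma monp_power: "monp u ^ n = (monp (\<Sum>_<n. u) :: 'i cpoly)" for u :: "'i monomial"
  by (induction n) (auto simp: mult_single add.commute)

subsection \<open>Algebras of functions\<close>

text \<open>A notion of regular functions of a parameter \<open>s\<close> that asks only for closure
  under the ring operations. It covers polynomials in a point, chart functions, fractions with a
  fixed denominator, and functions differentiable at 0.\<close>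

definition fun_alg :: "('s \<Rightarrow> complex) set \<Rightarrow> bool"
  where "fun_alg R \<longleftrightarrow> (\<forall>c. (\<lambda>_. c) \<in> R) \<and>
    (\<forall>f\<in>R. \<forall>g\<in>R. (\<lambda>s. f s + g s) \<in> R \<and> (\<lambda>s. f s * g s) \<in> R)"

lemma fun_alg_const: "fun_alg R \<Longrightarrow> (\<lambda>_. c) \<in> R"
  by (simp add: fun_alg_def)

lemma fun_alg_add: "fun_alg R \<Longrightarrow> f \<in> R \<Longrightarrow> g \<in> R \<Longrightarrow> (\<lambda>s. f s + g s) \<in> R"
  by (simp add: fun_alg_def)

lemma fun_alg_mult: "fun_alg R \<Longrightarrow> f \<in> R \<Longrightarrow> g \<in> R \<Longrightarrow> (\<lambda>s. f s * g s) \<in> R"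
  by (simp add: fun_alg_def)

lemma fun_alg_power: "fun_alg R \<Longrightarrow> f \<in> R \<Longrightarrow> (\<lambda>s. f s ^ n) \<in> R"
  by (induction n) (auto intro: fun_alg_const fun_alg_mult)

lemma fun_alg_sum: "fun_alg R \<Longrightarrow> (\<And>i. i \<in> A \<Longrightarrow> f i \<in> R) \<Longrightarrow> (\<lambda>s. \<Sum>i\<in>A. f i s) \<in> R"
  by (induction A rule: infinite_finite_induct) (auto intro: fun_alg_const fun_alg_add)

lemma fun_alg_prod: "fun_alg R \<Longrightarrow> (\<And>i. i \<in> A \<Longrightarrow> f i \<in> R) \<Longrightarrow> (\<lambda>s. \<Prod>i\<in>A. f i s) \<in> R"
  by (induction A rule: infinite_finite_induct) (auto intro: fun_alg_const fun_alg_mult)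

lemma fun_alg_evalp:
  assumes "fun_alg R" "\<And>i. (\<lambda>s. a s i) \<in> R"
  shows "(\<lambda>s. evalp (a s) F) \<in> R"
  unfolding evalp_linf linf_def monev_def
  by (intro fun_alg_sum fun_alg_mult fun_alg_const fun_alg_prod fun_alg_power assms)

lemma fun_alg_polys: "fun_alg (range (\<lambda>F s. evalp (a s) F))"
  unfolding fun_alg_def
proof (intro conjI allI ballI)
  fix c show "(\<lambda>_. c) \<in> range (\<lambda>F s. evalp (a s) F)"
    by (rule range_eqI[of _ _ "constp c"]) simp
next
  fix f g assume "f \<in> range (\<lambda>F s. evalp (a s) F)" "g \<in> range (\<lambda>F s. evalp (a s) F)"
  then obtain F G where [simp]: "f = (\<lambda>s. evalp (a s) F)" "g = (\<lambda>s. evalp (a s) G)" by auto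
  show "(\<lambda>s. f s + g s) \<in> range (\<lambda>F s. evalp (a s) F)"
    by (rule range_eqI[of _ _ "F + G"]) (simp add: evalp_add)
  show "(\<lambda>s. f s * g s) \<in> range (\<lambda>F s. evalp (a s) F)"
    by (rule range_eqI[of _ _ "F * G"]) (simp add: evalp_mult)
qed

text \<open>No interpretation: its simp rule \<open>scale_scale\<close> would reassociate every product.\<close>

lemma module_mult: "module ((*) :: 'a::comm_ring_1 \<Rightarrow> 'a \<Rightarrow> 'a)"
  by unfold_locales (auto simp: algebra_simps)

lemma ideal_monomialI:
  fixes I :: "'i cpoly set"
  assumes "0 \<in> I" "\<And>f g. f \<in> I \<Longrightarrow> g \<in> I \<Longrightarrow> f + g \<in> I"
    and "\<And>u c f. f \<in> I \<Longrightarrow> mterm u c * f \<in> I"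
  shows "ideal_of_polys I"
proof (rule module.subspaceI[OF module_mult])
  fix h f :: "'i cpoly" assume f: "f \<in> I"
  show "h * f \<in> I"
    by (induction h rule: poly_induct) (auto simp: distrib_right assms f)
qed (use assms in auto)

lemmas ideal_0 = module.subspace_0[OF module_mult]
lemmas ideal_add = module.subspace_add[OF module_mult]
lemmas ideal_diff = module.subspace_diff[OF module_mult]
lemmas ideal_sum = module.subspace_sum[OF module_mult]
lemmas ideal_mult = module.subspace_scale[OF module_mult]

lemma ideal_eq_UNIV: "ideal_of_polys I \<Longrightarrow> 1 \<in> I \<Longrightarrow> I = UNIV"
  using ideal_mult[of I 1] by auto

lemma ideal_const_cancel:
  assumes "ideal_of_polys I" "c \<noteq> 0" "constp c * f \<in> I"
  shows "f \<in> I"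
proof -
  have "constp (inverse c) * (constp c * f) = f"
    using assms(2) by (simp add: mult.assoc[symmetric] mult_single)
  then show ?thesis using ideal_mult[OF assms(1,3), of "constp (inverse c)"] by simp
qed

lemma ideal_colon:
  assumes "ideal_of_polys I"
  shows "ideal_of_polys {f. f * h \<in> I}"
  by (rule module.subspaceI[OF module_mult])
    (auto simp: distrib_right mult.assoc intro: ideal_0 ideal_add ideal_mult assms)

subsection \<open>Bases of quotients\<close>

text \<open>Gaussian elimination on the equations \<open>B\<close>: unless the equation
  \<open>b0\<close> is trivial, an unknown with nonzero coefficient in it is eliminated from the
  others, and its value is recovered at the end.\<close>

lemma homogeneous_system_solution:
  fixes M :: "'a \<Rightarrow> 'b \<Rightarrow> complex"
  assumes "finite B" "finite A" "card B < card A"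
  shows "\<exists>c. (\<exists>a\<in>A. c a \<noteq> 0) \<and> (\<forall>b\<in>B. (\<Sum>a\<in>A. c a * M a b) = 0)"
  using assms
proof (induction B arbitrary: A M rule: finite_induct)
  case empty
  then have "A \<noteq> {}" by auto
  then show ?case by (intro exI[of _ "\<lambda>_. 1"]) auto
next
  case (insert b0 B)
  show ?case
  proof (cases "\<forall>a\<in>A. M a b0 = 0")
    case True
    have "card B < card A" using insert by auto
    from insert.IH[OF insert.prems(1) this, of M] True show ?thesis by auto
  next
    case False
    then obtain a0 where a0: "a0 \<in> A" "M a0 b0 \<noteq> 0" by auto
    define A' where "A' = A - {a0}"
    define M' where "M' = (\<lambda>a b. M a b - M a b0 / M a0 b0 * M a0 b)"
    have "card B < card A'" "finite A'"
      using insert a0 by (auto simp: A'_def)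
    then obtain c where c: "\<exists>a\<in>A'. c a \<noteq> 0" "\<forall>b\<in>B. (\<Sum>a\<in>A'. c a * M' a b) = 0"
      using insert.IH[of A' M'] by auto
    define c0 where "c0 = - (\<Sum>a\<in>A'. c a * (M a b0 / M a0 b0))"
    define d where "d = (\<lambda>a. if a = a0 then c0 else c a)"
    have split: "(\<Sum>a\<in>A. d a * M a b) = c0 * M a0 b + (\<Sum>a\<in>A'. c a * M a b)" for b
    proof -
      have "(\<Sum>a\<in>A. d a * M a b) = d a0 * M a0 b + (\<Sum>a\<in>A'. d a * M a b)"
        unfolding A'_def using a0 insert by (intro sum.remove) auto
      also have "(\<Sum>a\<in>A'. d a * M a b) = (\<Sum>a\<in>A'. c a * M a b)"
        by (intro sum.cong) (auto simp: d_def A'_def)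
      finally show ?thesis by (simp add: d_def)
    qed
    have eq: "c0 * M a0 b + (\<Sum>a\<in>A'. c a * M a b) = (\<Sum>a\<in>A'. c a * M' a b)" for b
      unfolding c0_def M'_def
      by (simp only: right_diff_distrib sum_subtractf sum_distrib_right mult.assoc
          minus_mult_left[symmetric]) simp
    have "(\<Sum>a\<in>A. d a * M a b) = 0" if "b \<in> insert b0 B" for b
      unfolding split eq using that c(2) a0 by (auto simp: M'_def)
    moreover have "\<exists>a\<in>A. d a \<noteq> 0" using c(1) by (auto simp: d_def A'_def)
    ultimately show ?thesis by (intro exI[of _ d]) auto
  qed
qed

text \<open>The vectors form an indexed family, so repetitions among the \<open>f a\<close> are
  allowed. Expansion in the basis \<open>B\<close> turns a dependence modulo \<open>W\<close> into a
  homogeneous system with more unknowns than equations.\<close>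

lemma quotient_basis_dependent:
  assumes "quotient_basis V W B" "ideal_of_polys W" "finite A" "\<And>a. a \<in> A \<Longrightarrow> f a \<in> V"
    and "card B < card A"
  shows "\<exists>c. (\<exists>a\<in>A. c a \<noteq> 0) \<and> (\<Sum>a\<in>A. constp (c a) * f a) \<in> W"
proof -
  have finB: "finite B" using assms(1) by (simp add: quotient_basis_def)
  have "\<exists>c :: _ \<Rightarrow> complex. f a - (\<Sum>b\<in>B. constp (c b) * b) \<in> W" if "a \<in> A" for a
  proof -
    have "\<exists>!c. (\<forall>b. b \<notin> B \<longrightarrow> c b = 0) \<and> f a - (\<Sum>b\<in>B. constp (c b) * b) \<in> W"
      using assms(1) assms(4)[OF that] by (simp add: quotient_basis_def)
    then show ?thesis by (elim ex1E conjE) (rule exI)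
  qed
  then have "\<forall>a\<in>A. \<exists>c :: _ \<Rightarrow> complex. f a - (\<Sum>b\<in>B. constp (c b) * b) \<in> W" by (rule ballI)
  from bchoice[OF this] obtain M
    where M: "\<forall>a\<in>A. f a - (\<Sum>b\<in>B. constp (M a b) * b) \<in> W" by (rule exE)
  obtain c where c: "\<exists>a\<in>A. c a \<noteq> 0" "\<forall>b\<in>B. (\<Sum>a\<in>A. c a * M a b) = 0"
    using homogeneous_system_solution[OF finB assms(3,5), of M] by (elim exE conjE) 
  have W: "(\<Sum>a\<in>A. constp (c a) * (f a - (\<Sum>b\<in>B. constp (M a b) * b))) \<in> W"
    by (intro ideal_sum[OF assms(2)] ideal_mult[OF assms(2)] M[rule_format])
  have cs: "(\<Sum>a\<in>A. constp (c a) * (constp (M a b) * b)) = constp (\<Sum>a\<in>A. c a * M a b) * b" for b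
  proof -
    have h: "constp (\<Sum>a\<in>A. c a * M a b) = (\<Sum>a\<in>A. constp (c a * M a b))"
      by (induction A rule: infinite_finite_induct) (auto simp: single_add)
    show ?thesis
      by (simp only: h sum_distrib_right mult.assoc[symmetric] mult_single add_0)
  qed
  have "(\<Sum>a\<in>A. constp (c a) * (\<Sum>b\<in>B. constp (M a b) * b)) =
      (\<Sum>b\<in>B. \<Sum>a\<in>A. constp (c a) * (constp (M a b) * b))"
    unfolding sum_distrib_left by (rule sum.swap)
  also have "\<dots> = 0" unfolding cs using c(2) by simp
  finally have "(\<Sum>a\<in>A. constp (c a) * (f a - (\<Sum>b\<in>B. constp (M a b) * b))) =
      (\<Sum>a\<in>A. constp (c a) * f a)"
    by (simp only: right_diff_distrib sum_subtractf) simp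
  with W c(1) show ?thesis by (intro exI[of _ c] conjI) (simp_all only:)
qed

lemma quotient_basis_independent:
  assumes "quotient_basis V W B" "0 \<in> V" "0 \<in> W" "(\<Sum>b\<in>B. constp (c b) * b) \<in> W" "ideal_of_polys W" "b \<in> B"
  shows "c b = 0"
proof -
  let ?P = "\<lambda>c. (\<forall>b. b \<notin> B \<longrightarrow> c b = (0::complex)) \<and> 0 - (\<Sum>b\<in>B. constp (c b) * b) \<in> W"
  define c' where "c' = (\<lambda>b. if b \<in> B then c b else 0)"
  have "(\<Sum>b\<in>B. constp (c' b) * b) = (\<Sum>b\<in>B. constp (c b) * b)"
    by (intro sum.cong) (auto simp: c'_def)
  then have P1: "?P c'" using ideal_diff[OF assms(5,3,4)] by (auto simp: c'_def)
  have P2: "?P (\<lambda>_. 0)" using assms(3) by auto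
  have ex: "\<exists>!c. ?P c" using assms(1,2) by (simp only: quotient_basis_def)
  have "c' = (\<lambda>_. 0)"
    by (rule trans[OF sym[OF the1_equality[of ?P, OF ex P1]] the1_equality[of ?P, OF ex P2]])
  then show ?thesis using assms(6) by (metis c'_def)
qed

lemma quotient_basis_card_le:
  assumes "quotient_basis V W B" "quotient_basis V W B'" "0 \<in> V" "ideal_of_polys W"
  shows "card B' \<le> card B"
proof (rule ccontr)
  assume "\<not> ?thesis"
  then obtain c where "\<exists>b\<in>B'. c b \<noteq> 0" "(\<Sum>b\<in>B'. constp (c b) * b) \<in> W"
    using quotient_basis_dependent[OF assms(1,4), of B' "\<lambda>b. b"] assms(2)
    unfolding quotient_basis_def by auto
  then show False
    using quotient_basis_independent[OF assms(2,3) _ _ assms(4)] ideal_0[OF assms(4)] by blast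
qed

lemma has_quotient_dim_unique:
  assumes "has_quotient_dim V W d" "has_quotient_dim V W d'" "0 \<in> V" "ideal_of_polys W"
  shows "d = d'"
  using assms quotient_basis_card_le unfolding has_quotient_dim_def by (metis le_antisym)

text \<open>An element of \<open>I'\<close> outside \<open>I\<close>, added to a basis modulo
  \<open>I'\<close>, would give N + 1 independent classes modulo \<open>I\<close>.\<close>

lemma Hilb_subset_eq:
  assumes "I \<in> Hilb N" "I' \<in> Hilb N" "I \<subseteq> I'"
  shows "I = I'"
proof (rule ccontr)
  assume "I \<noteq> I'"
  then obtain f where f: "f \<in> I'" "f \<notin> I" using assms(3) by auto
  have id: "ideal_of_polys I" "ideal_of_polys I'" using assms by (auto simp: Hilb_def)
  obtain B B' where B: "quotient_basis UNIV I B" "card B = N"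
    and B': "quotient_basis UNIV I' B'" "card B' = N"
    using assms by (auto simp: Hilb_def has_quotient_dim_def)
  have fin: "finite B'" using B' by (auto simp: quotient_basis_def)
  obtain c where c: "\<exists>a\<in>insert None (Some ` B'). c a \<noteq> 0"
    "(\<Sum>a\<in>insert None (Some ` B'). constp (c a) * (case a of None \<Rightarrow> f | Some b \<Rightarrow> b)) \<in> I"
    using quotient_basis_dependent[OF B(1) id(1), of "insert None (Some ` B')"
        "\<lambda>a. case a of None \<Rightarrow> f | Some b \<Rightarrow> b"] fin B(2) B'(2)
    by (auto simp: card_image)
  have "(\<Sum>a\<in>insert None (Some ` B'). constp (c a) * (case a of None \<Rightarrow> f | Some b \<Rightarrow> b)) =
    constp (c None) * f + (\<Sum>b\<in>B'. constp (c (Some b)) * b)"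
    using fin by (subst sum.insert) (auto simp: sum.reindex)
  then have s: "constp (c None) * f + (\<Sum>b\<in>B'. constp (c (Some b)) * b) \<in> I" using c(2) by simp
  then have "constp (c None) * f + (\<Sum>b\<in>B'. constp (c (Some b)) * b) \<in> I'" using assms(3) by auto
  then have "(\<Sum>b\<in>B'. constp (c (Some b)) * b) \<in> I'"
    using ideal_diff[OF id(2) _ ideal_mult[OF id(2) f(1), of "constp (c None)"]] by fastforce
  then have z: "c (Some b) = 0" if "b \<in> B'" for b
    using quotient_basis_independent[OF B'(1) _ _ _ id(2) that, of "\<lambda>b. c (Some b)"] ideal_0[OF id(2)]
    by auto
  then have "c None \<noteq> 0" using c(1) by auto
  moreover have "constp (c None) * f \<in> I" using s z by simp
  ultimately show False using ideal_const_cancel[OF id(1)] f(2) by auto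
qed

lemma monp_eq_iff [simp]: "monp u = (monp v :: 'i cpoly) \<longleftrightarrow> u = v"
  by (metis keys_single one_neq_zero singleton_inject)

lemma inj_monp: "inj_on (monp :: 'i monomial \<Rightarrow> 'i cpoly) A"
  by (auto simp: inj_on_def)

lemma ex1_transfer:
  assumes "\<And>x. P x \<Longrightarrow> Q (f x)" "\<And>y. Q y \<Longrightarrow> P (g y)"
    and "\<And>x. P x \<Longrightarrow> g (f x) = x" "\<And>y. Q y \<Longrightarrow> f (g y) = y"
  shows "(\<exists>!x. P x) \<longleftrightarrow> (\<exists>!y. Q y)"
proof
  assume "\<exists>!x. P x"
  then obtain x where x: "P x" "\<And>x'. P x' \<Longrightarrow> x' = x" by auto
  show "\<exists>!y. Q y"
  proof (rule ex1I)
    show "Q (f x)" by (rule assms(1)[OF x(1)])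
    fix y assume "Q y"
    then show "y = f x" using assms(2,4) x(2) by force
  qed
next
  assume "\<exists>!y. Q y"
  then obtain y where y: "Q y" "\<And>y'. Q y' \<Longrightarrow> y' = y" by auto
  show "\<exists>!x. P x"
  proof (rule ex1I)
    show "P (g y)" by (rule assms(2)[OF y(1)])
    fix x assume "P x"
    then show "x = g y" using assms(1,3) y(2) by force
  qed
qed

text \<open>\<open>quotient_basis\<close> takes coefficients indexed by polynomials, the chart
  coordinates take them indexed by monomials; unique existence is transported between the two along
  the injection \<open>monp\<close>.\<close>

lemma quotient_basis_monp:
  "quotient_basis UNIV I (monp ` B) \<longleftrightarrow> finite B \<and>
    (\<forall>f. \<exists>!c. (\<forall>b. b \<notin> B \<longrightarrow> c b = 0) \<and> f - (\<Sum>b\<in>B. mterm b (c b)) \<in> I)"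
    (is "_ \<longleftrightarrow> _ \<and> (\<forall>f. Ex1 (?Q f))")
proof -
  let ?m = "monp :: 'a monomial \<Rightarrow> 'a cpoly"
  let ?P = "\<lambda>f c. (\<forall>p. p \<notin> ?m ` B \<longrightarrow> c p = (0::complex)) \<and>
      f - (\<Sum>p\<in>?m ` B. constp (c p) * p) \<in> I"
  let ?g = "\<lambda>c p. if p \<in> ?m ` B then c (the_inv_into B ?m p) else (0::complex)"
  have inv: "the_inv_into B ?m (?m b) = b" if "b \<in> B" for b
    using that by (intro the_inv_into_f_f inj_monp)
  have s: "(\<Sum>p\<in>?m ` B. constp (c p) * p) = (\<Sum>b\<in>B. mterm b (c (?m b)))" for c
    by (subst sum.reindex[OF inj_monp]) (simp add: mult_single)
  have s2: "(\<Sum>p\<in>?m ` B. constp (?g c p) * p) = (\<Sum>b\<in>B. mterm b (c b))" for c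
    unfolding s by (intro sum.cong) (auto simp: inv)
  have "Ex1 (?P f) \<longleftrightarrow> Ex1 (?Q f)" for f
  proof (rule ex1_transfer[where f = "\<lambda>c b. c (?m b)" and g = ?g])
    fix c assume P: "?P f c"
    have "\<And>b. b \<notin> B \<Longrightarrow> ?m b \<notin> ?m ` B" by auto
    then show "?Q f (\<lambda>b. c (?m b))" using P by (auto simp: s)
    show "?g (\<lambda>b. c (?m b)) = c" using P by (auto simp: inv fun_eq_iff)
  next
    fix c assume Q: "?Q f c"
    show "?P f (?g c)" using Q s2[of c] by auto
    have "\<And>b. b \<notin> B \<Longrightarrow> ?m b \<notin> ?m ` B" by auto
    then show "(\<lambda>b. ?g c (?m b)) = c" using Q by (auto simp: inv fun_eq_iff)
  qed
  then show ?thesis unfolding quotient_basis_def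
    using finite_image_iff[OF inj_monp[of B]] by auto
qed

section \<open>Zariski topologies\<close>

lemma irreducible_in_meet:
  assumes "irreducible_in X S" "openin X U" "openin X V" "U \<inter> S \<noteq> {}" "V \<inter> S \<noteq> {}"
  shows "U \<inter> V \<inter> S \<noteq> {}"
proof
  assume e: "U \<inter> V \<inter> S = {}"
  have "closedin X (topspace X - U)" "closedin X (topspace X - V)" using assms by auto
  moreover have "S \<subseteq> (topspace X - U) \<union> (topspace X - V)"
    using e assms(1) by (auto simp: irreducible_in_def)
  ultimately show False using assms unfolding irreducible_in_def by blast
qed

lemma irreducible_inI:
  assumes "S \<subseteq> topspace X" "S \<noteq> {}"
    and "\<And>U V. openin X U \<Longrightarrow> openin X V \<Longrightarrow> U \<inter> S \<noteq> {} \<Longrightarrow> V \<inter> S \<noteq> {} \<Longrightarrow> U \<inter> V \<inter> S \<noteq> {}"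
  shows "irreducible_in X S"
  unfolding irreducible_in_def
proof (intro conjI allI impI)
  fix C D assume CD: "closedin X C \<and> closedin X D \<and> S \<subseteq> C \<union> D"
  show "S \<subseteq> C \<or> S \<subseteq> D"
  proof (rule ccontr)
    assume "\<not> ?thesis"
    then have "(topspace X - C) \<inter> S \<noteq> {}" "(topspace X - D) \<inter> S \<noteq> {}" using assms(1) by auto
    moreover have "openin X (topspace X - C)" "openin X (topspace X - D)" using CD by auto
    ultimately show False using assms(3)[of "topspace X - C" "topspace X - D"] CD by blast
  qed
qed (use assms in auto)

lemma irreducible_in_closure_of:
  assumes "irreducible_in X S"
  shows "irreducible_in X (X closure_of S)"
proof (rule irreducible_inI)
  have "S \<subseteq> X closure_of S" using assms by (intro closure_of_subset) (auto simp: irreducible_in_def)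
  then show "X closure_of S \<noteq> {}" using assms by (auto simp: irreducible_in_def)
  fix U V assume UV: "openin X U" "openin X V" "U \<inter> X closure_of S \<noteq> {}" "V \<inter> X closure_of S \<noteq> {}"
  then have "U \<inter> S \<noteq> {}" "V \<inter> S \<noteq> {}"
    using openin_Int_closure_of_eq_empty by metis+
  then have "U \<inter> V \<inter> S \<noteq> {}" using irreducible_in_meet[OF assms UV(1,2)] by auto
  then show "U \<inter> V \<inter> X closure_of S \<noteq> {}" using \<open>S \<subseteq> X closure_of S\<close> by blast
qed (rule closure_of_subset_topspace)

lemma irreducible_in_image:
  assumes "irreducible_in X S" "continuous_map X Y f"
  shows "irreducible_in Y (f ` S)"
proof (rule irreducible_inI)
  show "f ` S \<subseteq> topspace Y" "f ` S \<noteq> {}"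
    using assms continuous_map_image_subset_topspace[OF assms(2)] by (auto simp: irreducible_in_def)
  fix U V assume UV: "openin Y U" "openin Y V" "U \<inter> f ` S \<noteq> {}" "V \<inter> f ` S \<noteq> {}"
  let ?p = "\<lambda>U. {x \<in> topspace X. f x \<in> U}"
  have "openin X (?p U)" "openin X (?p V)"
    using openin_continuous_map_preimage[OF assms(2)] UV by blast+
  moreover have "?p U \<inter> S \<noteq> {}" "?p V \<inter> S \<noteq> {}"
    using UV assms(1) by (auto simp: irreducible_in_def)
  ultimately have "?p U \<inter> ?p V \<inter> S \<noteq> {}" using irreducible_in_meet[OF assms(1)] by blast
  then show "U \<inter> V \<inter> f ` S \<noteq> {}" by auto
qed

lemma irreducible_in_subset_closure_of:
  assumes "irreducible_in X T" "openin X U" "T \<inter> U \<noteq> {}"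
  shows "T \<subseteq> X closure_of (T \<inter> U)"
proof
  fix x assume x: "x \<in> T"
  show "x \<in> X closure_of (T \<inter> U)"
    unfolding in_closure_of
  proof (intro conjI allI impI)
    show "x \<in> topspace X" using assms(1) x by (auto simp: irreducible_in_def)
    fix V assume V: "x \<in> V \<and> openin X V"
    then have "V \<inter> U \<inter> T \<noteq> {}"
      using irreducible_in_meet[OF assms(1), of V U] assms x by blast
    then show "\<exists>y. y \<in> T \<inter> U \<and> y \<in> V" by auto
  qed
qed

text \<open>Reduces topological statements to algebraic ones along a family \<open>h\<close>: finite
  intersections of open sets correspond to products of nonvanishing conditions, so only the
  generating sets need to be examined.\<close>

lemma generated_open_nonvanishing:
  assumes "openin (topology_generated_by \<S>) W" "fun_alg R" "s1 \<in> S" "h s1 \<in> W"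
    and basis: "\<And>U s. U \<in> \<S> \<Longrightarrow> s \<in> S \<Longrightarrow> h s \<in> U \<Longrightarrow> \<exists>r\<in>R. r s \<noteq> 0 \<and> (\<forall>t\<in>S. r t \<noteq> 0 \<longrightarrow> h t \<in> U)"
  shows "\<exists>r\<in>R. r s1 \<noteq> 0 \<and> (\<forall>t\<in>S. r t \<noteq> 0 \<longrightarrow> h t \<in> W)"
proof -
  have "generate_topology_on \<S> W"
    using assms(1) by (simp add: openin_topology_generated_by_iff)
  then show ?thesis using assms(4)
  proof induction
    case (Int a b)
    obtain r r' where r: "r \<in> R" "r s1 \<noteq> 0" "\<forall>t\<in>S. r t \<noteq> 0 \<longrightarrow> h t \<in> a"
      and r': "r' \<in> R" "r' s1 \<noteq> 0" "\<forall>t\<in>S. r' t \<noteq> 0 \<longrightarrow> h t \<in> b"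
      using Int by auto
    have "(\<lambda>t. r t * r' t) \<in> R" using r r' assms(2) by (intro fun_alg_mult)
    then show ?case using r r' by (intro bexI[of _ "\<lambda>t. r t * r' t"]) auto
  next
    case (UN K)
    then obtain k where k: "k \<in> K" "h s1 \<in> k" by auto
    with UN.IH[OF k] obtain r where "r \<in> R" "r s1 \<noteq> 0" "\<forall>t\<in>S. r t \<noteq> 0 \<longrightarrow> h t \<in> k" by auto
    then show ?case using k by (intro bexI[of _ r]) auto
  next
    case (Basis U)
    then show ?case using basis assms(3) by blast
  qed auto
qed

text \<open>On the line through \<open>p\<close> and \<open>q\<close> both polynomials become
  nonzero polynomials in one variable \<open>t\<close> (look at \<open>t = 0\<close> and
  \<open>t = 1\<close>), and their product has only finitely many zeros.\<close>

lemma evalp_common_nonvanishing: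
  fixes p q :: "complex^'n::finite"
  assumes "evalp (($) p) f \<noteq> 0" "evalp (($) q) g \<noteq> 0"
  shows "\<exists>r :: complex^'n. evalp (($) r) f \<noteq> 0 \<and> evalp (($) r) g \<noteq> 0"
proof -
  let ?l = "\<lambda>t. \<chi> i. p $ i + t * (q $ i - p $ i)"
  let ?R = "range (poly :: complex poly \<Rightarrow> _)"
  have R: "fun_alg ?R"
    unfolding fun_alg_def
  proof (intro conjI allI ballI)
    fix c :: complex show "(\<lambda>_. c) \<in> ?R" by (rule range_eqI[of _ _ "[:c:]"]) auto
    fix f g assume "f \<in> ?R" "g \<in> ?R"
    then obtain P Q where "f = poly P" "g = poly Q" by auto
    then have "(\<lambda>s. f s + g s) = poly (P + Q)" "(\<lambda>s. f s * g s) = poly (P * Q)"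
      by (simp_all add: fun_eq_iff)
    then show "(\<lambda>s. f s + g s) \<in> ?R" "(\<lambda>s. f s * g s) \<in> ?R"
      by (simp_all only: rangeI)
  qed
  have "(\<lambda>t. evalp (($) (?l t)) F) \<in> ?R" for F :: "'n cpoly"
  proof (rule fun_alg_evalp[OF R])
    fix i show "(\<lambda>s. (\<chi> i. p $ i + s * (q $ i - p $ i)) $ i) \<in> ?R"
      by (rule range_eqI[of _ _ "[:p $ i, q $ i - p $ i:]"]) auto
  qed
  then have "\<exists>P. \<forall>t. evalp (($) (?l t)) F = poly P t" for F :: "'n cpoly"
    unfolding image_iff fun_eq_iff by blast
  then have "\<forall>F :: 'n cpoly. \<exists>P. \<forall>t. evalp (($) (?l t)) F = poly P t" by blast
  from choice[OF this] obtain P where P: "evalp (($) (?l t)) (F :: 'n cpoly) = poly (P F) t" for F t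
    by blast
  have "evalp (($) (?l 0)) f \<noteq> 0" "evalp (($) (?l 1)) g \<noteq> 0"
    using assms by (simp_all add: vec_lambda_eta)
  then have "P f * P g \<noteq> 0" unfolding P by auto
  then have "finite {t. poly (P f * P g) t = 0}" by (rule poly_roots_finite)
  then obtain t where "poly (P f * P g) t \<noteq> 0"
    using infinite_UNIV_char_0[where 'a = complex] ex_new_if_finite by blast
  then show ?thesis by (intro exI[of _ "?l t"]) (auto simp: P)
qed

lemma openin_zariski_affine_basic: "openin zariski_affine {p. evalp (($) p) f \<noteq> 0}"
  unfolding zariski_affine_def by (rule topology_generated_by_Basis) auto

lemma topspace_zariski_affine [simp]: "topspace zariski_affine = UNIV"
  using openin_subset[OF openin_zariski_affine_basic[of 1]] by auto

lemma openin_zariski_affine_nonvanishing: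
  assumes "openin zariski_affine W" "p \<in> W"
  shows "\<exists>f. evalp (($) p) f \<noteq> 0 \<and> (\<forall>q. evalp (($) q) f \<noteq> 0 \<longrightarrow> q \<in> W)"
proof -
  have "\<exists>r\<in>range (\<lambda>f p. evalp (($) p) f). r p \<noteq> 0 \<and> (\<forall>t\<in>UNIV. r t \<noteq> 0 \<longrightarrow> t \<in> W)"
    by (rule generated_open_nonvanishing[OF assms(1)[unfolded zariski_affine_def] fun_alg_polys _ ])
      (use assms(2) in auto)
  then show ?thesis by auto
qed

lemma irreducible_zariski_affine: "irreducible_in (zariski_affine :: (complex^'n::finite) topology) UNIV"
proof (rule irreducible_inI)
  fix U V :: "(complex^'n) set"
  assume UV: "openin zariski_affine U" "openin zariski_affine V" "U \<inter> UNIV \<noteq> {}" "V \<inter> UNIV \<noteq> {}"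
  then obtain p q where pq: "p \<in> U" "q \<in> V" by auto
  obtain f where f: "evalp (($) p) f \<noteq> 0" "\<forall>r. evalp (($) r) f \<noteq> 0 \<longrightarrow> r \<in> U"
    using openin_zariski_affine_nonvanishing[OF UV(1) pq(1)] by auto
  obtain g where g: "evalp (($) q) g \<noteq> 0" "\<forall>r. evalp (($) r) g \<noteq> 0 \<longrightarrow> r \<in> V"
    using openin_zariski_affine_nonvanishing[OF UV(2) pq(2)] by auto
  obtain r where "evalp (($) r) f \<noteq> 0" "evalp (($) r) g \<noteq> 0"
    using evalp_common_nonvanishing[OF f(1) g(1)] by auto
  with f g show "U \<inter> V \<inter> UNIV \<noteq> {}" by auto
qed auto

lemma openin_Hilb_chart: "openin (zariski_Hilb N) {I \<in> Hilb_chart N B. chart_fun B F I \<noteq> 0}"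
  unfolding zariski_Hilb_def by (rule topology_generated_by_Basis) auto

lemma openin_Hilb_chart_1: "openin (zariski_Hilb N) (Hilb_chart N B)"
  using openin_Hilb_chart[of N B 1] by (simp add: chart_fun_def)

lemma zariski_Hilb_in_chart: "I \<in> topspace (zariski_Hilb N) \<Longrightarrow> \<exists>B. I \<in> Hilb_chart N B"
  by (auto simp: zariski_Hilb_def)

section \<open>Ideals with one-dimensional weight spaces\<close>

lemma chart_independent:
  assumes "I \<in> Hilb_chart N B" "(\<Sum>b\<in>B. mterm b (c b)) \<in> I" "b \<in> B"
  shows "c b = 0"
proof -
  have q: "quotient_basis UNIV I (monp ` B)" and id: "ideal_of_polys I"
    using assms(1) by (auto simp: Hilb_chart_def Hilb_def)
  define c' where "c' = (\<lambda>p :: 'a cpoly. c (the_inv monp p))"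
  have c': "c' (monp b) = c b" for b unfolding c'_def by (simp add: the_inv_f_f[OF inj_monp])
  have "(\<Sum>p\<in>monp ` B. constp (c' p) * p) = (\<Sum>b\<in>B. mterm b (c b))"
    by (subst sum.reindex[OF inj_monp]) (simp add: mult_single c')
  then show ?thesis
    using quotient_basis_independent[OF q _ _ _ id, of c' "monp b"] assms(2,3) ideal_0[OF id] c' by auto
qed

lemma add_mod_eq_iff:
  fixes a x j N :: nat
  assumes "a < N" "x < N" "j < N"
  shows "(a + x) mod N = j \<longleftrightarrow> x = (j + (N - a)) mod N"
proof -
  have m: "y mod N = (if y < N then y else y - N)" if "y < 2 * N" for y
    using that by (auto simp: mod_if[of y N] mod_if[of "y - N" N])
  have "a + x < 2 * N" "j + (N - a) < 2 * N" using assms by auto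
  then show ?thesis using assms by (simp add: m) linarith
qed

locale weighted =
  fixes N :: nat and w :: "'n::finite \<Rightarrow> nat"
  assumes N_pos: "N > 0"
begin

definition wdeg :: "'n monomial \<Rightarrow> nat" where "wdeg u = (\<Sum>i\<in>UNIV. lk u i * w i)"

definition wt :: "'n monomial \<Rightarrow> nat" where "wt u = wdeg u mod N"

definition wpart :: "('n monomial \<Rightarrow> complex) \<Rightarrow> nat \<Rightarrow> 'n cpoly \<Rightarrow> complex"
  where "wpart \<phi> j = linf (\<lambda>u. if wt u = j then \<phi> u else 0)"

text \<open>\<open>wpart \<phi> j\<close> serves as the coordinate of the weight j part of the
  quotient, so this is the common kernel of N functionals, one for each weight.\<close>

definition gid :: "('n monomial \<Rightarrow> complex) \<Rightarrow> 'n cpoly set"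
  where "gid \<phi> = {f. \<forall>j<N. wpart \<phi> j f = 0}"

text \<open>The condition for \<open>gid \<phi>\<close> to be an ideal of colength \<open>N\<close>.\<close>

definition cluster :: "('n monomial \<Rightarrow> complex) \<Rightarrow> bool"
  where "cluster \<phi> \<longleftrightarrow> (\<forall>u v s. wt u = wt v \<longrightarrow> \<phi> u * \<phi> (v + s) = \<phi> v * \<phi> (u + s)) \<and>
    (\<forall>j<N. \<exists>u. wt u = j \<and> \<phi> u \<noteq> 0)"

definition section_of :: "'n monomial set \<Rightarrow> bool"
  where "section_of B \<longleftrightarrow> finite B \<and> card B = N \<and> inj_on wt B"

lemma wdeg_add: "wdeg (u + v) = wdeg u + wdeg v"
  by (simp add: wdeg_def lookup_add algebra_simps sum.distrib)

lemma wdeg_0 [simp]: "wdeg 0 = 0" by (simp add: wdeg_def)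
lemma wt_0 [simp]: "wt 0 = 0" by (simp add: wt_def)

lemma wdeg_single [simp]: "wdeg (mterm i k) = k * w i"
  by (simp add: wdeg_def lookup_single when_def if_distrib[of "\<lambda>x. x * _"] cong: if_cong)

lemma wt_less: "wt u < N" using N_pos by (simp add: wt_def)

lemma wt_add: "wt (u + v) = (wt u + wt v) mod N"
  by (simp add: wt_def wdeg_add mod_add_eq)

lemma wt_add_cong: "wt u = wt v \<Longrightarrow> wt (u + s) = wt (v + s)"
  by (simp add: wt_add)

lemma wpart_single: "wpart \<phi> j (mterm u c) = (if wt u = j then c * \<phi> u else 0)"
  by (simp add: wpart_def)

lemmas wpart_add = linf_add[of "\<lambda>u. if wt u = j then \<phi> u else 0" for j \<phi>, folded wpart_def]
lemmas wpart_diff = linf_diff[of "\<lambda>u. if wt u = j then \<phi> u else 0" for j \<phi>, folded wpart_def]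
lemmas wpart_sum = linf_sum[of "\<lambda>u. if wt u = j then \<phi> u else 0" for j \<phi>, folded wpart_def]

lemma wpart_0 [simp]: "wpart \<phi> j 0 = 0" by (simp add: wpart_def)

lemma clusterD: "cluster \<phi> \<Longrightarrow> wt u = wt v \<Longrightarrow> \<phi> u * \<phi> (v + s) = \<phi> v * \<phi> (u + s)"
  by (simp add: cluster_def)

lemma cluster_ex: "cluster \<phi> \<Longrightarrow> j < N \<Longrightarrow> \<exists>u. wt u = j \<and> \<phi> u \<noteq> 0"
  by (simp add: cluster_def)

text \<open>By the cluster condition, multiplication by \<open>v\<close> acts on a weight line by
  the single scalar \<open>\<phi> (b + v) / \<phi> b\<close>, the same for every monomial of that
  weight. The index \<open>j + (N - wt v)\<close> stands for j - wt v modulo N.\<close>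

lemma wpart_monom_mult:
  assumes "cluster \<phi>" "j < N"
  shows "\<exists>K. \<forall>f. wpart \<phi> j (mterm v c * f) = K * wpart \<phi> ((j + (N - wt v)) mod N) f"
proof -
  let ?j = "(j + (N - wt v)) mod N"
  obtain b where b: "wt b = ?j" "\<phi> b \<noteq> 0" using cluster_ex[OF assms(1), of ?j] N_pos by auto
  have "(if wt (v + u) = j then \<phi> (v + u) else 0) = \<phi> (b + v) / \<phi> b * (if wt u = ?j then \<phi> u else 0)" for u
  proof -
    have "wt (v + u) = j \<longleftrightarrow> wt u = ?j"
      unfolding wt_add using assms(2) by (intro add_mod_eq_iff wt_less)
    moreover have "\<phi> (v + u) = \<phi> (b + v) / \<phi> b * \<phi> u" if "wt u = ?j"
      using clusterD[OF assms(1), of u b v] b that by (simp add: field_simps add.commute)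
    ultimately show ?thesis by auto
  qed
  then have "wpart \<phi> j (mterm v c * f) = (c * (\<phi> (b + v) / \<phi> b)) * wpart \<phi> ?j f" for f
    unfolding wpart_def linf_monom_mult by (simp only: linf_cmult_fun mult.assoc)
  then show ?thesis by blast
qed

lemma ideal_gid:
  assumes "cluster \<phi>"
  shows "ideal_of_polys (gid \<phi>)"
proof (rule ideal_monomialI)
  fix v c f assume f: "f \<in> gid \<phi>"
  show "mterm v c * f \<in> gid \<phi>"
    unfolding gid_def
  proof (intro CollectI allI impI)
    fix j assume "j < N"
    from wpart_monom_mult[OF assms this, of v c] obtain K where
      "wpart \<phi> j (mterm v c * f) = K * wpart \<phi> ((j + (N - wt v)) mod N) f" by auto
    then show "wpart \<phi> j (mterm v c * f) = 0" using f N_pos by (simp add: gid_def)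
  qed
qed (auto simp: gid_def wpart_add)

lemma section_of_bij: "section_of B \<Longrightarrow> bij_betw wt B {..<N}"
  unfolding section_of_def bij_betw_def
  by (metis card_image card_lessThan card_subset_eq finite_lessThan image_subsetI lessThan_iff wt_less)

lemma section_of_ex: "section_of B \<Longrightarrow> j < N \<Longrightarrow> \<exists>b\<in>B. wt b = j"
  using section_of_bij[of B] unfolding bij_betw_def by (metis imageE lessThan_iff)

lemma wpart_section_sum:
  assumes "section_of B" "b \<in> B"
  shows "wpart \<phi> (wt b) (\<Sum>b\<in>B. mterm b (c b)) = c b * \<phi> b"
proof -
  have "wpart \<phi> (wt b) (\<Sum>b\<in>B. mterm b (c b)) =
      (\<Sum>b'\<in>B. if b' = b then c b' * \<phi> b' else 0)"
    unfolding wpart_sum wpart_single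
    by (rule sum.cong) (use assms in \<open>auto simp: section_of_def inj_on_def\<close>)
  then show ?thesis using assms by (simp add: section_of_def)
qed

text \<open>Determining the coefficients explicitly gives the quotient basis and at the same time
  evaluates the definite description in \<open>chart_coord\<close>.\<close>

lemma gid_expansion:
  assumes "section_of B" "\<forall>b\<in>B. \<phi> b \<noteq> 0"
  shows "(\<forall>b. b \<notin> B \<longrightarrow> c b = 0) \<and> f - (\<Sum>b\<in>B. mterm b (c b)) \<in> gid \<phi> \<longleftrightarrow>
    c = (\<lambda>b. if b \<in> B then wpart \<phi> (wt b) f / \<phi> b else 0)"
proof -
  have "f - (\<Sum>b\<in>B. mterm b (c b)) \<in> gid \<phi> \<longleftrightarrow>
      (\<forall>b\<in>B. wpart \<phi> (wt b) (f - (\<Sum>b\<in>B. mterm b (c b))) = 0)"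
    using section_of_ex[OF assms(1)] wt_less unfolding gid_def by blast
  also have "\<dots> \<longleftrightarrow> (\<forall>b\<in>B. c b = wpart \<phi> (wt b) f / \<phi> b)"
    using assms(2) by (simp add: wpart_diff wpart_section_sum[OF assms(1)] field_simps) (metis)
  finally show ?thesis by (auto simp: fun_eq_iff)
qed

lemma quotient_basis_gid:
  assumes "section_of B" "\<forall>b\<in>B. \<phi> b \<noteq> 0"
  shows "quotient_basis UNIV (gid \<phi>) (monp ` B)"
  unfolding quotient_basis_monp gid_expansion[OF assms]
  using assms(1) by (simp add: section_of_def)

lemma section_exists:
  assumes "cluster \<phi>"
  shows "\<exists>B. section_of B \<and> (\<forall>b\<in>B. \<phi> b \<noteq> 0)"
proof -
  obtain g where g: "\<And>j. j < N \<Longrightarrow> wt (g j) = j \<and> \<phi> (g j) \<noteq> 0"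
    using cluster_ex[OF assms] by metis
  have "inj_on g {..<N}" using g by (metis inj_onI lessThan_iff)
  then have "section_of (g ` {..<N})"
    using g by (auto simp: section_of_def card_image inj_on_def)
  then show ?thesis using g by (intro exI[of _ "g ` {..<N}"]) auto
qed

lemma gid_Hilb:
  assumes "cluster \<phi>"
  shows "gid \<phi> \<in> Hilb N"
proof -
  obtain B where "section_of B" "\<forall>b\<in>B. \<phi> b \<noteq> 0" using section_exists[OF assms] by auto
  then show ?thesis
    using quotient_basis_gid[of B \<phi>] ideal_gid[OF assms] card_image[OF inj_monp, of B]
    by (auto simp: Hilb_def has_quotient_dim_def section_of_def)
qed

text \<open>If \<open>\<phi> b = 0\<close> then \<open>b\<close> itself lies in the ideal, and two
  monomials of equal weight satisfy a binomial relation; both contradict the independence of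
  \<open>B\<close>.\<close>

lemma gid_chart_iff:
  assumes "cluster \<phi>"
  shows "gid \<phi> \<in> Hilb_chart N B \<longleftrightarrow> section_of B \<and> (\<forall>b\<in>B. \<phi> b \<noteq> 0)"
proof
  assume "section_of B \<and> (\<forall>b\<in>B. \<phi> b \<noteq> 0)"
  then show "gid \<phi> \<in> Hilb_chart N B"
    using quotient_basis_gid[of B \<phi>] gid_Hilb[OF assms] by (auto simp: Hilb_chart_def section_of_def)
next
  assume I: "gid \<phi> \<in> Hilb_chart N B"
  have fin: "finite B" "card B = N" using I by (auto simp: Hilb_chart_def)
  have nz: "\<phi> b \<noteq> 0" if "b \<in> B" for b
  proof
    assume "\<phi> b = 0"
    then have "monp b \<in> gid \<phi>" by (simp add: gid_def wpart_single)
    also have "monp b = (\<Sum>b'\<in>B. mterm b' (if b' = b then 1 else (0::complex)))"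
      using that fin by (simp add: sum.delta if_distrib[of "mterm _"] cong: if_cong)
    finally have "(\<Sum>b'\<in>B. mterm b' (if b' = b then 1 else (0::complex))) \<in> gid \<phi>" .
    from chart_independent[OF I this that] show False by simp
  qed
  have "inj_on wt B"
  proof (rule inj_onI, rule ccontr)
    fix b b' assume b: "b \<in> B" "b' \<in> B" "wt b = wt b'" "b \<noteq> b'"
    \<comment> \<open>The relation \<open>\<phi>(b') b - \<phi>(b) b'\<close>, written in the basis
      \<open>B\<close>.\<close>
    define c where "c = (\<lambda>x. if x = b then \<phi> b' else if x = b' then - \<phi> b else 0)"
    have "(\<Sum>x\<in>B. mterm x (c x)) = (\<Sum>x\<in>{b, b'}. mterm x (c x))"
      using b fin by (intro sum.mono_neutral_right) (auto simp: c_def)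
    also have "\<dots> \<in> gid \<phi>"
      using b by (simp add: gid_def c_def wpart_add wpart_single)
    finally have "c b = 0" using chart_independent[OF I _ b(1)] by blast
    then show False using nz[OF b(2)] by (simp add: c_def)
  qed
  then show "section_of B \<and> (\<forall>b\<in>B. \<phi> b \<noteq> 0)" using nz fin by (auto simp: section_of_def)
qed

lemma chart_coord_gid:
  assumes "section_of B" "\<forall>b\<in>B. \<phi> b \<noteq> 0"
  shows "chart_coord B (gid \<phi>) (u, b) = (if b \<in> B \<and> wt u = wt b then \<phi> u / \<phi> b else 0)"
  unfolding chart_coord_def gid_expansion[OF assms]
  by (simp add: wpart_single)

text \<open>Chart coordinates are quotients of values of \<open>\<phi>\<close>. Functions that
  become regular after multiplication by a power of the common denominator again form a function
  algebra \<open>?G\<close>, so it suffices to treat the coordinates.\<close>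

lemma chart_fun_family:
  assumes "fun_alg R" "\<And>u. (\<lambda>s. \<phi> s u) \<in> R" "section_of B"
  shows "\<exists>k. \<exists>r\<in>R. \<forall>s. (\<Prod>b\<in>B. \<phi> s b) \<noteq> 0 \<longrightarrow> chart_fun B F (gid (\<phi> s)) * (\<Prod>b\<in>B. \<phi> s b) ^ k = r s"
proof -
  let ?D = "\<lambda>s. \<Prod>b\<in>B. \<phi> s b"
  let ?G = "{g. \<exists>k. \<exists>r\<in>R. \<forall>s. ?D s \<noteq> 0 \<longrightarrow> g s * ?D s ^ k = r s}"
  have fin: "finite B" using assms(3) by (simp add: section_of_def)
  have D: "?D \<in> R" by (intro fun_alg_prod assms)
  have GI: "g \<in> ?G" if "r \<in> R" "\<And>s. ?D s \<noteq> 0 \<Longrightarrow> g s * ?D s ^ k = r s" for g r k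
    using that by blast
  have G: "fun_alg ?G"
    unfolding fun_alg_def
  proof (intro conjI allI ballI)
    fix c show "(\<lambda>_. c) \<in> ?G"
      using fun_alg_const[OF assms(1)] by (auto intro!: exI[of _ 0] bexI[of _ "\<lambda>_. c"])
  next
    fix f g assume "f \<in> ?G" "g \<in> ?G"
    then obtain k l r r' where r: "r \<in> R" "\<And>s. ?D s \<noteq> 0 \<Longrightarrow> f s * ?D s ^ k = r s"
      and r': "r' \<in> R" "\<And>s. ?D s \<noteq> 0 \<Longrightarrow> g s * ?D s ^ l = r' s" by blast
    have *: "(f s + g s) * ?D s ^ (k + l) = r s * ?D s ^ l + r' s * ?D s ^ k" if "?D s \<noteq> 0" for s
      unfolding r(2)[OF that, symmetric] r'(2)[OF that, symmetric] by (simp add: power_add algebra_simps)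
    have "(\<lambda>s. r s * ?D s ^ l + r' s * ?D s ^ k) \<in> R"
      by (intro fun_alg_add fun_alg_mult fun_alg_power assms(1) r(1) r'(1) D)
    then show "(\<lambda>s. f s + g s) \<in> ?G" by (rule GI) (rule *)
    have *: "(f s * g s) * ?D s ^ (k + l) = r s * r' s" if "?D s \<noteq> 0" for s
      unfolding r(2)[OF that, symmetric] r'(2)[OF that, symmetric] by (simp add: power_add algebra_simps)
    have "(\<lambda>s. r s * r' s) \<in> R"
      by (intro fun_alg_mult assms(1) r(1) r'(1))
    then show "(\<lambda>s. f s * g s) \<in> ?G" by (rule GI) (rule *)
  qed
  have "(\<lambda>s. chart_coord B (gid (\<phi> s)) (u, b)) \<in> ?G" for u b
  proof (cases "b \<in> B \<and> wt u = wt b")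
    case True
    have *: "chart_coord B (gid (\<phi> s)) (u, b) * ?D s ^ 1 = \<phi> s u * (\<Prod>b\<in>B - {b}. \<phi> s b)"
      if "?D s \<noteq> 0" for s
    proof -
      have nz: "\<forall>b\<in>B. \<phi> s b \<noteq> 0" using that fin by auto
      have "?D s = \<phi> s b * (\<Prod>b\<in>B - {b}. \<phi> s b)" using True fin by (intro prod.remove) auto
      then show ?thesis using chart_coord_gid[OF assms(3), of "\<phi> s" u b] nz True by simp
    qed
    have "(\<lambda>s. \<phi> s u * (\<Prod>b\<in>B - {b}. \<phi> s b)) \<in> R"
      by (intro fun_alg_mult fun_alg_prod assms)
    then show ?thesis by (rule GI) (rule *)
  next
    case False
    have *: "chart_coord B (gid (\<phi> s)) (u, b) * ?D s ^ 0 = 0" if "?D s \<noteq> 0" for s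
    proof -
      have nz: "\<forall>b\<in>B. \<phi> s b \<noteq> 0" using that fin by auto
      then show ?thesis using chart_coord_gid[OF assms(3), of "\<phi> s" u b] False by auto
    qed
    show ?thesis by (rule GI[OF fun_alg_const[OF assms(1), of 0]]) (rule *)
  qed
  then have "(\<lambda>s. chart_coord B (gid (\<phi> s)) ub) \<in> ?G" for ub by (cases ub) auto
  then have "(\<lambda>s. chart_fun B F (gid (\<phi> s))) \<in> ?G"
    unfolding chart_fun_def by (intro fun_alg_evalp[OF G])
  then show ?thesis by blast
qed

lemma family_open:
  assumes "openin (zariski_Hilb N) W" "fun_alg R" "\<And>u. (\<lambda>s. \<phi> s u) \<in> R"
    and "\<And>s. s \<in> S \<Longrightarrow> cluster (\<phi> s)" "s1 \<in> S" "gid (\<phi> s1) \<in> W"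
  shows "\<exists>r\<in>R. r s1 \<noteq> 0 \<and> (\<forall>t\<in>S. r t \<noteq> 0 \<longrightarrow> gid (\<phi> t) \<in> W)"
proof (rule generated_open_nonvanishing[OF assms(1)[unfolded zariski_Hilb_def] assms(2,5),
      of "\<lambda>s. gid (\<phi> s)", OF assms(6)])
  fix U s assume U: "U \<in> {{I \<in> Hilb_chart N B. chart_fun B F I \<noteq> 0} |B F. True}"
    and s: "s \<in> S" and sU: "gid (\<phi> s) \<in> U"
  then obtain B F where UB: "U = {I \<in> Hilb_chart N B. chart_fun B F I \<noteq> 0}" by auto
  let ?D = "\<lambda>s. \<Prod>b\<in>B. \<phi> s b"
  have B: "section_of B" "\<forall>b\<in>B. \<phi> s b \<noteq> 0"
    using sU gid_chart_iff[OF assms(4)[OF s]] unfolding UB by auto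
  have fin: "finite B" using B(1) by (simp add: section_of_def)
  obtain k r where r: "r \<in> R" "\<And>s. ?D s \<noteq> 0 \<Longrightarrow> chart_fun B F (gid (\<phi> s)) * ?D s ^ k = r s"
    using chart_fun_family[OF assms(2), of \<phi> B F, OF assms(3) B(1)] by blast
  show "\<exists>r\<in>R. r s \<noteq> 0 \<and> (\<forall>t\<in>S. r t \<noteq> 0 \<longrightarrow> gid (\<phi> t) \<in> U)"
  \<comment> \<open>The factor \<open>?D s\<close> keeps the parameters inside the chart, where
    alone \<open>r\<close> is known to agree with the chart function up to a power of
    \<open>?D\<close>.\<close>
  proof (intro bexI[of _ "\<lambda>s. r s * ?D s"] conjI ballI impI)
    show "(\<lambda>s. r s * ?D s) \<in> R" by (intro fun_alg_mult fun_alg_prod assms(2,3) r(1))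
    have "?D s \<noteq> 0" using B fin by simp
    then show "r s * ?D s \<noteq> 0" using r(2)[of s] sU unfolding UB by auto
    fix t assume t: "t \<in> S" "r t * ?D t \<noteq> 0"
    then have "\<forall>b\<in>B. \<phi> t b \<noteq> 0" using fin by auto
    then have "gid (\<phi> t) \<in> Hilb_chart N B" using gid_chart_iff[OF assms(4)[OF t(1)]] B by auto
    moreover have "chart_fun B F (gid (\<phi> t)) \<noteq> 0" using r(2)[of t] t(2) by auto
    ultimately show "gid (\<phi> t) \<in> U" unfolding UB by auto
  qed
qed

lemma gid_topspace:
  assumes "cluster \<phi>"
  shows "gid \<phi> \<in> topspace (zariski_Hilb N)"
proof -
  obtain B where "section_of B" "\<forall>b\<in>B. \<phi> b \<noteq> 0" using section_exists[OF assms] by auto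
  then have "gid \<phi> \<in> Hilb_chart N B" using gid_chart_iff[OF assms] by auto
  then show ?thesis using openin_subset[OF openin_Hilb_chart_1] by blast
qed

lemma continuous_gid:
  fixes \<phi> :: "complex^'k::finite \<Rightarrow> 'n monomial \<Rightarrow> complex"
  assumes "\<And>p. cluster (\<phi> p)" "\<And>u. (\<lambda>p. \<phi> p u) \<in> range (\<lambda>f p. evalp (($) p) f)"
  shows "continuous_map zariski_affine (zariski_Hilb N) (\<lambda>p. gid (\<phi> p))"
  unfolding continuous_map_def
proof (intro conjI allI impI)
  show "(\<lambda>p. gid (\<phi> p)) \<in> topspace zariski_affine \<rightarrow> topspace (zariski_Hilb N)"
    using gid_topspace assms(1) by auto
  fix W :: "'n cpoly set set" assume W: "openin (zariski_Hilb N) W"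
  let ?V = "{p \<in> topspace zariski_affine. gid (\<phi> p) \<in> W}"
  show "openin zariski_affine ?V"
  proof (subst openin_subopen, intro ballI)
    fix p assume p: "p \<in> ?V"
    then obtain r where r: "r \<in> range (\<lambda>f p. evalp (($) p) f)" "r p \<noteq> 0" "\<forall>t. r t \<noteq> 0 \<longrightarrow> gid (\<phi> t) \<in> W"
      using family_open[OF W fun_alg_polys, of \<phi> "($)" UNIV p] assms by auto
    then obtain f where f: "r = (\<lambda>p. evalp (($) p) f)" by auto
    show "\<exists>T. openin zariski_affine T \<and> p \<in> T \<and> T \<subseteq> ?V"
      using r openin_zariski_affine_basic[of f] unfolding f
      by (intro exI[of _ "{p. evalp (($) p) f \<noteq> 0}"]) auto
  qed
qed

end

section \<open>The cyclic group and its action\<close>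

lemma matrix_inv_eqI:
  fixes A B :: "'a::semiring_1^'n^'n"
  assumes "A ** B = mat 1" "B ** A = mat 1"
  shows "matrix_inv A = B"
proof -
  have "A ** matrix_inv A = mat 1 \<and> matrix_inv A ** A = mat 1"
    unfolding matrix_inv_def by (rule someI[of _ B]) (use assms in auto)
  then have "matrix_inv A = matrix_inv A ** (A ** B)" "matrix_inv A ** A = mat 1" using assms by auto
  then show ?thesis by (simp add: matrix_mul_assoc)
qed

lemma prod_single:
  "(\<Prod>i\<in>A. mterm (f i) (g i)) =
    mterm (\<Sum>i\<in>A. f i :: 'i monomial) (\<Prod>i\<in>A. g i :: complex)"
  by (induction A rule: infinite_finite_induct) (auto simp: mult_single)

lemma single_power:
  "mterm (u :: 'i monomial) (c :: complex) ^ n = mterm (\<Sum>_<n. u) (c ^ n)"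
  by (induction n) (auto simp: mult_single add.commute)

lemma sum_single_nat: "(\<Sum>_<n. mterm i (1::nat)) = mterm i n"
  by (induction n) (auto simp: single_add[symmetric] add.commute)

lemma monomial_eq_sum: "(\<Sum>i\<in>mkeys u. mterm i (lk u i)) = (u :: 'i monomial)"
proof (rule poly_mapping_eqI)
  fix k
  show "lk (\<Sum>i\<in>mkeys u. mterm i (lk u i)) k = lk u k"
    by (cases "k \<in> mkeys u") (auto simp: lookup_sum lookup_single when_def in_keys_iff)
qed

lemma prod_scaled_variables:
  "(\<Prod>i\<in>mkeys u. mterm (mterm i 1) (c i) ^ lk u i) =
    (mterm u (monev c u) :: 'i cpoly)"
  by (simp only: single_power sum_single_nat prod_single monomial_eq_sum monev_def)

lemma poly_ring_induct [case_names const var add mult]: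
  assumes "\<And>c. P (constp c)" "\<And>i. P (varp i)"
    and "\<And>f g. P f \<Longrightarrow> P g \<Longrightarrow> P (f + g)" "\<And>f g. P f \<Longrightarrow> P g \<Longrightarrow> P (f * g)"
  shows "P (f :: 'i cpoly)"
proof (induction f rule: poly_induct)
  case (single u c)
  have one: "P 1" using assms(1)[of 1] by simp
  have pow: "P (f ^ n)" if "P f" for f n by (induction n) (auto intro: assms that one)
  have prod: "P (\<Prod>i\<in>A. f i)" if "\<And>i. P (f i)" for f A
    by (induction A rule: infinite_finite_induct) (auto intro: assms that one)
  have "mterm u c = constp c * (\<Prod>i\<in>mkeys u. varp i ^ lk u i)"
    using prod_scaled_variables[of "\<lambda>_. 1" u] by (simp add: mult_single monev_def)
  moreover have "P (constp c * (\<Prod>i\<in>mkeys u. varp i ^ lk u i))"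
    by (intro assms prod pow)
  ultimately show ?case by simp
qed (rule assms)

text \<open>The variable \<open>i0\<close> of weight 1 makes the action faithful, so that the group
  has order N, and its powers represent all weights.\<close>

locale cyclic = weighted N w for N and w :: "'n::finite \<Rightarrow> nat" +
  fixes \<epsilon> :: complex and i0 :: 'n
  assumes prim: "primitive_root_of_unity N \<epsilon>" and w_i0: "w i0 = 1"
    and w_less: "w i < N"
begin

definition diag :: "nat \<Rightarrow> complex^'n^'n"
  where "diag k = (\<chi> i j. if i = j then \<epsilon> ^ (k * w i) else 0)"

definition grp :: "(complex^'n^'n) set" where "grp = diag ` {..<N}"

lemma eps_N: "\<epsilon> ^ N = 1" using prim by (simp add: primitive_root_of_unity_def)

lemma eps_nz [simp]: "\<epsilon> \<noteq> 0" using eps_N N_pos by (metis power_0_left zero_neq_one neq0_conv)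

lemma eps_mod: "\<epsilon> ^ (k mod N) = \<epsilon> ^ k"
proof -
  have "\<epsilon> ^ k = \<epsilon> ^ (N * (k div N) + k mod N)" by simp
  also have "\<dots> = \<epsilon> ^ (k mod N)" by (simp only: power_add power_mult eps_N power_one mult_1)
  finally show ?thesis by simp
qed

lemma eps_eq_1_iff: "\<epsilon> ^ k = 1 \<longleftrightarrow> N dvd k"
proof
  assume "\<epsilon> ^ k = 1"
  then have "\<epsilon> ^ (k mod N) = 1" by (simp add: eps_mod)
  then have "k mod N = 0" using prim N_pos unfolding primitive_root_of_unity_def
    by (metis mod_less_divisor neq0_conv)
  then show "N dvd k" by auto
qed (auto simp: power_mult eps_N)

lemma eps_eq_iff: "\<epsilon> ^ k = \<epsilon> ^ l \<longleftrightarrow> k mod N = l mod N"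
proof
  have *: "k mod N = l mod N" if "\<epsilon> ^ k = \<epsilon> ^ l" "k \<le> l" for k l
  proof -
    have "\<epsilon> ^ k * \<epsilon> ^ (l - k) = \<epsilon> ^ l" using that(2) by (simp add: power_add[symmetric])
    then have "\<epsilon> ^ k * \<epsilon> ^ (l - k) = \<epsilon> ^ k" using that(1) by simp
    then have "N dvd l - k" by (simp add: eps_eq_1_iff)
    then show ?thesis using that(2) by (metis mod_eq_dvd_iff_nat)
  qed
  assume e: "\<epsilon> ^ k = \<epsilon> ^ l"
  show "k mod N = l mod N"
  proof (cases "k \<le> l")
    case True
    then show ?thesis using *[OF e] by blast
  next
    case False
    then show ?thesis using *[OF e[symmetric]] by simp
  qed
next
  assume "k mod N = l mod N"
  then show "\<epsilon> ^ k = \<epsilon> ^ l" using eps_mod[of k] eps_mod[of l] by simp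
qed

lemma sum_eps: "(\<Sum>k<N. \<epsilon> ^ (k * a)) = (if N dvd a then of_nat N else 0)"
proof -
  have "(\<Sum>k<N. \<epsilon> ^ (k * a)) = (\<Sum>k<N. (\<epsilon> ^ a) ^ k)" by (simp add: power_mult mult.commute flip: power_mult)
  also have "\<dots> = (if N dvd a then of_nat N else 0)"
  proof (cases "N dvd a")
    case True
    then have "\<epsilon> ^ a = 1" by (simp add: eps_eq_1_iff)
    then show ?thesis using True by simp
  next
    case False
    then have "\<epsilon> ^ a \<noteq> 1" by (simp add: eps_eq_1_iff)
    moreover have "(\<epsilon> ^ a) ^ N = 1" by (metis eps_N power_commutes power_mult power_one mult.commute)
    ultimately show ?thesis using False by (simp add: geometric_sum)
  qed
  finally show ?thesis .
qed

lemma diag_mult: "diag k ** diag l = diag (k + l)"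
  by (simp add: diag_def matrix_matrix_mult_def vec_eq_iff if_distrib[of "\<lambda>x. x * _"]
      if_distrib[of "\<lambda>x. _ * x"] power_add distrib_right cong: if_cong)

lemma diag_mod: "diag (k mod N) = diag k"
  by (simp add: diag_def vec_eq_iff eps_eq_iff mod_mult_left_eq)

lemma diag_0: "diag 0 = mat 1" by (simp add: diag_def mat_def vec_eq_iff)

lemma diag_vec: "(diag k *v p) $ i = \<epsilon> ^ (k * w i) * p $ i"
  by (simp add: diag_def matrix_vector_mult_def if_distrib[of "\<lambda>x. x * _"] cong: if_cong)

lemma diag_inj: "inj_on diag {..<N}"
proof (rule inj_onI)
  fix k l assume kl: "k \<in> {..<N}" "l \<in> {..<N}" "diag k = diag l"
  then have "diag k $ i0 $ i0 = diag l $ i0 $ i0" by simp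
  then have "\<epsilon> ^ k = \<epsilon> ^ l" by (simp add: diag_def w_i0)
  then show "k = l" using kl by (simp add: eps_eq_iff)
qed

lemma card_grp: "card grp = N"
  by (simp add: grp_def card_image diag_inj)

lemma diag_in_grp: "diag k \<in> grp"
  unfolding grp_def using N_pos by (intro image_eqI[of _ _ "k mod N"]) (simp_all add: diag_mod)

lemma diag_inverse: "diag k ** diag ((N - 1) * k) = mat 1" "diag ((N - 1) * k) ** diag k = mat 1"
proof -
  have "k + (N - 1) * k = N * k" using N_pos by (cases N) auto
  then have "diag (k + (N - 1) * k) = mat 1"
    using diag_mod[of "N * k"] by (simp add: diag_0)
  then show "diag k ** diag ((N - 1) * k) = mat 1" "diag ((N - 1) * k) ** diag k = mat 1"
    by (simp_all add: diag_mult add.commute)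
qed

text \<open>\<open>twist z\<close> is the substitution \<open>x\<^sub>i \<mapsto> z ^ w i * x\<^sub>i\<close>.\<close>

definition twist :: "complex \<Rightarrow> 'n cpoly \<Rightarrow> 'n cpoly"
  where "twist z f = (\<Sum>u\<in>mkeys f. mterm u (lk f u * z ^ wdeg u))"

definition hcomp :: "nat \<Rightarrow> 'n cpoly \<Rightarrow> 'n cpoly"
  where "hcomp j f = (\<Sum>u\<in>mkeys f. if wt u = j then mterm u (lk f u) else 0)"

lemma lookup_twist: "lk (twist z f) u = lk f u * z ^ wdeg u"
  by (cases "u \<in> mkeys f")
    (auto simp: twist_def lookup_sum lookup_single when_def in_keys_iff)

lemma lookup_hcomp: "lk (hcomp j f) u = (if wt u = j then lk f u else 0)"
proof -
  have "lk (hcomp j f) u = (\<Sum>v\<in>mkeys f. if v = u then (if wt u = j then lk f u else 0) else 0)"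
    unfolding hcomp_def lookup_sum by (rule sum.cong) (auto simp: lookup_single when_def)
  then show ?thesis by (auto simp: in_keys_iff)
qed

lemma linf_hcomp: "linf \<psi> (hcomp j f) = wpart \<psi> j f"
  unfolding hcomp_def linf_sum wpart_def linf_def[of _ f] by (rule sum.cong) auto

lemma lookup_constp_mult: "lk (constp c * f) u = c * lk f u"
  by (induction f rule: poly_induct) (auto simp: mult_single lookup_single when_def distrib_left lookup_add)

lemma eps_wdeg: "\<epsilon> ^ (k * wdeg u) = \<epsilon> ^ (k * wt u)"
  unfolding eps_eq_iff wt_def by (simp add: mod_mult_right_eq)

lemma eps_power_wdeg: "(\<epsilon> ^ k) ^ wdeg u = \<epsilon> ^ (k * wt u)"
  by (simp only: power_mult[symmetric] eps_wdeg)

lemma twist_eps: "twist (\<epsilon> ^ k) f = (\<Sum>j<N. constp (\<epsilon> ^ (k * j)) * hcomp j f)"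
proof (rule poly_mapping_eqI)
  fix u
  have "lk (\<Sum>j<N. constp (\<epsilon> ^ (k * j)) * hcomp j f) u =
      (\<Sum>j<N. if j = wt u then \<epsilon> ^ (k * j) * lk f u else 0)"
    unfolding lookup_sum lookup_constp_mult lookup_hcomp by (rule sum.cong) auto
  then show "lk (twist (\<epsilon> ^ k) f) u = lk (\<Sum>j<N. constp (\<epsilon> ^ (k * j)) * hcomp j f) u"
    using wt_less[of u] by (simp add: lookup_twist eps_power_wdeg)
qed

text \<open>Projection to a weight space by averaging over the group; \<open>N - j\<close> takes the
  place of -j in the exponent.\<close>

lemma hcomp_eq_sum:
  assumes "j < N"
  shows "constp (of_nat N) * hcomp j f = (\<Sum>k<N. constp (\<epsilon> ^ (k * (N - j))) * twist (\<epsilon> ^ k) f)"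
proof (rule poly_mapping_eqI)
  fix u
  have eq: "lk (\<Sum>k<N. constp (\<epsilon> ^ (k * (N - j))) * twist (\<epsilon> ^ k) f) u =
      lk f u * (\<Sum>k<N. \<epsilon> ^ (k * (N - j + wt u)))"
    unfolding lookup_sum lookup_constp_mult lookup_twist sum_distrib_left
    by (rule sum.cong) (simp_all add: eps_power_wdeg power_add distrib_left)
  \<comment> \<open>The sum lies strictly between 0 and 2N, so it can be divisible by N only if it
    equals N.\<close>
  have "N dvd (N - j + wt u) \<longleftrightarrow> wt u = j"
  proof
    assume "N dvd N - j + wt u"
    then obtain q where q: "N - j + wt u = N * q" by auto
    have "0 < N * q" "N * q < N * 2" unfolding q[symmetric] using assms wt_less[of u] by auto
    then have "q = 1" by auto
    then show "wt u = j" using q assms by auto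
  qed (use assms in auto)
  then show "lk (constp (of_nat N) * hcomp j f) u =
      lk (\<Sum>k<N. constp (\<epsilon> ^ (k * (N - j))) * twist (\<epsilon> ^ k) f) u"
    unfolding eq sum_eps by (auto simp: lookup_constp_mult lookup_hcomp simp del: single_of_nat)
qed

lemma hcomp_sum: "(\<Sum>j<N. hcomp j f) = f"
proof (rule poly_mapping_eqI)
  fix u
  show "lk (\<Sum>j<N. hcomp j f) u = lk f u"
    using wt_less[of u] by (simp add: lookup_sum lookup_hcomp)
qed

lemma act_diag: "act_poly (diag k) f = twist (\<epsilon> ^ ((N - 1) * k)) f"
proof -
  let ?l = "(N - 1) * k"
  have inv: "matrix_inv (diag k) = diag ?l" by (intro matrix_inv_eqI diag_inverse)
  have eq: "(\<Sum>j\<in>UNIV. constp (matrix_inv (diag k) $ i $ j) * varp j) =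
      mterm (mterm i 1) (\<epsilon> ^ (?l * w i))" for i
    unfolding inv by
      (simp add: diag_def mult_single if_distrib[of constp] if_distrib[of "\<lambda>x. x * _"] cong: if_cong)
  have "act_poly (diag k) f =
      (\<Sum>u\<in>mkeys f. constp (lk f u) * mterm u (monev (\<lambda>i. \<epsilon> ^ (?l * w i)) u))"
    unfolding act_poly_def substp_def by (simp only: eq prod_scaled_variables)
  also have "\<dots> = twist (\<epsilon> ^ ?l) f"
    unfolding twist_def
  proof (rule sum.cong[OF refl])
    fix u
    have "monev (\<lambda>i. \<epsilon> ^ (?l * w i)) u = (\<epsilon> ^ ?l) ^ wdeg u"
      unfolding monev_UNIV wdeg_def by (simp add: power_sum mult_ac flip: power_mult)
    then show "constp (lk f u) * mterm u (monev (\<lambda>i. \<epsilon> ^ (?l * w i)) u) =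
        mterm u (lk f u * (\<epsilon> ^ ?l) ^ wdeg u)"
      by (simp add: mult_single)
  qed
  finally show ?thesis .
qed

lemma twist_mult: "twist (\<epsilon> ^ k) (twist (\<epsilon> ^ l) f) = twist (\<epsilon> ^ (k + l)) f"
  by (rule poly_mapping_eqI) (simp add: lookup_twist power_add power_mult_distrib mult_ac)

lemma twist_cong: "k mod N = l mod N \<Longrightarrow> twist (\<epsilon> ^ k) f = twist (\<epsilon> ^ l) f"
  by (simp only: eps_eq_iff[symmetric])

lemma twist_1: "twist (\<epsilon> ^ 0) f = f"
  by (rule poly_mapping_eqI) (simp add: lookup_twist)

lemma twist_N: "twist (\<epsilon> ^ (N * k)) f = f"
  using twist_cong[of "N * k" 0 f] twist_1[of f] by simp

lemma N_mult_eq: "(N - 1) * k + k = N * k"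
  using N_pos by (cases N) auto

text \<open>Invariance under the cyclic group is homogeneity for the weight grading: weight
  components are combinations of twists, and twists are combinations of weight components.\<close>

lemma Hilb_fixed_iff:
  "I \<in> Hilb_fixed grp \<longleftrightarrow> I \<in> Hilb N \<and> (\<forall>f\<in>I. \<forall>j<N. hcomp j f \<in> I)"
proof (cases "I \<in> Hilb N")
  case True
  then have id: "ideal_of_polys I" by (simp add: Hilb_def)
  have "(\<forall>g\<in>grp. act_poly g ` I = I) \<longleftrightarrow> (\<forall>f\<in>I. \<forall>j<N. hcomp j f \<in> I)"
  proof
    assume fx: "\<forall>g\<in>grp. act_poly g ` I = I"
    have tw: "twist (\<epsilon> ^ k) f \<in> I" if "f \<in> I" for f k
    proof -
      \<comment> \<open>\<open>act_poly\<close> uses the inverse matrix, so a twist by k is the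
        action of the inverse element; inverting twice returns k modulo N.\<close>
      have "(N - 1) * ((N - 1) * k) mod N = k mod N"
      proof -
        obtain M where M: "N = Suc M" using N_pos by (cases N) auto
        have "(M * (M * k) + Suc M * k) mod Suc M = (k + Suc M * (M * k)) mod Suc M"
          by (simp add: algebra_simps)
        then show ?thesis unfolding M diff_Suc_1 by (simp only: mod_mult_self2)
      qed
      then have "twist (\<epsilon> ^ k) f = act_poly (diag ((N - 1) * k)) f"
        unfolding act_diag by (intro twist_cong) simp
      then show ?thesis using fx diag_in_grp that by blast
    qed
    show "\<forall>f\<in>I. \<forall>j<N. hcomp j f \<in> I"
    proof (intro ballI allI impI)
      fix f j assume f: "f \<in> I" "j < N"
      have *: "constp (of_nat N) * hcomp j f \<in> I"
        unfolding hcomp_eq_sum[OF f(2)] by (intro ideal_sum[OF id] ideal_mult[OF id] tw f(1))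
      have nz: "of_nat N \<noteq> (0::complex)" using N_pos by simp
      show "hcomp j f \<in> I" by (rule ideal_const_cancel[OF id nz *])
    qed
  next
    assume h: "\<forall>f\<in>I. \<forall>j<N. hcomp j f \<in> I"
    have tw: "twist (\<epsilon> ^ k) f \<in> I" if "f \<in> I" for f k
      unfolding twist_eps using h that by (intro ideal_sum[OF id] ideal_mult[OF id]) auto
    show "\<forall>g\<in>grp. act_poly g ` I = I"
    proof
      fix g assume "g \<in> grp"
      then obtain k where g: "g = diag k" by (auto simp: grp_def)
      have "f \<in> act_poly g ` I" if "f \<in> I" for f
      proof (rule image_eqI)
        show "f = act_poly g (twist (\<epsilon> ^ k) f)"
          unfolding g act_diag twist_mult N_mult_eq twist_N ..
      qed (rule tw[OF that])
      then show "act_poly g ` I = I" using tw unfolding g act_diag by auto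
    qed
  qed
  then show ?thesis using True by (simp add: Hilb_fixed_def card_grp)
qed (simp add: Hilb_fixed_def card_grp)

lemma gid_Hilb_fixed:
  assumes "cluster \<phi>"
  shows "gid \<phi> \<in> Hilb_fixed grp"
proof -
  have "wpart \<phi> j (hcomp i f) = (if i = j then wpart \<phi> j f else 0)" for i j f
    unfolding wpart_def[of \<phi> j] linf_hcomp unfolding wpart_def
    by (auto simp: linf_def intro!: sum.cong sum.neutral)
  then show ?thesis
    unfolding Hilb_fixed_iff using gid_Hilb[OF assms] by (auto simp: gid_def)
qed

text \<open>In the expansion of \<open>u\<close>, the component of weight \<open>wt u\<close>
  retains a single basis monomial, whose coefficient is taken as \<open>\<phi> u\<close>. The
  cluster identity follows on multiplying the binomial relation between \<open>u\<close> and
  \<open>v\<close> by \<open>s\<close>.\<close>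

lemma fixed_eq_gid:
  assumes "I \<in> Hilb_fixed grp" "I \<in> Hilb_chart N B" "section_of B"
    and bs: "\<And>j. j < N \<Longrightarrow> bs j \<in> B \<and> wt (bs j) = j"
  defines "\<phi> \<equiv> \<lambda>u. chart_coord B I (u, bs (wt u))"
  shows "cluster \<phi> \<and> I = gid \<phi> \<and> (\<forall>b\<in>B. \<phi> b = 1)"
proof -
  have id: "ideal_of_polys I" and hom: "\<And>f j. f \<in> I \<Longrightarrow> j < N \<Longrightarrow> hcomp j f \<in> I"
    using assms(1) unfolding Hilb_fixed_iff by (auto simp: Hilb_def)
  have fin: "finite B" using assms(3) by (simp add: section_of_def)
  have bsw: "bs (wt b) = b" if "b \<in> B" for b
    using bs[OF wt_less[of b]] assms(3) that unfolding section_of_def inj_on_def by auto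
  have ex1: "\<exists>!c. (\<forall>b. b \<notin> B \<longrightarrow> c b = 0) \<and> f - (\<Sum>b\<in>B. mterm b (c b)) \<in> I" for f
    using assms(2) unfolding Hilb_chart_def quotient_basis_monp by auto
  have red: "monp u - mterm (bs (wt u)) (\<phi> u) \<in> I" for u
  proof -
    define c where "c = (THE c. (\<forall>b. b \<notin> B \<longrightarrow> c b = 0) \<and> monp u - (\<Sum>b\<in>B. mterm b (c b)) \<in> I)"
    have c: "monp u - (\<Sum>b\<in>B. mterm b (c b)) \<in> I"
      using theI'[OF ex1[of "monp u"]] unfolding c_def by auto
    have "hcomp (wt u) (monp u - (\<Sum>b\<in>B. mterm b (c b))) =
        monp u - mterm (bs (wt u)) (c (bs (wt u)))"
    proof (rule poly_mapping_eqI)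
      fix v
      have "(\<Sum>b\<in>B. lk (mterm b (c b)) v) = (if v \<in> B then c v else 0)"
        using fin by (simp add: lookup_single when_def sum.delta')
      moreover have "v = bs (wt u)" if "wt v = wt u" "v \<in> B" using bsw[OF that(2)] that(1) by simp
      ultimately show "lk (hcomp (wt u) (monp u - (\<Sum>b\<in>B. mterm b (c b)))) v =
          lk (monp u - mterm (bs (wt u)) (c (bs (wt u)))) v"
        using bs[OF wt_less[of u]]
        by (auto simp: lookup_hcomp lookup_minus lookup_sum lookup_single when_def)
    qed
    moreover have "\<phi> u = c (bs (wt u))" by (simp add: \<phi>_def chart_coord_def c_def)
    ultimately show ?thesis using hom[OF c wt_less[of u]] by simp
  qed
  have indep: "\<phi> b = 1" if b: "b \<in> B" for b
  proof -
    have "(\<Sum>b'\<in>B. mterm b' (if b' = b then 1 - \<phi> b else 0)) = monp b - mterm b (\<phi> b)"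
      using b fin by (simp add: sum.delta if_distrib[of "mterm _"] single_diff cong: if_cong)
    also have "\<dots> \<in> I" using red[of b] bsw[OF b] by simp
    finally have "(\<Sum>b'\<in>B. mterm b' (if b' = b then 1 - \<phi> b else 0)) \<in> I" .
    from chart_independent[OF assms(2) this b] show ?thesis by simp
  qed
  have expand: "f - (\<Sum>b\<in>B. mterm b (wpart \<phi> (wt b) f)) \<in> I" for f
  proof (induction f rule: poly_induct)
    case (single u c)
    have "(\<Sum>b\<in>B. mterm b (wpart \<phi> (wt b) (mterm u c))) =
        (\<Sum>b\<in>B. if b = bs (wt u) then mterm b (c * \<phi> u) else 0)"
      by (rule sum.cong) (auto simp: wpart_single bs wt_less bsw)
    also have "\<dots> = constp c * mterm (bs (wt u)) (\<phi> u)"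
      using fin bs[OF wt_less[of u]] by (simp add: mult_single)
    finally have "mterm u c - (\<Sum>b\<in>B. mterm b (wpart \<phi> (wt b) (mterm u c))) =
        constp c * (monp u - mterm (bs (wt u)) (\<phi> u))"
      by (simp add: right_diff_distrib mult_single)
    then show ?case using ideal_mult[OF id red] by simp
  next
    case (add f g)
    have "(\<Sum>b\<in>B. mterm b (wpart \<phi> (wt b) (f + g))) =
      (\<Sum>b\<in>B. mterm b (wpart \<phi> (wt b) f)) + (\<Sum>b\<in>B. mterm b (wpart \<phi> (wt b) g))"
      by (simp add: wpart_add single_add sum.distrib)
    then show ?case using ideal_add[OF id add] by (simp add: algebra_simps)
  qed
  have "f \<in> I \<longleftrightarrow> (\<forall>b\<in>B. wpart \<phi> (wt b) f = 0)" for f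
  proof
    assume "f \<in> I"
    then have "(\<Sum>b\<in>B. mterm b (wpart \<phi> (wt b) f)) \<in> I"
      using ideal_diff[OF id _ expand[of f]] by fastforce
    from chart_independent[OF assms(2) this] show "\<forall>b\<in>B. wpart \<phi> (wt b) f = 0" by blast
  next
    assume "\<forall>b\<in>B. wpart \<phi> (wt b) f = 0"
    then show "f \<in> I" using expand[of f] by simp
  qed
  moreover have "(\<forall>b\<in>B. wpart \<phi> (wt b) f = 0) \<longleftrightarrow> f \<in> gid \<phi>" for f
    unfolding gid_def using bs wt_less by force
  ultimately have I: "I = gid \<phi>" by blast
  have "\<phi> u * \<phi> (v + s) = \<phi> v * \<phi> (u + s)" if uv: "wt u = wt v" for u v s
  proof -
    have "mterm u (\<phi> v) - mterm v (\<phi> u) \<in> gid \<phi>"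
      using uv by (simp add: gid_def wpart_diff wpart_single)
    then have "monp s * (mterm u (\<phi> v) - mterm v (\<phi> u)) \<in> gid \<phi>"
      using ideal_mult[OF id] I by simp
    then have "wpart \<phi> (wt (u + s)) (mterm (s + u) (\<phi> v) - mterm (s + v) (\<phi> u)) = 0"
      using wt_less by (simp add: gid_def right_diff_distrib mult_single)
    then show ?thesis
      using wt_add_cong[OF uv, of s] by (simp add: wpart_diff wpart_single add.commute)
  qed
  moreover have "\<exists>u. wt u = j \<and> \<phi> u \<noteq> 0" if "j < N" for j
    using bs[OF that] indep by (intro exI[of _ "bs j"]) auto
  ultimately show ?thesis using I indep by (auto simp: cluster_def)
qed

end

section \<open>The Hilbert-Chow cycle\<close>

definition nmult :: "nat \<Rightarrow> 'i monomial \<Rightarrow> 'i monomial" where "nmult k u = (\<Sum>_<k. u)"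

lemma nmult_0 [simp]: "nmult 0 u = 0" by (simp add: nmult_def)
lemma nmult_Suc: "nmult (Suc k) u = u + nmult k u" by (simp add: nmult_def add.commute)

lemma monp_nmult: "(monp (nmult k u) :: 'i cpoly) = monp u ^ k"
  by (simp add: monp_power nmult_def)

lemma monev_nmult: "monev a (nmult k u) = monev a u ^ k"
  by (induction k) (auto simp: nmult_Suc monev_add)

lemma ideal_local_kernel:
  assumes "ideal_of_polys I"
  shows "ideal_of_polys (local_kernel I q)"
proof (rule module.subspaceI[OF module_mult])
  show "0 \<in> local_kernel I q"
    using ideal_0[OF assms] by (auto simp: local_kernel_def intro!: exI[of _ 1])
next
  fix f g assume "f \<in> local_kernel I q" "g \<in> local_kernel I q"
  then obtain s t where s: "evalp (($) q) s \<noteq> 0" "s * f \<in> I" and t: "evalp (($) q) t \<noteq> 0" "t * g \<in> I"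
    by (auto simp: local_kernel_def)
  have "t * (s * f) + s * (t * g) \<in> I" by (intro ideal_add[OF assms] ideal_mult[OF assms] s t)
  then have "(s * t) * (f + g) \<in> I" by (simp add: algebra_simps)
  then show "f + g \<in> local_kernel I q" using s t by (auto simp: local_kernel_def evalp_mult intro!: exI[of _ "s * t"])
next
  fix c f assume "f \<in> local_kernel I q"
  then obtain s where s: "evalp (($) q) s \<noteq> 0" "s * f \<in> I" by (auto simp: local_kernel_def)
  have "c * (s * f) \<in> I" by (intro ideal_mult[OF assms] s)
  then have "s * (c * f) \<in> I" by (simp add: mult_ac)
  then show "c * f \<in> local_kernel I q" using s by (auto simp: local_kernel_def)
qed

lemma local_kernel_superset: "I \<subseteq> local_kernel I q"
  by (auto simp: local_kernel_def intro!: exI[of _ 1])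

lemma hilbert_chow_eqI:
  assumes "ideal_of_polys I" "has_quotient_dim UNIV (local_kernel I q) d"
  shows "hilbert_chow I q = d"
  unfolding hilbert_chow_def
  using assms(2) has_quotient_dim_unique[OF _ _ _ ideal_local_kernel[OF assms(1)]] by blast

lemma hilbert_chow_eq_0:
  assumes "ideal_of_polys I" "f \<in> I" "evalp (($) q) f \<noteq> 0"
  shows "hilbert_chow I q = 0"
proof (rule hilbert_chow_eqI[OF assms(1)])
  have "1 \<in> local_kernel I q" using assms by (auto simp: local_kernel_def)
  then have "local_kernel I q = UNIV" by (rule ideal_eq_UNIV[OF ideal_local_kernel[OF assms(1)]])
  then show "has_quotient_dim UNIV (local_kernel I q) 0"
    unfolding has_quotient_dim_def quotient_basis_def by (intro exI[of _ "{}"]) (auto intro: ext)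
qed

lemma quotient_basis_monpI:
  assumes id: "ideal_of_polys I" and fin: "finite B"
    and span: "\<And>u. \<exists>b\<in>B. \<exists>c. monp u - mterm b c \<in> I"
    and indep: "\<And>c b. (\<Sum>b\<in>B. mterm b (c b)) \<in> I \<Longrightarrow> b \<in> B \<Longrightarrow> c b = 0"
  shows "quotient_basis UNIV I (monp ` B)"
  unfolding quotient_basis_monp
proof (intro conjI fin allI)
  fix f
  have "\<exists>c. (\<forall>b. b \<notin> B \<longrightarrow> c b = 0) \<and> f - (\<Sum>b\<in>B. mterm b (c b)) \<in> I"
  proof (induction f rule: poly_induct)
    case (single u a)
    obtain b c where b: "b \<in> B" "monp u - mterm b c \<in> I" using span by blast
    have "(\<Sum>b'\<in>B. mterm b' (if b' = b then a * c else 0)) = constp a * mterm b c"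
      using b fin by (simp add: sum.delta if_distrib[of "mterm _"] mult_single cong: if_cong)
    then have "mterm u a - (\<Sum>b'\<in>B. mterm b' (if b' = b then a * c else 0)) =
        constp a * (monp u - mterm b c)"
      by (simp add: right_diff_distrib mult_single)
    also have "\<dots> \<in> I" by (rule ideal_mult[OF id b(2)])
    finally show ?case using b by (intro exI[of _ "\<lambda>b'. if b' = b then a * c else 0"]) auto
  next
    case (add f g)
    then obtain c c' where
      "\<forall>b. b \<notin> B \<longrightarrow> c b = 0" "f - (\<Sum>b\<in>B. mterm b (c b)) \<in> I"
      "\<forall>b. b \<notin> B \<longrightarrow> c' b = 0" "g - (\<Sum>b\<in>B. mterm b (c' b)) \<in> I" by auto
    moreover have "(\<Sum>b\<in>B. mterm b (c b + c' b)) =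
        (\<Sum>b\<in>B. mterm b (c b)) + (\<Sum>b\<in>B. mterm b (c' b))"
      by (simp add: single_add sum.distrib)
    ultimately show ?case
      using ideal_add[OF id, of "f - (\<Sum>b\<in>B. mterm b (c b))"
          "g - (\<Sum>b\<in>B. mterm b (c' b))"]
      by (intro exI[of _ "\<lambda>b. c b + c' b"]) (auto simp: algebra_simps)
  qed
  then show "\<exists>!c. (\<forall>b. b \<notin> B \<longrightarrow> c b = 0) \<and> f - (\<Sum>b\<in>B. mterm b (c b)) \<in> I"
  proof (rule ex_ex1I)
    fix c c' assume c: "(\<forall>b. b \<notin> B \<longrightarrow> c b = 0) \<and> f - (\<Sum>b\<in>B. mterm b (c b)) \<in> I"
      and c': "(\<forall>b. b \<notin> B \<longrightarrow> c' b = 0) \<and> f - (\<Sum>b\<in>B. mterm b (c' b)) \<in> I"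
    have "(f - (\<Sum>b\<in>B. mterm b (c' b))) - (f - (\<Sum>b\<in>B. mterm b (c b))) \<in> I"
      by (rule ideal_diff[OF id conjunct2[OF c'] conjunct2[OF c]])
    also have "(f - (\<Sum>b\<in>B. mterm b (c' b))) - (f - (\<Sum>b\<in>B. mterm b (c b))) =
        (\<Sum>b\<in>B. mterm b (c b - c' b))"
      by (simp add: single_diff sum_subtractf)
    finally have "(\<Sum>b\<in>B. mterm b (c b - c' b)) \<in> I" .
    from indep[OF this] have "c b = c' b" if "b \<in> B" for b using that by simp
    then show "c = c'" using c c' by (intro ext) metis
  qed
qed

context cyclic
begin

section \<open>Common zeros of cluster ideals\<close>

lemma wdeg_nmult: "wdeg (nmult k u) = k * wdeg u"
  by (induction k) (auto simp: nmult_Suc wdeg_add)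

text \<open>One linear factor of \<open>x ^ N - a\<close> can be added to a proper ideal containing \<open>x ^ N - a\<close>: the
  colon ideals by the complementary factors \<open>F k\<close> serve, since the \<open>F k\<close> generate a nonzero constant.\<close>

lemma ideal_extend_root:
  fixes J :: "'n cpoly set"
  assumes id: "ideal_of_polys J" and "1 \<notin> J" and x: "x ^ N - constp a \<in> J"
  shows "\<exists>J' \<beta>. ideal_of_polys J' \<and> J \<subseteq> J' \<and> 1 \<notin> J' \<and> x - constp \<beta> \<in> J'"
proof (cases "a = 0")
  case True
  then have xN: "x ^ N \<in> J" using x by simp
  \<comment> \<open>In the nilpotent case the root is 0: the colon ideal by the last power of
    \<open>x\<close> outside \<open>J\<close> is proper and contains \<open>x\<close>.\<close>
  define n where "n = (LEAST n. x ^ n \<in> J)"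
  have n: "x ^ n \<in> J" unfolding n_def by (rule LeastI[of _ N]) (rule xN)
  have "n \<noteq> 0" using n assms(2) by (metis power_0)
  then obtain r where r: "n = Suc r" by (cases n) auto
  have "x ^ r \<notin> J" using not_less_Least[of r "\<lambda>n. x ^ n \<in> J"] r unfolding n_def by auto
  moreover have "x - constp 0 \<in> {f. f * x ^ r \<in> J}" using n r by simp
  moreover have "J \<subseteq> {f. f * x ^ r \<in> J}" using ideal_mult[OF id] by (auto simp: mult.commute)
  ultimately show ?thesis using ideal_colon[OF id, of "x ^ r"]
    by (intro exI[of _ "{f. f * x ^ r \<in> J}"] exI[of _ 0]) simp
next
  case False
  obtain \<alpha> where \<alpha>: "\<alpha> ^ N = a" using exists_complex_root[of N a] N_pos by auto
  define \<beta> where "\<beta> k = \<alpha> * \<epsilon> ^ k" for k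
  define F where "F k = (\<Sum>i<N. constp (\<beta> k) ^ (N - Suc i) * x ^ i)" for k
  have cp: "constp c ^ n = (constp (c ^ n) :: 'n cpoly)" for c n
    by (induction n) (auto simp: mult_single)
  have \<beta>N: "\<beta> k ^ N = a" for k
    by (simp add: \<beta>_def power_mult_distrib \<alpha> power_commutes flip: power_mult)
      (metis eps_N mult.commute power_mult power_one mult.right_neutral)
  have xF: "(x - constp (\<beta> k)) * F k = x ^ N - constp a" for k
    using power_diff_sumr2[of x N "constp (\<beta> k)"] unfolding F_def cp \<beta>N by (rule sym)
  \<comment> \<open>The coefficient of \<open>x^i\<close> is a power sum over the N-th roots of
    \<open>a\<close>; all of these vanish except the one for i = 0, which is N a.\<close>
  have "(\<Sum>k<N. constp (\<beta> k) * F k) = (\<Sum>i<N. constp (\<Sum>k<N. \<beta> k ^ (N - i)) * x ^ i)"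
  proof -
    have "constp (\<beta> k) * F k = (\<Sum>i<N. constp (\<beta> k ^ (N - i)) * x ^ i)" for k
      unfolding F_def sum_distrib_left
    proof (rule sum.cong[OF refl])
      fix i assume "i \<in> {..<N}"
      then have "N - i = Suc (N - Suc i)" by auto
      then show "constp (\<beta> k) * (constp (\<beta> k) ^ (N - Suc i) * x ^ i) = constp (\<beta> k ^ (N - i)) * x ^ i"
        by (simp add: cp mult_single flip: mult.assoc)
    qed
    then have "(\<Sum>k<N. constp (\<beta> k) * F k) = (\<Sum>i<N. (\<Sum>k<N. constp (\<beta> k ^ (N - i))) * x ^ i)"
      by (simp add: sum_distrib_right) (rule sum.swap)
    moreover have "(\<Sum>k<n. constp (g k)) = (constp (\<Sum>k<n. g k) :: 'n cpoly)" for n :: nat and g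
      by (induction n) (auto simp: single_add)
    ultimately show ?thesis by simp
  qed
  also have "\<dots> = (\<Sum>i<N. if i = 0 then constp (of_nat N * a) else 0)"
  proof (rule sum.cong[OF refl])
    fix i assume i: "i \<in> {..<N}"
    have "(\<Sum>k<N. \<beta> k ^ (N - i)) = \<alpha> ^ (N - i) * (\<Sum>k<N. \<epsilon> ^ (k * (N - i)))"
      by (simp add: \<beta>_def power_mult_distrib power_mult sum_distrib_left)
    also have "\<dots> = (if i = 0 then of_nat N * a else 0)"
      unfolding sum_eps using i N_pos by (auto simp: \<alpha> dest: dvd_imp_le)
    finally show "constp (\<Sum>k<N. \<beta> k ^ (N - i)) * x ^ i = (if i = 0 then constp (of_nat N * a) else 0)"
      by simp
  qed
  also have "\<dots> = constp (of_nat N * a)" using N_pos by simp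
  finally have total: "(\<Sum>k<N. constp (\<beta> k) * F k) = constp (of_nat N * a) * 1" by simp
  have nz: "of_nat N * a \<noteq> 0" using False N_pos by simp
  have "\<exists>k. F k \<notin> J"
  proof (rule ccontr)
    assume "\<not> ?thesis"
    then have "(\<Sum>k<N. constp (\<beta> k) * F k) \<in> J" by (intro ideal_sum[OF id] ideal_mult[OF id]) auto
    then show False using ideal_const_cancel[OF id nz] assms(2) unfolding total by blast
  qed
  then obtain k where k: "F k \<notin> J" by auto
  have "J \<subseteq> {f. f * F k \<in> J}" using ideal_mult[OF id] by (auto simp: mult.commute)
  then show ?thesis using k x xF[of k] ideal_colon[OF id, of "F k"]
    by (intro exI[of _ "{f. f * F k \<in> J}"] exI[of _ "\<beta> k"]) simp
qed

text \<open>After a linear factor has been adjoined for each variable, the ideal is still proper and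
  contains \<open>x_i - q_i\<close> for a point \<open>q\<close>. Every polynomial is then congruent
  to its value at \<open>q\<close>, and a nonzero value of some \<open>f\<close> in \<open>J\<close>
  would put a unit into the ideal.\<close>

lemma nullstellensatz:
  assumes id: "ideal_of_polys J" and "1 \<notin> J" and x: "\<And>i. \<exists>a. varp i ^ N - constp a \<in> J"
  shows "\<exists>q :: complex^'n. \<forall>f\<in>J. evalp (($) q) f = 0"
proof -
  have "\<exists>J'. ideal_of_polys J' \<and> J \<subseteq> J' \<and> 1 \<notin> J' \<and> (\<forall>i\<in>A. \<exists>\<beta>. varp i - constp \<beta> \<in> J')"
    if "finite A" for A
    using that
  proof (induction A rule: finite_induct)
    case empty
    show ?case using assms by (intro exI[of _ J]) auto
  next
    case (insert i A)
    then obtain J' where J': "ideal_of_polys J'" "J \<subseteq> J'" "1 \<notin> J'" "\<forall>i\<in>A. \<exists>\<beta>. varp i - constp \<beta> \<in> J'"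
      by auto
    obtain a where "varp i ^ N - constp a \<in> J'" using x J' by blast
    from ideal_extend_root[OF J'(1,3) this] obtain J'' \<beta> where
      J'': "ideal_of_polys J''" "J' \<subseteq> J''" "1 \<notin> J''" "varp i - constp \<beta> \<in> J''" by auto
    have "\<forall>i\<in>insert i A. \<exists>\<beta>. varp i - constp \<beta> \<in> J''" using J' J'' by blast
    moreover have "J \<subseteq> J''" using J' J'' by blast
    ultimately show ?case using J'' by (intro exI[of _ J'']) simp
  qed
  from this[OF finite_class.finite_UNIV] obtain J' where
    J': "ideal_of_polys J'" "J \<subseteq> J'" "1 \<notin> J'" "\<forall>i. \<exists>\<beta>. varp i - constp \<beta> \<in> J'" by auto
  from choice[OF J'(4)] obtain \<beta> where \<beta>: "\<And>i. varp i - constp (\<beta> i) \<in> J'" by auto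
  define q :: "complex^'n" where "q = (\<chi> i. \<beta> i)"
  have ev: "f - constp (evalp (($) q) f) \<in> J'" for f
  proof (induction f rule: poly_ring_induct)
    case (const c)
    then show ?case using ideal_0[OF J'(1)] by simp
  next
    case (var i)
    then show ?case using \<beta>[of i] by (simp add: monev_single q_def)
  next
    case (add f g)
    then show ?case using ideal_add[OF J'(1) add] by (simp add: evalp_add single_add algebra_simps)
  next
    case (mult f g)
    have "g * (f - constp (evalp (($) q) f)) + constp (evalp (($) q) f) * (g - constp (evalp (($) q) g)) \<in> J'"
      by (intro ideal_add[OF J'(1)] ideal_mult[OF J'(1)] mult)
    then show ?case by (simp add: evalp_mult algebra_simps mult_single)
  qed
  have "evalp (($) q) f = 0" if "f \<in> J" for f
  proof (rule ccontr)
    assume nz: "evalp (($) q) f \<noteq> 0"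
    have "f \<in> J'" using that J'(2) by auto
    then have "f - (f - constp (evalp (($) q) f)) \<in> J'" by (rule ideal_diff[OF J'(1) _ ev])
    then have "constp (evalp (($) q) f) * 1 \<in> J'" by simp
    from ideal_const_cancel[OF J'(1) nz this] show False using J' by simp
  qed
  then show ?thesis by blast
qed

lemma monev_diag: "monev (($) (diag k *v p)) u = \<epsilon> ^ (k * wt u) * monev (($) p) u"
proof -
  have "(\<Prod>i\<in>UNIV. (\<epsilon> ^ (k * w i)) ^ lk u i) = (\<epsilon> ^ k) ^ wdeg u"
    unfolding wdeg_def power_sum by (rule prod.cong) (simp_all add: mult_ac flip: power_mult)
  then have "monev (($) (diag k *v p)) u = (\<epsilon> ^ k) ^ wdeg u * monev (($) p) u"
    unfolding monev_UNIV diag_vec power_mult_distrib prod.distrib by simp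
  then show ?thesis by (simp only: eps_power_wdeg)
qed

lemma evalp_diag: "evalp (($) (diag k *v p)) f = evalp (($) p) (twist (\<epsilon> ^ k) f)"
proof -
  have "evalp (($) p) (twist (\<epsilon> ^ k) f) = linf (\<lambda>u. \<epsilon> ^ (k * wt u) * monev (($) p) u) f"
    unfolding evalp_linf twist_def linf_sum linf_def[of _ f] by (simp add: eps_power_wdeg mult_ac)
  then show ?thesis unfolding evalp_linf monev_diag by simp
qed

text \<open>A twist multiplies weight components by scalars, and the components of \<open>f\<close>
  lie in the ideal, so they vanish at \<open>q\<close> one by one.\<close>

lemma diag_vanishing:
  assumes "cluster \<phi>" "\<forall>f\<in>gid \<phi>. evalp (($) q) f = 0" "f \<in> gid \<phi>"
  shows "evalp (($) (diag k *v q)) f = 0"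
proof -
  have "hcomp j f \<in> gid \<phi>" if "j < N" for j
    using gid_Hilb_fixed[OF assms(1)] that assms(3) by (simp add: Hilb_fixed_iff)
  then show ?thesis
    unfolding evalp_diag twist_eps evalp_sum evalp_mult using assms(2) by simp
qed

lemma gid_binomial:
  assumes "wt u = wt v"
  shows "mterm u (\<phi> v) - mterm v (\<phi> u) \<in> gid \<phi>"
  using assms by (simp add: gid_def wpart_diff wpart_single)

lemma one_notin_gid:
  assumes "cluster \<phi>"
  shows "1 \<notin> gid \<phi>"
proof
  assume "1 \<in> gid \<phi>"
  then have "gid \<phi> = UNIV" by (rule ideal_eq_UNIV[OF ideal_gid[OF assms]])
  moreover obtain u where "\<phi> u \<noteq> 0" using cluster_ex[OF assms N_pos] by auto
  then have "wpart \<phi> (wt u) (monp u) \<noteq> 0" by (simp add: wpart_single)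
  then have "monp u \<notin> gid \<phi>" using wt_less by (auto simp: gid_def)
  ultimately show False by simp
qed

lemma cluster_0:
  assumes "cluster \<phi>"
  shows "\<phi> 0 \<noteq> 0"
proof
  assume "\<phi> 0 = 0"
  then have "(1 :: 'n cpoly) \<in> gid \<phi>"
    using wpart_single[of \<phi> _ 0 1] by (auto simp: gid_def)
  then show False using one_notin_gid[OF assms] by simp
qed

lemma invariant_in_gid:
  assumes "cluster \<phi>" "wt u = 0"
  shows "monp u - constp (\<phi> u / \<phi> 0) \<in> gid \<phi>"
proof -
  have nz: "\<phi> 0 \<noteq> 0" by (rule cluster_0[OF assms(1)])
  have "constp (\<phi> 0) * (monp u - constp (\<phi> u / \<phi> 0)) = mterm u (\<phi> 0) - constp (\<phi> u)"
    using nz by (simp add: right_diff_distrib mult_single)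
  also have "\<dots> \<in> gid \<phi>" using gid_binomial[of u 0 \<phi>] assms(2) by simp
  finally show ?thesis by (rule ideal_const_cancel[OF ideal_gid[OF assms(1)] nz])
qed

lemma wt_nmult_N [simp]: "wt (nmult N u) = 0"
  by (simp add: wt_def wdeg_nmult)

lemma gid_var_power:
  assumes "cluster \<phi>"
  shows "\<exists>a. varp i ^ N - constp a \<in> gid \<phi>"
  using invariant_in_gid[OF assms, of "nmult N (mterm i 1)"] by (auto simp: monp_nmult)

lemma gid_zero_exists:
  assumes "cluster \<phi>"
  shows "\<exists>q :: complex^'n. \<forall>f\<in>gid \<phi>. evalp (($) q) f = 0"
  by (rule nullstellensatz[OF ideal_gid[OF assms] one_notin_gid[OF assms] gid_var_power[OF assms]])

text \<open>The weights of the monomials not vanishing at \<open>q\<close> are the multiples of a divisor \<open>d\<close> of \<open>N\<close>, which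
  is the order of the stabilizer of \<open>q\<close>.\<close>

definition period :: "complex^'n \<Rightarrow> nat \<Rightarrow> 'n monomial \<Rightarrow> bool"
  where "period q d v0 \<longleftrightarrow> 0 < d \<and> d dvd N \<and> wt v0 = d mod N \<and> monev (($) q) v0 \<noteq> 0 \<and>
    (\<forall>v. monev (($) q) v \<noteq> 0 \<longrightarrow> d dvd wt v)"

text \<open>Euclidean division: the remainder of a weight by the smallest positive \<open>d\<close>
  is again attained. If only invariant monomials are nonzero at \<open>q\<close>, then
  \<open>d = N\<close>, which is why the weight of \<open>v0\<close> is written
  \<open>d mod N\<close>.\<close>

lemma period_exists: "\<exists>d v0. period q d v0"
proof -
  let ?P = "\<lambda>d. 0 < d \<and> (\<exists>v. monev (($) q) v \<noteq> 0 \<and> wt v = d mod N)"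
  define d where "d = (LEAST d. ?P d)"
  have "?P N" using N_pos by (auto intro!: exI[of _ 0])
  then have d: "?P d" unfolding d_def by (rule LeastI)
  then obtain v0 where v0: "monev (($) q) v0 \<noteq> 0" "wt v0 = d mod N" by auto
  have dvd: "d dvd t" if v: "monev (($) q) v \<noteq> 0" "wt v = t mod N" for v t
  proof (rule ccontr)
    assume nd: "\<not> d dvd t"
    \<comment> \<open>In weight this is v - (t div d) v0, because N-fold multiples of
      \<open>v0\<close> have weight 0.\<close>
    define v' where "v' = v + nmult ((N - 1) * (t div d)) v0"
    obtain M where M: "N = Suc M" using N_pos by (cases N) auto
    have "wt v' = (t + (N - 1) * (t div d) * d) mod N"
      unfolding v'_def wt_add wt_def[of "nmult _ _"] wdeg_nmult
      using v(2) v0(2) by (simp add: wt_def mod_add_left_eq mod_add_right_eq) (metis mod_add_right_eq mod_mult_right_eq)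
    also have "t + (N - 1) * (t div d) * d = t mod d + N * (t div d * d)"
    proof -
      have "t + M * (t div d) * d = t mod d + t div d * d + M * (t div d) * d" by simp
      then show ?thesis unfolding M by (simp add: algebra_simps)
    qed
    finally have "wt v' = (t mod d) mod N" by simp
    moreover have "monev (($) q) v' \<noteq> 0" using v v0 by (simp add: v'_def monev_add monev_nmult)
    moreover have "0 < t mod d" using nd by (simp add: dvd_eq_mod_eq_0)
    ultimately have "?P (t mod d)" by auto
    then have "d \<le> t mod d" unfolding d_def by (rule Least_le)
    then show False using mod_less_divisor[of d t] d by linarith
  qed
  have "d dvd N" using dvd[of 0 N] by simp
  moreover have "d dvd wt v" if "monev (($) q) v \<noteq> 0" for v
    using dvd[OF that, of "wt v"] wt_less by simp
  ultimately show ?thesis using d v0 unfolding period_def by blast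
qed

lemma period_diag: "period q d v0 \<Longrightarrow> period (diag k *v q) d v0"
  by (simp add: period_def monev_diag)

text \<open>A coordinate vanishing at \<open>q\<close> has its N-th power in the ideal. The weight
  of any other coordinate is a multiple of \<open>d\<close>, so modulo the ideal it is proportional
  to a power of \<open>v0\<close>. Hence the value of \<open>v0\<close> determines a common
  zero.\<close>

lemma zero_unique:
  assumes "cluster \<phi>" "period q d v0" and q: "\<forall>f\<in>gid \<phi>. evalp (($) q) f = 0"
    and q': "\<forall>f\<in>gid \<phi>. evalp (($) q') f = 0" and eq: "monev (($) q') v0 = monev (($) q) v0"
  shows "q' = q"
proof -
  have "q' $ i = q $ i" for i
  proof (cases "q $ i = 0")
    case True
    let ?u = "nmult N (mterm i 1)"
    have u: "monp ?u - constp (\<phi> ?u / \<phi> 0) \<in> gid \<phi>" by (rule invariant_in_gid[OF assms(1) wt_nmult_N])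
    have 0: "\<phi> ?u / \<phi> 0 = 0" using q[rule_format, OF u] True N_pos
      by (simp add: evalp_diff monev_nmult monev_single power_0_left)
    then show ?thesis using q'[rule_format, OF u] True
      unfolding 0 by (simp add: monev_nmult monev_single)
  next
    case False
    let ?x = "mterm i 1"
    have "d dvd wt ?x" using assms(2) False by (simp add: period_def monev_single)
    then obtain t where t: "wt ?x = d * t" by auto
    let ?v = "nmult t v0"
    have "wt ?v = wt ?x"
    proof -
      have "wt ?v = (t * (d mod N)) mod N"
        using assms(2) by (simp add: wt_def[of ?v] wdeg_nmult period_def wt_def[of v0, symmetric])
          (metis mod_mult_right_eq wt_def)
      also have "\<dots> = wt ?x mod N" using t by (simp add: mod_mult_right_eq mult.commute)
      finally show ?thesis using wt_less[of ?x] by simp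
    qed
    then have b: "mterm ?x (\<phi> ?v) - mterm ?v (\<phi> ?x) \<in> gid \<phi>"
      by (intro gid_binomial) simp
    have nz: "monev (($) q) ?v \<noteq> 0" using assms(2) by (simp add: period_def monev_nmult)
    have "\<phi> ?v \<noteq> 0"
    proof
      assume "\<phi> ?v = 0"
      then have "monp ?v \<in> gid \<phi>" by (simp add: gid_def wpart_single)
      then show False using q nz by auto
    qed
    then show ?thesis
      using q[rule_format, OF b] q'[rule_format, OF b] eq
      by (simp add: evalp_diff monev_nmult monev_single) (metis mult_cancel_left)
  qed
  then show ?thesis by (simp add: vec_eq_iff)
qed

lemma root_of_unity_eq_power:
  assumes "z ^ N = 1"
  shows "\<exists>j<N. z = \<epsilon> ^ j"
proof -
  have "inj_on (\<lambda>j. \<epsilon> ^ j) {..<N}" by (auto simp: inj_on_def eps_eq_iff)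
  then have "card ((\<lambda>j. \<epsilon> ^ j) ` {..<N}) = N" by (simp add: card_image)
  moreover have "(\<lambda>j. \<epsilon> ^ j) ` {..<N} \<subseteq> {z. z ^ N = 1}"
    by (auto simp: power_mult[symmetric] eps_eq_1_iff)
  ultimately have "(\<lambda>j. \<epsilon> ^ j) ` {..<N} = {z. z ^ N = 1}"
    using card_roots_unity_eq[OF N_pos] finite_roots_unity[of N, where 'a = complex] N_pos
    by (intro card_subset_eq) auto
  then show ?thesis using assms by auto
qed

text \<open>With \<open>M = N / d\<close> the monomial \<open>v0^M\<close> is invariant, so it takes
  the same value at both zeros. The values of \<open>v0\<close> then differ by a power of
  \<open>\<epsilon>^d\<close>, which some \<open>diag k\<close> realizes, and
  \<open>zero_unique\<close> applies.\<close>

lemma zeros_are_orbit: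
  assumes "cluster \<phi>" and q: "\<forall>f\<in>gid \<phi>. evalp (($) q) f = 0"
    and q': "\<forall>f\<in>gid \<phi>. evalp (($) q') f = 0"
  shows "\<exists>k. q' = diag k *v q"
proof -
  obtain d v0 where p: "period q d v0" using period_exists by blast
  let ?y = "monev (($) q) v0" and ?z = "monev (($) q') v0"
  have y: "?y \<noteq> 0" using p by (simp add: period_def)
  obtain M where M: "N = d * M" using p by (auto simp: period_def)
  have "wt (nmult M v0) = 0"
  proof -
    have "M * wdeg v0 mod N = M * (wt v0) mod N" by (simp add: wt_def mod_mult_right_eq)
    also have "\<dots> = M * d mod N" using p by (simp add: period_def mod_mult_right_eq)
    also have "\<dots> = 0" using M by (simp add: mult.commute)
    finally show ?thesis by (simp add: wt_def[of "nmult _ _"] wdeg_nmult)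
  qed
  from invariant_in_gid[OF assms(1) this]
  have b: "monp (nmult M v0) - constp (\<phi> (nmult M v0) / \<phi> 0) \<in> gid \<phi>" .
  have "?z ^ M = ?y ^ M"
    using q[rule_format, OF b] q'[rule_format, OF b] by (simp add: evalp_diff monev_nmult)
  then have zy: "(?z / ?y) ^ M = 1" using y by (simp add: power_divide)
  then have "(?z / ?y) ^ N = 1" unfolding M by (metis mult.commute power_mult power_one)
  then obtain j where j: "?z / ?y = \<epsilon> ^ j" using root_of_unity_eq_power by blast
  have "N dvd j * M" using zy unfolding j by (simp add: eps_eq_1_iff flip: power_mult)
  then have "d dvd j" using M N_pos by (simp add: mult.commute[of j])
  then obtain k where k: "j = d * k" by auto
  have "monev (($) (diag k *v q)) v0 = \<epsilon> ^ (k * (d mod N)) * ?y"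
    using p by (simp add: monev_diag period_def)
  also have "\<epsilon> ^ (k * (d mod N)) = \<epsilon> ^ j" unfolding eps_eq_iff k by (simp add: mod_mult_right_eq mult.commute)
  also have "\<epsilon> ^ j * ?y = ?z" using j y by (simp add: field_simps)
  finally have "?z = monev (($) (diag k *v q)) v0" by simp
  with zero_unique[OF assms(1) period_diag[OF p, of k] _ q'] diag_vanishing[OF assms(1) q]
  show ?thesis by blast
qed

text \<open>Let \<open>y\<close> be the value of \<open>v0\<close> at \<open>q\<close>. The polynomial \<open>e = (v0^M - y^M) / (v0 - y)\<close> with \<open>M = N / d\<close> is
  a multiple of the idempotent of the local factor at \<open>q\<close>, so that \<open>local_kernel I q\<close> is the colon ideal of \<open>e\<close>.\<close>

lemma hilbert_chow_gid:
  assumes cl: "cluster \<phi>" and p: "period q d v0" and q: "\<forall>f\<in>gid \<phi>. evalp (($) q) f = 0"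
  shows "hilbert_chow (gid \<phi>) q = d"
proof -
  note id = ideal_gid[OF cl]
  define y where "y = monev (($) q) v0"
  have y: "y \<noteq> 0" using p by (simp add: period_def y_def)
  obtain M where M: "N = d * M" using p by (auto simp: period_def)
  have dM: "0 < d" "0 < M" using p M N_pos by (auto simp: period_def)
  define e :: "'n cpoly" where "e = (\<Sum>t<M. mterm (nmult t v0) (y ^ (M - Suc t)))"
  let ?K = "local_kernel (gid \<phi>) q"
  have wtn: "wt (nmult t v0) = (t * d) mod N" for t
  proof -
    have "t * wdeg v0 mod N = t * (wt v0) mod N" by (simp add: wt_def mod_mult_right_eq)
    also have "\<dots> = t * d mod N" using p by (simp add: period_def mod_mult_right_eq)
    finally show ?thesis by (simp add: wt_def[of "nmult _ _"] wdeg_nmult)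
  qed
  have inv: "monp v0 ^ M - constp (y ^ M) \<in> gid \<phi>"
  proof -
    have "M * d mod N = 0" using M by (simp add: mult.commute)
    then have "wt (nmult M v0) = 0" by (simp add: wtn)
    from invariant_in_gid[OF cl this]
    have b: "monp v0 ^ M - constp (\<phi> (nmult M v0) / \<phi> 0) \<in> gid \<phi>" by (simp add: monp_nmult)
    have "\<phi> (nmult M v0) / \<phi> 0 = y ^ M"
      using q[rule_format, OF b] by (simp add: evalp_diff evalp_power y_def)
    then show ?thesis using b by simp
  qed
  have cp: "constp c ^ n = (constp (c ^ n) :: 'n cpoly)" for c n
    by (induction n) (auto simp: mult_single)
  have e_eq: "e = (\<Sum>t<M. constp y ^ (M - Suc t) * monp v0 ^ t)"
    unfolding e_def cp by (simp add: mult_single flip: monp_nmult)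
  have ve: "(monp v0 - constp y) * e \<in> gid \<phi>"
    using inv power_diff_sumr2[of "monp v0" M "constp y"] by (simp add: e_eq cp)
  have eq: "evalp (($) q) e \<noteq> 0"
  proof -
    have "evalp (($) q) e = (\<Sum>t<M. y ^ (M - 1))"
      unfolding e_def evalp_sum by (rule sum.cong) (auto simp: monev_nmult y_def[symmetric] simp flip: power_add)
    then show ?thesis using dM y by simp
  qed
  have K: "f \<in> ?K \<longleftrightarrow> e * f \<in> gid \<phi>" for f
  proof
    assume "e * f \<in> gid \<phi>" then show "f \<in> ?K" using eq by (auto simp: local_kernel_def)
  next
    assume "f \<in> ?K"
    then obtain s where s: "evalp (($) q) s \<noteq> 0" "s * f \<in> gid \<phi>" by (auto simp: local_kernel_def)
    let ?J = "{g. g * (e * f) \<in> gid \<phi>}"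
    have J: "ideal_of_polys ?J" by (rule ideal_colon[OF id])
    have sub: "gid \<phi> \<subseteq> ?J" using ideal_mult[OF id] by (auto simp: mult.commute)
    have sJ: "s \<in> ?J" using ideal_mult[OF id s(2), of e] by (simp add: mult_ac)
    have vJ: "monp v0 - constp y \<in> ?J" using ideal_mult[OF id ve, of f] by (simp add: mult_ac)
    \<comment> \<open>Otherwise the ideal \<open>?J\<close> annihilating the class of
      \<open>e * f\<close> is proper and has a common zero. Since \<open>?J\<close> contains
      \<open>v0 - y\<close>, that zero is \<open>q\<close>, where \<open>s\<close>, also in
      \<open>?J\<close>, does not vanish.\<close>
    show "e * f \<in> gid \<phi>"
    proof (rule ccontr)
      assume "e * f \<notin> gid \<phi>"
      then have "1 \<notin> ?J" by simp
      moreover have "\<exists>a. varp i ^ N - constp a \<in> ?J" for i using gid_var_power[OF cl] sub by blast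
      ultimately obtain q' :: "complex^'n" where q': "\<forall>g\<in>?J. evalp (($) q') g = 0"
        using nullstellensatz[OF J] by blast
      have "monev (($) q') v0 = monev (($) q) v0"
        using q'[rule_format, OF vJ] by (simp add: evalp_diff y_def)
      then have "q' = q" using zero_unique[OF cl p q, of q'] q' sub by blast
      then show False using q'[rule_format, OF sJ] s(1) by simp
    qed
  qed
  obtain b where b: "\<And>j. j < N \<Longrightarrow> wt (b j) = j \<and> \<phi> (b j) \<noteq> 0" using cluster_ex[OF cl] by metis
  have dN: "d \<le> N" using M dM by simp
  have binj: "inj_on b {..<d}" using b dN by (metis inj_onI lessThan_iff less_le_trans)
  have indep: "c (b j) = 0" if "(\<Sum>b\<in>b ` {..<d}. mterm b (c b)) \<in> ?K" "j < d" for c j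
  proof -
    \<comment> \<open>The weights \<open>t * d + i\<close> with \<open>t < M\<close> and
      \<open>i < d\<close> are distinct and below N, so the part of weight j sees only the term with
      t = 0 and i = j.\<close>
    have *: "wpart \<phi> j (mterm (nmult t v0) (y ^ (M - Suc t)) * mterm (b i) (c (b i))) =
        (if t = 0 then if i = j then y ^ (M - 1) * c (b j) * \<phi> (b j) else 0 else 0)" if "t < M" "i < d" for t i
    proof -
      have lt: "t * d + i < N"
      proof -
        have "t * d + i < (t + 1) * d" using that by simp
        also have "\<dots> \<le> M * d" using that by (intro mult_right_mono) auto
        finally show ?thesis by (simp add: M mult.commute)
      qed
      then have "wt (nmult t v0 + b i) = t * d + i"
        using b[of i] that dN by (simp add: wt_add wtn)
      moreover have "t * d + i = j \<longleftrightarrow> t = 0 \<and> i = j"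
        using that \<open>j < d\<close> dM by (cases t) auto
      ultimately show ?thesis by (auto simp: mult_single wpart_single)
    qed
    have "e * (\<Sum>b\<in>b ` {..<d}. mterm b (c b)) =
      (\<Sum>t<M. \<Sum>i<d. mterm (nmult t v0) (y ^ (M - Suc t)) * mterm (b i) (c (b i)))"
      unfolding e_def by (simp add: sum.reindex[OF binj] sum_product)
    then have "wpart \<phi> j (e * (\<Sum>b\<in>b ` {..<d}. mterm b (c b))) =
        (\<Sum>t<M. \<Sum>i<d. if t = 0 then if i = j then y ^ (M - 1) * c (b j) * \<phi> (b j) else 0 else 0)"
      by (simp add: wpart_sum *)
    also have "\<dots> = y ^ (M - 1) * c (b j) * \<phi> (b j)"
    proof -
      have "(\<Sum>i<d. if t = 0 then if i = j then y ^ (M - 1) * c (b j) * \<phi> (b j) else 0 else 0) =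
        (if t = 0 then y ^ (M - 1) * c (b j) * \<phi> (b j) else 0)" for t :: nat
        using that(2) by simp
      then show ?thesis using dM by simp
    qed
    finally have "wpart \<phi> j (e * (\<Sum>b\<in>b ` {..<d}. mterm b (c b))) = y ^ (M - 1) * c (b j) * \<phi> (b j)" .
    moreover have "wpart \<phi> j (e * (\<Sum>b\<in>b ` {..<d}. mterm b (c b))) = 0"
      using that dN unfolding K by (auto simp: gid_def)
    ultimately show ?thesis using y b[of j] that(2) dN by auto
  qed
  have idK: "ideal_of_polys ?K" by (rule ideal_local_kernel[OF id])
  have "quotient_basis UNIV ?K (monp ` b ` {..<d})"
  proof (rule quotient_basis_monpI[OF idK])
    show "finite (b ` {..<d})" by simp
    show "c b' = 0" if "(\<Sum>b\<in>b ` {..<d}. mterm b (c b)) \<in> ?K" "b' \<in> b ` {..<d}" for c b'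
      using indep[OF that(1)] that(2) by auto
    fix u
    \<comment> \<open>Modulo the local kernel, \<open>u\<close> is proportional to
      \<open>b j\<close> times \<open>v0^t\<close>, and \<open>v0\<close> equals the constant
      \<open>y\<close>.\<close>
    define j t where "j = wt u mod d" and "t = wt u div d"
    have j: "j < d" using dM by (simp add: j_def)
    let ?v = "b j + nmult t v0"
    have tu: "t * d + j = wt u" by (simp add: j_def t_def)
    have "wt ?v = wt u"
      using b[of j] j dN tu wt_less[of u] by (simp add: wt_add wtn mod_add_right_eq add.commute)
    then have bin: "mterm u (\<phi> ?v) - mterm ?v (\<phi> u) \<in> ?K"
      using gid_binomial[of u ?v \<phi>] local_kernel_superset by auto
    have vy: "monp v0 - constp y \<in> ?K" unfolding K using ve by (simp add: mult.commute)
    have "monp v0 ^ t - constp (y ^ t) \<in> ?K"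
    proof -
      have "(\<Sum>i<t. constp y ^ (t - Suc i) * monp v0 ^ i) * (monp v0 - constp y) \<in> ?K"
        by (rule ideal_mult[OF idK vy])
      then show ?thesis using power_diff_sumr2[of "monp v0" t "constp y"] by (simp add: cp mult.commute)
    qed
    from ideal_mult[OF idK this, of "monp (b j)"]
    have vb: "monp ?v - mterm (b j) (y ^ t) \<in> ?K"
      by (simp add: right_diff_distrib mult_single flip: monp_nmult)
    have nv: "\<phi> ?v \<noteq> 0"
    proof
      assume "\<phi> ?v = 0"
      then have "monp ?v \<in> gid \<phi>" by (simp add: gid_def wpart_single)
      then have "monp ?v \<in> ?K" using local_kernel_superset by auto
      then have "mterm (b j) (y ^ t) \<in> ?K" using ideal_diff[OF idK _ vb] by fastforce
      moreover have "(\<Sum>b'\<in>b ` {..<d}. mterm b' (if b' = b j then y ^ t else 0)) =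
          mterm (b j) (y ^ t)"
        using j by (simp add: sum.delta if_distrib[of "mterm _"] cong: if_cong)
      ultimately have "y ^ t = 0" using indep[of "\<lambda>b'. if b' = b j then y ^ t else 0" j] j by simp
      then show False using y by simp
    qed
    let ?c = "\<phi> u / \<phi> ?v"
    have "constp (inverse (\<phi> ?v)) * (mterm u (\<phi> ?v) - mterm ?v (\<phi> u)) +
        constp ?c * (monp ?v - mterm (b j) (y ^ t)) \<in> ?K"
      by (intro ideal_add[OF idK] ideal_mult[OF idK] bin vb)
    also have "constp (inverse (\<phi> ?v)) * (mterm u (\<phi> ?v) - mterm ?v (\<phi> u)) +
        constp ?c * (monp ?v - mterm (b j) (y ^ t)) = monp u - mterm (b j) (?c * y ^ t)"
      using nv by (simp add: right_diff_distrib mult_single field_simps)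
    finally show "\<exists>b'\<in>b ` {..<d}. \<exists>c. monp u - mterm b' c \<in> ?K" using j by blast
  qed
  moreover have "card (monp ` b ` {..<d} :: 'n cpoly set) = d"
    by (simp add: card_image inj_monp binj)
  ultimately show ?thesis
    by (intro hilbert_chow_eqI[OF id]) (auto simp: has_quotient_dim_def)
qed

section \<open>Orbit cycles and stabilizers\<close>

lemma card_mod_class:
  assumes "0 < M"
  shows "card {j. j < d * M \<and> j mod M = k mod M} = d"
proof -
  have "bij_betw (\<lambda>t. k mod M + t * M) {..<d} {j. j < d * M \<and> j mod M = k mod M}"
  proof (rule bij_betwI[where g = "\<lambda>j. j div M"])
    show "(\<lambda>t. k mod M + t * M) \<in> {..<d} \<rightarrow> {j. j < d * M \<and> j mod M = k mod M}"
    proof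
      fix t assume "t \<in> {..<d}"
      then have "(t + 1) * M \<le> d * M" by (intro mult_right_mono) auto
      moreover have "k mod M < M" using assms by simp
      ultimately show "k mod M + t * M \<in> {j. j < d * M \<and> j mod M = k mod M}" by simp
    qed
    show "(\<lambda>j. j div M) \<in> {j. j < d * M \<and> j mod M = k mod M} \<rightarrow> {..<d}"
      using assms by (auto simp: less_mult_imp_div_less)
    show "(k mod M + x * M) div M = x" for x using assms by simp
    show "k mod M + y div M * M = y" if "y \<in> {j. j < d * M \<and> j mod M = k mod M}" for y
    proof -
      have "k mod M = y mod M" using that by simp
      then show ?thesis by (simp only: mod_div_mult_eq)
    qed
  qed
  from bij_betw_same_card[OF this] show ?thesis by simp
qed

text \<open>Nonvanishing coordinates have weights divisible by \<open>d\<close>, and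
  \<open>v0\<close> has weight \<open>d\<close> modulo N, so two group elements agree on
  \<open>q\<close> exactly when their indices agree modulo \<open>M = N / d\<close>. Thus each point
  of the orbit arises \<open>d\<close> times.\<close>

lemma orbit_cycle_diag:
  assumes p: "period q d v0"
  shows "orbit_cycle grp q (diag k *v q) = d"
proof -
  obtain M where M: "N = d * M" using p by (auto simp: period_def)
  have dM: "0 < d" "0 < M" using p M N_pos by (auto simp: period_def)
  have iff: "diag j *v q = diag k *v q \<longleftrightarrow> j mod M = k mod M" for j
  proof -
    have nm: "j * d mod N = k * d mod N \<longleftrightarrow> j mod M = k mod M"
      unfolding M by (simp add: mult.commute[of _ d] mult_mod_right[symmetric] dM less_imp_neq)
        (use dM in auto)
    show ?thesis
    proof
      assume "diag j *v q = diag k *v q"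
      then have "monev (($) (diag j *v q)) v0 = monev (($) (diag k *v q)) v0" by simp
      then have "\<epsilon> ^ (j * (d mod N)) = \<epsilon> ^ (k * (d mod N))"
        using p by (simp add: monev_diag period_def)
      then show "j mod M = k mod M" unfolding eps_eq_iff mod_mult_right_eq nm .
    next
      assume "j mod M = k mod M"
      then have jk: "j * d mod N = k * d mod N" unfolding nm .
      show "diag j *v q = diag k *v q"
        unfolding vec_eq_iff diag_vec
      proof
        fix i
        show "\<epsilon> ^ (j * w i) * q $ i = \<epsilon> ^ (k * w i) * q $ i"
        proof (cases "q $ i = 0")
          case False
          then have "d dvd wt (mterm i 1)" using p by (simp add: period_def monev_single)
          then obtain s where s: "w i mod N = d * s" by (auto simp: wt_def)
          have "j * w i mod N = (j * d) * s mod N"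
            by (metis s mod_mult_right_eq mult.assoc)
          also have "\<dots> = (k * d) * s mod N" using jk by (metis mod_mult_left_eq)
          also have "\<dots> = k * w i mod N" by (metis s mod_mult_right_eq mult.assoc)
          finally show ?thesis by (simp add: eps_eq_iff)
        qed simp
      qed
    qed
  qed
  have "{g \<in> grp. g *v q = diag k *v q} = diag ` {j. j < d * M \<and> j mod M = k mod M}"
    using iff by (auto simp: grp_def M[symmetric])
  moreover have "inj_on diag {j. j < d * M \<and> j mod M = k mod M}"
    by (rule inj_on_subset[OF diag_inj]) (auto simp: M)
  ultimately show ?thesis
    by (simp add: orbit_cycle_def card_image card_mod_class[OF dM(2)])
qed

theorem hilbert_chow_orbit:
  assumes cl: "cluster \<phi>" and q: "\<forall>f\<in>gid \<phi>. evalp (($) q) f = 0"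
  shows "hilbert_chow (gid \<phi>) = orbit_cycle grp q"
proof
  fix q'
  obtain d v0 where p: "period q d v0" using period_exists by blast
  show "hilbert_chow (gid \<phi>) q' = orbit_cycle grp q q'"
  proof (cases "\<exists>k. q' = diag k *v q")
    case True
    then obtain k where k: "q' = diag k *v q" by auto
    have "hilbert_chow (gid \<phi>) q' = d"
      unfolding k using diag_vanishing[OF cl q] by (intro hilbert_chow_gid[OF cl period_diag[OF p]]) auto
    then show ?thesis unfolding k orbit_cycle_diag[OF p] .
  next
    case False
    then obtain f where "f \<in> gid \<phi>" "evalp (($) q') f \<noteq> 0"
      using zeros_are_orbit[OF cl q, of q'] by blast
    then have "hilbert_chow (gid \<phi>) q' = 0" by (rule hilbert_chow_eq_0[OF ideal_gid[OF cl]])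
    moreover have "{g \<in> grp. g *v q = q'} = {}" using False by (auto simp: grp_def)
    ultimately show ?thesis by (simp add: orbit_cycle_def del: Collect_empty_eq)
  qed
qed

end

section \<open>The dominating component\<close>

lemma monomial_induct [case_names zero add]:
  fixes u :: "'i monomial"
  assumes "P 0" "\<And>u i. P u \<Longrightarrow> P (u + mterm i 1)"
  shows "P u"
proof -
  have step: "P (v + nmult k (mterm i 1))" if "P v" for v k i
  proof (induction k)
    case (Suc k)
    have "v + nmult (Suc k) (mterm i 1) =
        (v + nmult k (mterm i 1)) + mterm i 1"
      by (simp add: nmult_Suc add_ac)
    then show ?case using assms(2)[OF Suc] by simp
  qed (simp add: that)
  have nm: "nmult k (mterm i 1) = mterm i k" for k and i :: 'i
    by (simp add: nmult_def sum_single_nat[simplified])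
  have "P (\<Sum>i\<in>A. mterm i (lk u i))" if "finite A" for A
    using that
  proof (induction A rule: finite_induct)
    case (insert i A)
    then show ?case using step[OF insert.IH, of "lk u i" i] by (simp add: nm[simplified] add.commute)
  qed (simp add: assms)
  from this[of "mkeys u"] show ?thesis by (simp add: monomial_eq_sum)
qed

lemma coordinate_poly: "(\<lambda>p. p $ i) \<in> range (\<lambda>f p. evalp (($) p) f)"
  by (rule range_eqI[of _ _ "varp i"]) (simp add: monev_single)

context cyclic
begin

abbreviation xpow :: "nat \<Rightarrow> 'n monomial" where "xpow k \<equiv> mterm i0 k"

definition xbasis :: "'n monomial set" where "xbasis = xpow ` {..<N}"

lemma wt_xpow: "wt (xpow k) = k mod N" by (simp add: wt_def w_i0)

lemma section_xbasis: "section_of xbasis"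
proof -
  have "inj_on xpow {..<N}" by (rule inj_onI) (metis lookup_single_eq)
  then show ?thesis
    unfolding section_of_def xbasis_def by (auto simp: card_image inj_on_def wt_xpow)
qed

text \<open>The chart of \<open>xbasis\<close> in the fixed locus is an affine space with coordinates \<open>p\<close>:
  \<open>x^N = p i0\<close> for the variable \<open>x\<close> of weight 1, and \<open>x\<^sub>i = p i * x ^ w i\<close> for the others.\<close>

definition xfam :: "complex^'n \<Rightarrow> 'n monomial \<Rightarrow> complex"
  where "xfam p u = p $ i0 ^ (wdeg u div N) * (\<Prod>i\<in>UNIV - {i0}. p $ i ^ lk u i)"

text \<open>The carries in addition modulo N form a cocycle. This is the identity needed for the
  exponent \<open>wdeg u div N\<close> in \<open>xfam\<close>.\<close>

lemma div_add_swap: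
  fixes a b s :: nat
  assumes "a mod N = b mod N"
  shows "a div N + (b + s) div N = b div N + (a + s) div N"
proof -
  have *: "(c + s) div N = c div N + (c mod N + s) div N" for c
  proof -
    have "c + s = (c mod N + s) + N * (c div N)" by simp
    then have "(c + s) div N = ((c mod N + s) + N * (c div N)) div N" by simp
    also have "\<dots> = c div N + (c mod N + s) div N" using N_pos by (subst div_mult_self2) auto
    finally show ?thesis .
  qed
  show ?thesis unfolding *[of a] *[of b] assms by simp
qed

lemma xfam_xpow: "k < N \<Longrightarrow> xfam p (xpow k) = 1"
  by (auto simp: xfam_def w_i0 lookup_single when_def intro!: prod.neutral)

lemma cluster_xfam: "cluster (xfam p)"
  unfolding cluster_def
proof (intro conjI allI impI)
  fix u v s assume "wt u = wt v"
  then have "wdeg u div N + (wdeg v + wdeg s) div N = wdeg v div N + (wdeg u + wdeg s) div N"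
    by (intro div_add_swap) (simp add: wt_def)
  then have "p $ i0 ^ (wdeg u div N) * p $ i0 ^ ((wdeg v + wdeg s) div N) =
      p $ i0 ^ (wdeg v div N) * p $ i0 ^ ((wdeg u + wdeg s) div N)"
    by (simp only: power_add[symmetric])
  then show "xfam p u * xfam p (v + s) = xfam p v * xfam p (u + s)"
    by (simp add: xfam_def wdeg_add lookup_add power_add prod.distrib mult_ac)
next
  fix j assume "j < N"
  then show "\<exists>u. wt u = j \<and> xfam p u \<noteq> 0"
    by (intro exI[of _ "xpow j"]) (simp add: wt_xpow xfam_xpow)
qed

lemma xfam_poly: "(\<lambda>p. xfam p u) \<in> range (\<lambda>f p. evalp (($) p) f)"
  unfolding xfam_def
  by (intro fun_alg_mult[OF fun_alg_polys] fun_alg_power[OF fun_alg_polys] fun_alg_prod[OF fun_alg_polys]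
      coordinate_poly)

text \<open>Comparing \<open>u\<close> with the power of x of the same weight gives
  \<open>\<theta> (u + s) = \<theta> u * \<theta> (xpow (wt u) + s)\<close>. Inductively all values
  reduce to those at a power of x times one variable.\<close>

lemma cluster_unique:
  assumes cl: "cluster \<phi>" "cluster \<psi>"
    and x: "\<And>k. k < N \<Longrightarrow> \<phi> (xpow k) = 1" "\<And>k. k < N \<Longrightarrow> \<psi> (xpow k) = 1"
    and xN: "\<phi> (xpow N) = \<psi> (xpow N)"
    and var: "\<And>i. i \<noteq> i0 \<Longrightarrow> \<phi> (mterm i 1) = \<psi> (mterm i 1)"
  shows "\<phi> u = \<psi> u"
proof -
  have step: "\<theta> (u + s) = \<theta> u * \<theta> (xpow (wt u) + s)"
    if "cluster \<theta>" "\<And>k. k < N \<Longrightarrow> \<theta> (xpow k) = 1" for \<theta> u s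
    using clusterD[OF that(1), of u "xpow (wt u)" s] that(2)[OF wt_less] wt_less[of u] by (simp add: wt_xpow)
  have A: "\<phi> (xpow k) = \<psi> (xpow k)" if "k < 2 * N" for k
  proof (cases "k < N")
    case False
    then have k: "xpow k = xpow N + xpow (k - N)" by (simp add: single_add[symmetric])
    have "k - N < N" using that False by auto
    then show ?thesis
      unfolding k using step[OF cl(1) x(1), of "xpow N" "xpow (k - N)"]
        step[OF cl(2) x(2), of "xpow N" "xpow (k - N)"] xN x
      by (simp add: wt_xpow)
  qed (simp add: x)
  have B: "\<phi> (xpow k + mterm i 1) = \<psi> (xpow k + mterm i 1)" if "k < N" for k i
  proof (cases "i = i0")
    case True
    then have "xpow k + mterm i 1 = xpow (k + 1)" by (simp add: single_add[symmetric])
    then show ?thesis using A[of "k + 1"] that by simp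
  next
    case False
    let ?x = "mterm i 1"
    have "xpow (wt ?x) + xpow k = xpow (wt ?x + k)" by (simp add: single_add)
    moreover have "wt ?x + k < 2 * N" using wt_less[of ?x] that by simp
    ultimately show ?thesis
      using step[OF cl(1) x(1), of ?x "xpow k"] step[OF cl(2) x(2), of ?x "xpow k"] var[OF False] A
      by (simp add: add.commute[of "xpow k"])
  qed
  show ?thesis
  proof (induction u rule: monomial_induct)
    case zero
    then show ?case using x[of 0] N_pos by simp
  next
    case (add u i)
    then show ?case
      using step[OF cl(1) x(1), of u "mterm i 1"] step[OF cl(2) x(2), of u "mterm i 1"]
        B[OF wt_less[of u]] by simp
  qed
qed

section \<open>The component as the closure of an affine chart\<close>

abbreviation fixed_top where "fixed_top \<equiv> subtopology (zariski_Hilb N) (Hilb_fixed grp)"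

definition xchart :: "'n cpoly set set" where "xchart = Hilb_fixed grp \<inter> Hilb_chart N xbasis"

definition main_component :: "'n cpoly set set" where "main_component = fixed_top closure_of xchart"

lemma xchart_gidI:
  assumes "cluster \<phi>" "\<And>k. k < N \<Longrightarrow> \<phi> (xpow k) \<noteq> 0"
  shows "gid \<phi> \<in> xchart"
  unfolding xchart_def using gid_Hilb_fixed[OF assms(1)] gid_chart_iff[OF assms(1)] section_xbasis assms(2)
  by (auto simp: xbasis_def)

lemma xchart_eq: "xchart = range (\<lambda>p. gid (xfam p))"
proof
  show "range (\<lambda>p. gid (xfam p)) \<subseteq> xchart"
    using xchart_gidI[OF cluster_xfam] xfam_xpow by auto
  show "xchart \<subseteq> range (\<lambda>p. gid (xfam p))"
  proof
    fix I assume "I \<in> xchart"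
    then have I: "I \<in> Hilb_fixed grp" "I \<in> Hilb_chart N xbasis" by (auto simp: xchart_def)
    obtain \<phi> where \<phi>: "cluster \<phi>" "I = gid \<phi>" "\<forall>b\<in>xbasis. \<phi> b = 1"
      using fixed_eq_gid[OF I section_xbasis, of xpow] by (auto simp: xbasis_def wt_xpow)
    define p :: "complex^'n" where
      "p = (\<chi> i. if i = i0 then \<phi> (xpow N) else \<phi> (mterm i 1))"
    have "\<phi> u = xfam p u" for u
    proof (rule cluster_unique[OF \<phi>(1) cluster_xfam _ xfam_xpow])
      show "\<phi> (xpow k) = 1" if "k < N" for k using \<phi>(3) that by (auto simp: xbasis_def)
      have "(\<Prod>i\<in>UNIV - {i0}. p $ i ^ lk (xpow N) i) = 1"
        by (auto simp: lookup_single when_def intro!: prod.neutral)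
      then show "\<phi> (xpow N) = xfam p (xpow N)" using N_pos by (simp add: xfam_def w_i0 p_def)
      fix i assume i: "i \<noteq> i0"
      have "(\<Prod>k\<in>UNIV - {i0}. p $ k ^ lk (mterm i 1) k) = (\<Prod>k\<in>UNIV - {i0}. if k = i then p $ k else 1)"
        by (rule prod.cong) (auto simp: lookup_single when_def)
      then show "\<phi> (mterm i 1) = xfam p (mterm i 1)"
        using i w_less[of i] by (simp add: xfam_def p_def)
    qed
    then have "\<phi> = xfam p" by auto
    then show "I \<in> range (\<lambda>p. gid (xfam p))" using \<phi>(2) by auto
  qed
qed

lemma openin_xchart: "openin fixed_top xchart"
  unfolding xchart_def by (rule openin_subtopology_Int2[OF openin_Hilb_chart_1])

lemma continuous_gid_fixed:
  fixes \<phi> :: "complex^'k::finite \<Rightarrow> 'n monomial \<Rightarrow> complex"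
  assumes "\<And>p. cluster (\<phi> p)" "\<And>u. (\<lambda>p. \<phi> p u) \<in> range (\<lambda>f p. evalp (($) p) f)"
  shows "continuous_map zariski_affine fixed_top (\<lambda>p. gid (\<phi> p))"
  using continuous_gid[OF assms] gid_Hilb_fixed[OF assms(1)]
  by (auto simp: continuous_map_in_subtopology)

lemma irreducible_xchart: "irreducible_in fixed_top xchart"
  unfolding xchart_eq
  by (rule irreducible_in_image[OF irreducible_zariski_affine continuous_gid_fixed[OF cluster_xfam xfam_poly]])

lemma xchart_subset: "xchart \<subseteq> main_component"
  unfolding main_component_def using irreducible_xchart
  by (intro closure_of_subset) (simp add: irreducible_in_def)

lemma irreducible_main_component: "irreducible_in fixed_top main_component"
  unfolding main_component_def by (rule irreducible_in_closure_of[OF irreducible_xchart])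

lemma irreducible_subset_main_component:
  assumes "irreducible_in fixed_top T" "T \<inter> xchart \<noteq> {}"
  shows "T \<subseteq> main_component"
  unfolding main_component_def
  by (rule subset_trans[OF irreducible_in_subset_closure_of[OF assms(1) openin_xchart assms(2)]
        closure_of_mono[OF Int_lower2]])

lemma component_main_component: "irreducible_component_of fixed_top main_component"
  unfolding irreducible_component_of_def
proof (intro conjI allI impI irreducible_main_component)
  fix T assume T: "irreducible_in fixed_top T \<and> main_component \<subseteq> T"
  then have "T \<inter> xchart \<noteq> {}" using xchart_subset irreducible_xchart by (auto simp: irreducible_in_def)
  then show "T = main_component" using irreducible_subset_main_component T by blast
qed

lemma main_component_subset: "main_component \<subseteq> Hilb_fixed grp" "main_component \<subseteq> topspace (zariski_Hilb N)"
  using closure_of_subset_topspace[of fixed_top xchart] by (auto simp: main_component_def)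

text \<open>A chart is open, so one that contains a point of the closure also meets
  \<open>xchart\<close>, where \<open>gid_chart_iff\<close> identifies the possible bases.\<close>

lemma main_component_chart_section:
  assumes "I \<in> main_component" "I \<in> Hilb_chart N B"
  shows "section_of B"
proof -
  have "openin fixed_top (Hilb_fixed grp \<inter> Hilb_chart N B)"
    by (rule openin_subtopology_Int2[OF openin_Hilb_chart_1])
  moreover have "I \<in> Hilb_fixed grp \<inter> Hilb_chart N B" using assms main_component_subset by auto
  ultimately obtain J where "J \<in> xchart" "J \<in> Hilb_chart N B"
    using assms(1) unfolding main_component_def in_closure_of by (meson IntD2)
  then obtain p where "gid (xfam p) \<in> Hilb_chart N B" unfolding xchart_eq by auto
  then show ?thesis using gid_chart_iff[OF cluster_xfam] by blast
qed

lemma section_choice: "section_of B \<Longrightarrow> \<exists>bs. \<forall>j<N. bs j \<in> B \<and> wt (bs j) = j"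
  using section_of_ex[of B] by metis

lemma main_component_gid:
  assumes "I \<in> main_component"
  shows "\<exists>\<phi>. cluster \<phi> \<and> I = gid \<phi>"
proof -
  obtain B where B: "I \<in> Hilb_chart N B" using zariski_Hilb_in_chart assms main_component_subset by blast
  have sec: "section_of B" by (rule main_component_chart_section[OF assms B])
  obtain bs where "\<forall>j<N. bs j \<in> B \<and> wt (bs j) = j" using section_choice[OF sec] by auto
  then show ?thesis using fixed_eq_gid[OF _ B sec, of bs] assms main_component_subset by blast
qed

subsection \<open>Domination of the quotient\<close>

text \<open>For \<open>p $ i0 \<noteq> 0\<close> the orbit of \<open>p\<close> is free, and
  evaluation at \<open>p\<close> is the function \<open>\<phi>\<close> belonging to its
  ideal.\<close>

lemma cluster_point:
  assumes "p $ i0 \<noteq> 0"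
  shows "cluster (monev (($) p))"
  unfolding cluster_def
proof (intro conjI allI impI)
  fix j assume "j < N"
  then show "\<exists>u. wt u = j \<and> monev (($) p) u \<noteq> 0"
    using assms by (intro exI[of _ "xpow j"]) (simp add: wt_xpow monev_single)
qed (simp add: monev_add)

lemma evalp_eq_sum_wpart: "evalp (($) p) f = (\<Sum>j<N. wpart (monev (($) p)) j f)"
proof -
  have "evalp (($) p) f = evalp (($) p) (\<Sum>j<N. hcomp j f)" by (simp add: hcomp_sum)
  then show ?thesis by (simp add: evalp_linf linf_sum linf_hcomp)
qed

lemma point_zero: "\<forall>f\<in>gid (monev (($) p)). evalp (($) p) f = 0"
  unfolding evalp_eq_sum_wpart by (simp add: gid_def)

lemma point_xchart: "p $ i0 \<noteq> 0 \<Longrightarrow> gid (monev (($) p)) \<in> xchart"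
  by (intro xchart_gidI cluster_point) (simp_all add: monev_single)

lemma orbit_cycle_self: "orbit_cycle grp p p > 0"
proof -
  have "diag 0 \<in> {g \<in> grp. g *v p = p}" using diag_in_grp[of 0] by (simp add: diag_0)
  moreover have "finite grp" by (simp add: grp_def)
  ultimately show ?thesis unfolding orbit_cycle_def by (intro card_gt_0_iff[THEN iffD2]) auto
qed

lemma orbit_cycle_eq_orbit:
  assumes "orbit_cycle grp p = orbit_cycle grp q"
  shows "\<exists>k. p = diag k *v q"
proof -
  have "orbit_cycle grp q p > 0" using orbit_cycle_self[of p] assms by simp
  then have "{g \<in> grp. g *v q = p} \<noteq> {}" unfolding orbit_cycle_def by (metis card.empty less_irrefl)
  then show ?thesis by (auto simp: grp_def)
qed

lemma dominates_main_component: "dominates_quotient grp main_component"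
  unfolding dominates_quotient_def
proof (intro conjI allI impI)
  show "hilbert_chow ` main_component \<subseteq> range (orbit_cycle grp)"
  proof
    fix c assume "c \<in> hilbert_chow ` main_component"
    then obtain \<phi> where \<phi>: "cluster \<phi>" "c = hilbert_chow (gid \<phi>)" using main_component_gid by blast
    obtain q :: "complex^'n" where "\<forall>f\<in>gid \<phi>. evalp (($) q) f = 0" using gid_zero_exists[OF \<phi>(1)] by auto
    then show "c \<in> range (orbit_cycle grp)" using hilbert_chow_orbit[OF \<phi>(1)] \<phi>(2) by auto
  qed
next
  fix C assume C: "C \<subseteq> range (orbit_cycle grp)"
    and C2: "closedin zariski_affine {p. orbit_cycle grp p \<in> C} \<and> hilbert_chow ` main_component \<subseteq> C"
  let ?P = "{p. orbit_cycle grp p \<in> C}"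
  have sub: "p \<in> ?P" if "p $ i0 \<noteq> 0" for p
  proof -
    have "gid (monev (($) p)) \<in> main_component" using point_xchart[OF that] xchart_subset by auto
    then have "hilbert_chow (gid (monev (($) p))) \<in> C" using C2 by auto
    then show ?thesis using hilbert_chow_orbit[OF cluster_point[OF that] point_zero] by simp
  qed
  have op: "openin zariski_affine (- ?P)" using C2 by (simp add: closedin_def Compl_eq_Diff_UNIV)
  have "?P = UNIV"
  proof (rule ccontr)
    assume "?P \<noteq> UNIV"
    then obtain p where "p \<in> - ?P" by auto
    then obtain f where f: "evalp (($) p) f \<noteq> 0" "\<forall>q. evalp (($) q) f \<noteq> 0 \<longrightarrow> q \<in> - ?P"
      using openin_zariski_affine_nonvanishing[OF op] by auto
    have "evalp (($) (\<chi> i. 1)) (varp i0) \<noteq> 0" by (simp add: monev_single)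
    from evalp_common_nonvanishing[OF f(1) this] obtain r :: "complex^'n" where
      "evalp (($) r) f \<noteq> 0" "evalp (($) r) (varp i0) \<noteq> 0" by auto
    then show False using f(2) sub[of r] by (simp add: monev_single)
  qed
  then show "C = range (orbit_cycle grp)" using C by auto
qed

text \<open>The weight components of an element of \<open>I\<close> vanish at \<open>p\<close>,
  which puts \<open>I\<close> inside the orbit ideal; equal colength makes them equal.\<close>

lemma fixed_over_point:
  assumes "I \<in> Hilb_fixed grp" "hilbert_chow I = orbit_cycle grp p" "p $ i0 \<noteq> 0"
  shows "I = gid (monev (($) p))"
proof (rule Hilb_subset_eq)
  show I: "I \<in> Hilb N" using assms(1) by (simp add: Hilb_fixed_iff)
  then have id: "ideal_of_polys I" by (simp add: Hilb_def)
  show "gid (monev (($) p)) \<in> Hilb N" by (rule gid_Hilb[OF cluster_point[OF assms(3)]])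
  have van: "evalp (($) p) f = 0" if "f \<in> I" for f
  proof (rule ccontr)
    assume "evalp (($) p) f \<noteq> 0"
    from hilbert_chow_eq_0[OF id that this] show False using orbit_cycle_self[of p] assms(2) by simp
  qed
  show "I \<subseteq> gid (monev (($) p))"
  proof
    fix f assume f: "f \<in> I"
    have "wpart (monev (($) p)) j f = 0" if "j < N" for j
      using van[of "hcomp j f"] assms(1) f that unfolding Hilb_fixed_iff by (auto simp: evalp_linf linf_hcomp)
    then show "f \<in> gid (monev (($) p))" by (simp add: gid_def)
  qed
qed

text \<open>The image of the hyperplane \<open>p $ i0 = 0\<close> is closed and proper, so a
  dominating \<open>Z\<close> has a point over its complement. That point is the ideal of a free
  orbit and lies in \<open>xchart\<close>; maximality of \<open>Z\<close> gives equality.\<close>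

lemma dominating_component_unique:
  assumes "irreducible_component_of fixed_top Z" "dominates_quotient grp Z"
  shows "Z = main_component"
proof -
  let ?C = "orbit_cycle grp ` {p. p $ i0 = 0}"
  have irr: "irreducible_in fixed_top Z" using assms(1) by (simp add: irreducible_component_of_def)
  have "{p. orbit_cycle grp p \<in> ?C} = {p. p $ i0 = 0}"
  proof (intro equalityI subsetI)
    fix p assume "p \<in> {p. orbit_cycle grp p \<in> ?C}"
    then obtain q where q: "orbit_cycle grp p = orbit_cycle grp q" "q $ i0 = 0" by auto
    then obtain k where "p = diag k *v q" using orbit_cycle_eq_orbit by blast
    then show "p \<in> {p. p $ i0 = 0}" using q by (simp add: diag_vec)
  qed auto
  moreover have "closedin zariski_affine {p :: complex^'n. p $ i0 = 0}"
    using openin_zariski_affine_basic[of "varp i0"]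
    by (simp add: closedin_def monev_single Compl_eq_Diff_UNIV[symmetric] Collect_neg_eq[symmetric])
  ultimately have cl: "closedin zariski_affine {p. orbit_cycle grp p \<in> ?C}" by simp
  have "\<not> hilbert_chow ` Z \<subseteq> ?C"
  proof
    assume "hilbert_chow ` Z \<subseteq> ?C"
    moreover have "?C \<subseteq> range (orbit_cycle grp)" by auto
    ultimately have "?C = range (orbit_cycle grp)"
      using assms(2)[unfolded dominates_quotient_def, THEN conjunct2, rule_format, of ?C] cl by simp
    define p :: "complex^'n" where "p = (\<chi> i. 1)"
    have "orbit_cycle grp p \<in> ?C" unfolding \<open>?C = _\<close> by simp
    then obtain q where q: "orbit_cycle grp p = orbit_cycle grp q" "q $ i0 = 0" by auto
    then obtain k where "p = diag k *v q" using orbit_cycle_eq_orbit by blast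
    then have "p $ i0 = (diag k *v q) $ i0" by simp
    then show False using q by (simp add: diag_vec p_def)
  qed
  then obtain I where I: "I \<in> Z" "hilbert_chow I \<notin> ?C" by auto
  moreover have "hilbert_chow I \<in> range (orbit_cycle grp)"
    using assms(2)[unfolded dominates_quotient_def, THEN conjunct1] I(1) by auto
  ultimately obtain p where p: "hilbert_chow I = orbit_cycle grp p" "p $ i0 \<noteq> 0" by auto
  have "I \<in> Hilb_fixed grp" using I(1) irr by (auto simp: irreducible_in_def)
  from fixed_over_point[OF this p] have "I \<in> xchart" using point_xchart[OF p(2)] by simp
  then have "Z \<inter> xchart \<noteq> {}" using I(1) by auto
  then have "Z \<subseteq> main_component" by (rule irreducible_subset_main_component[OF irr])
  then have "main_component = Z"
    using assms(1)[unfolded irreducible_component_of_def, THEN conjunct2, rule_format, of main_component]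
      irreducible_main_component by simp
  then show ?thesis by simp
qed

theorem G_Hilb_eq: "G_Hilb grp = main_component"
  unfolding G_Hilb_def card_grp
proof (rule the_equality)
  show "irreducible_component_of fixed_top main_component \<and> dominates_quotient grp main_component"
    by (rule conjI[OF component_main_component dominates_main_component])
qed (elim conjE, rule dominating_component_unique)

end

section \<open>The dimension bound\<close>

text \<open>Exponent vectors are lists, so that the first function can be split off in an induction
  along a chain.\<close>

definition pprod :: "(nat \<Rightarrow> 'p \<Rightarrow> complex) \<Rightarrow> nat list \<Rightarrow> 'p \<Rightarrow> complex"
  where "pprod f e s = (\<Prod>i<length e. f i s ^ (e ! i))"

lemma pprod_Cons: "pprod f (a # e) s = f 0 s ^ a * pprod (\<lambda>i. f (Suc i)) e s"
  by (simp add: pprod_def prod.lessThan_Suc_shift del: prod.lessThan_Suc)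

lemma fun_alg_pprod: "fun_alg R \<Longrightarrow> (\<And>i. f i \<in> R) \<Longrightarrow> pprod f e \<in> R"
  unfolding pprod_def[abs_def] by (intro fun_alg_prod fun_alg_power)

lemma closure_of_meets: "x \<in> X closure_of S \<Longrightarrow> openin X T \<Longrightarrow> x \<in> T \<Longrightarrow> \<exists>y\<in>S. y \<in> T"
  by (auto simp: in_closure_of)

text \<open>Functions \<open>f i\<close> cutting down a chain of irreducible sets satisfy no polynomial relation: divide by the
  lowest power of \<open>f 0\<close> and restrict to the next set.\<close>

lemma chain_no_relation:
  assumes R: "fun_alg R" "\<And>i. f i \<in> R"
    and prime: "\<And>i g h. i \<le> n \<Longrightarrow> g \<in> R \<Longrightarrow> h \<in> R \<Longrightarrow> \<forall>s\<in>T i. g s * h s = 0 \<Longrightarrow>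
      (\<forall>s\<in>T i. g s = 0) \<or> (\<forall>s\<in>T i. h s = 0)"
    and chain: "\<And>i. i < n \<Longrightarrow> T (Suc i) \<subseteq> T i" "\<And>i s. i < n \<Longrightarrow> s \<in> T (Suc i) \<Longrightarrow> f i s = 0"
      "\<And>i. i < n \<Longrightarrow> \<exists>s\<in>T i. f i s \<noteq> 0" "T n \<noteq> {}"
    and E: "finite E" "E \<noteq> {}" "\<And>e. e \<in> E \<Longrightarrow> length e = n \<and> c e \<noteq> 0"
    and rel: "\<And>s. s \<in> T 0 \<Longrightarrow> (\<Sum>e\<in>E. c e * pprod f e s) = 0"
  shows False
  using assms
proof (induction n arbitrary: T f E c)
  case 0
  then obtain s where s: "s \<in> T 0" by auto
  have "E = {[]}" using 0(8,9) 0(10) by auto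
  then show False using 0(11)[OF s] 0(10)[of "[]"] by (simp add: pprod_def)
next
  case (Suc n)
  note R = Suc.prems(1,2) and prime = Suc.prems(3) and chain = Suc.prems(4-7)
    and E = Suc.prems(8-10) and rel = Suc.prems(11)
  \<comment> \<open>The lowest power of \<open>f 0\<close> in the relation: \<open>f 0 ^ a\<close>
    is not identically 0 on \<open>T 0\<close>, so by \<open>prime\<close> it can be
    cancelled.\<close>
  define a where "a = Min (hd ` E)"
  have aE: "a \<in> hd ` E" unfolding a_def using E by (intro Min_in) auto
  have ale: "a \<le> hd e" if "e \<in> E" for e unfolding a_def using E that by (intro Min_le) auto
  let ?f = "\<lambda>i. f (Suc i)"
  have cons: "e = hd e # tl e" if "e \<in> E" for e using E(3)[OF that] by (cases e) auto
  define g where "g s = (\<Sum>e\<in>E. c e * (f 0 s ^ (hd e - a) * pprod ?f (tl e) s))" for s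
  have gR: "g \<in> R"
    unfolding g_def[abs_def]
    by (intro fun_alg_sum fun_alg_mult fun_alg_const fun_alg_power fun_alg_pprod R)
  have "f 0 s ^ a * g s = 0" if "s \<in> T 0" for s
  proof -
    have "f 0 s ^ a * g s = (\<Sum>e\<in>E. c e * pprod f e s)"
      unfolding g_def sum_distrib_left
    proof (rule sum.cong[OF refl])
      fix e assume e: "e \<in> E"
      have "pprod f e s = f 0 s ^ (a + (hd e - a)) * pprod ?f (tl e) s"
        using ale[OF e] by (subst cons[OF e]) (simp add: pprod_Cons)
      then show "f 0 s ^ a * (c e * (f 0 s ^ (hd e - a) * pprod ?f (tl e) s)) = c e * pprod f e s"
        by (simp add: power_add)
    qed
    then show ?thesis using rel[OF that] by simp
  qed
  moreover have "(\<lambda>s. f 0 s ^ a) \<in> R" by (intro fun_alg_power R)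
  ultimately have "(\<forall>s\<in>T 0. f 0 s ^ a = 0) \<or> (\<forall>s\<in>T 0. g s = 0)"
    using prime[of 0 "\<lambda>s. f 0 s ^ a" g] gR by simp
  then have g0: "g s = 0" if "s \<in> T 0" for s using chain(3)[of 0] that by auto
  \<comment> \<open>On the next set \<open>f 0\<close> vanishes, and only the terms with exponent
    exactly \<open>a\<close> survive; there is at least one of them.\<close>
  define E' where "E' = tl ` {e \<in> E. hd e = a}"
  have rel': "(\<Sum>e\<in>E'. c (a # e) * pprod ?f e s) = 0" if s: "s \<in> T (Suc 0)" for s
  proof -
    have f0: "f 0 s = 0" and sT: "s \<in> T 0" using chain(1,2)[of 0] s by auto
    have inj: "inj_on tl {e \<in> E. hd e = a}" using cons by (metis (mono_tags, lifting) inj_onI mem_Collect_eq)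
    have "(\<Sum>e\<in>E'. c (a # e) * pprod ?f e s) = (\<Sum>e\<in>{e \<in> E. hd e = a}. c e * pprod ?f (tl e) s)"
      unfolding E'_def sum.reindex[OF inj] by (rule sum.cong) (use cons in auto)
    also have "\<dots> = (\<Sum>e\<in>E. c e * (f 0 s ^ (hd e - a) * pprod ?f (tl e) s))"
    proof (rule sum.mono_neutral_cong_left)
      show "\<forall>e\<in>E - {e \<in> E. hd e = a}. c e * (f 0 s ^ (hd e - a) * pprod ?f (tl e) s) = 0"
      proof
        fix e assume "e \<in> E - {e \<in> E. hd e = a}"
        then have "hd e - a > 0" using ale[of e] by auto
        then show "c e * (f 0 s ^ (hd e - a) * pprod ?f (tl e) s) = 0" by (simp add: f0)
      qed
    qed (use E in auto)
    also have "\<dots> = 0" using g0[OF sT] by (simp add: g_def)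
    finally show ?thesis .
  qed
  show False
  proof (rule Suc.IH[of ?f "\<lambda>i. T (Suc i)" E' "\<lambda>e. c (a # e)"])
    show "finite E'" "E' \<noteq> {}" using E aE by (auto simp: E'_def)
    show "length e = n \<and> c (a # e) \<noteq> 0" if e: "e \<in> E'" for e
    proof -
      obtain e' where e': "e' \<in> E" "hd e' = a" "e = tl e'" using e by (auto simp: E'_def)
      then have "e' = a # e" using cons by metis
      then show ?thesis using E(3)[OF e'(1)] by auto
    qed
    show "(\<forall>s\<in>T (Suc i). g s = 0) \<or> (\<forall>s\<in>T (Suc i). h s = 0)"
      if "i \<le> n" "g \<in> R" "h \<in> R" "\<forall>s\<in>T (Suc i). g s * h s = 0" for i g h
      using prime[of "Suc i" g h] that by simp
  qed (use R chain rel' in auto)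
qed

section \<open>Algebraic dependence by counting monomials of bounded degree\<close>

definition degree_box :: "nat \<Rightarrow> 'i monomial set" where "degree_box \<delta> = {u. \<forall>i. lk u i \<le> \<delta>}"

lemma degree_box_card: "finite (degree_box \<delta> :: 'i::finite monomial set)" "card (degree_box \<delta> :: 'i monomial set) \<le> (\<delta> + 1) ^ CARD('i)"
proof -
  let ?F = "PiE (UNIV :: 'i set) (\<lambda>_. {..\<delta>})"
  have inj: "inj_on lk (degree_box \<delta> :: 'i monomial set)" by (rule inj_onI) (simp add: lookup_inject)
  have sub: "lk ` (degree_box \<delta> :: 'i monomial set) \<subseteq> ?F" by (auto simp: degree_box_def)
  have fin: "finite ?F" by (intro finite_PiE) auto
  show "finite (degree_box \<delta> :: 'i monomial set)" using inj_on_finite[OF inj sub fin] .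
  have "card (degree_box \<delta> :: 'i monomial set) \<le> card ?F" using card_inj_on_le[OF inj sub fin] .
  then show "card (degree_box \<delta> :: 'i monomial set) \<le> (\<delta> + 1) ^ CARD('i)" by (simp add: card_PiE)
qed

lemma degree_box_mult:
  assumes "mkeys (f :: 'i cpoly) \<subseteq> degree_box \<delta>" "mkeys g \<subseteq> degree_box \<delta>'"
  shows "mkeys (f * g) \<subseteq> degree_box (\<delta> + \<delta>')"
proof
  fix u assume "u \<in> mkeys (f * g)"
  then obtain a b where "u = a + b" "a \<in> mkeys f" "b \<in> mkeys g"
    using keys_mult[of f g] by auto
  then show "u \<in> degree_box (\<delta> + \<delta>')" using assms by (force simp: degree_box_def lookup_add intro: add_mono)
qed

lemma degree_box_power:
  assumes "mkeys (f :: 'i cpoly) \<subseteq> degree_box \<delta>"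
  shows "mkeys (f ^ n) \<subseteq> degree_box (n * \<delta>)"
proof (induction n)
  case 0
  have "mkeys (1 :: 'i cpoly) = {0}" by simp
  then show ?case by (simp add: degree_box_def)
next
  case (Suc n)
  then show ?case using degree_box_mult[OF assms Suc] by simp
qed

lemma degree_box_prod:
  assumes "\<And>i. i \<in> A \<Longrightarrow> mkeys (f i :: 'i cpoly) \<subseteq> degree_box \<delta>"
  shows "mkeys (\<Prod>i\<in>A. f i) \<subseteq> degree_box (card A * \<delta>)"
  using assms
proof (induction A rule: infinite_finite_induct)
  case (insert i A)
  then show ?case using degree_box_mult[of "f i" \<delta> "\<Prod>i\<in>A. f i" "card A * \<delta>"] by simp
qed (simp_all add: degree_box_def)

lemma degree_box_exists:
  fixes F :: "'i::finite cpoly set"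
  assumes "finite F"
  shows "\<exists>\<delta>. \<forall>f\<in>F. mkeys f \<subseteq> degree_box \<delta>"
proof -
  have fin: "finite (\<Union>f\<in>F. \<Union>u\<in>mkeys f. range (lk u))" using assms by auto
  define \<delta> where "\<delta> = Max (insert 0 (\<Union>f\<in>F. \<Union>u\<in>mkeys f. range (lk u)))"
  have "lk u i \<le> \<delta>" if "f \<in> F" "u \<in> mkeys f" for f u i
    unfolding \<delta>_def using fin that by (intro Max_ge) auto
  then show ?thesis by (intro exI[of _ \<delta>]) (auto simp: degree_box_def)
qed

text \<open>For k variables there are \<open>(M + 1)^(k + 1)\<close> products with exponents up to
  M, while their numerators have degrees of order M and so lie in a space of dimension of order
  \<open>M^k\<close>.\<close>

lemma algebraic_dependence:
  fixes g :: "nat \<Rightarrow> complex^'k::finite \<Rightarrow> complex" and D :: "'k cpoly"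
  assumes "\<And>i p. i \<le> CARD('k) \<Longrightarrow> evalp (($) p) D \<noteq> 0 \<Longrightarrow> g i p * evalp (($) p) D = evalp (($) p) (P i)"
  shows "\<exists>E c. finite E \<and> E \<noteq> {} \<and> (\<forall>e\<in>E. length e = Suc CARD('k) \<and> c e \<noteq> 0) \<and>
    (\<forall>p. evalp (($) p) D \<noteq> 0 \<longrightarrow> (\<Sum>e\<in>E. c e * pprod g e p) = 0)"
proof -
  let ?K = "CARD('k)"
  define n where "n = Suc ?K"
  obtain \<delta> where \<delta>: "\<forall>f\<in>insert D (P ` {..?K}). mkeys f \<subseteq> degree_box \<delta>"
    using degree_box_exists[of "insert D (P ` {..?K})"] by auto
  \<comment> \<open>Chosen so that \<open>(n * (M * \<delta>) + 1)^k \<le> (M + 1)^k * M\<close>,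
    which is below \<open>(M + 1)^n\<close> for \<open>n = k + 1\<close>.\<close>
  define M where "M = (\<delta> * n + 1) ^ ?K"
  define A where "A = {e. set e \<subseteq> {..M} \<and> length e = n}"
  have A: "finite A" "card A = (M + 1) ^ n"
    unfolding A_def using card_lists_length_eq[of "{..M}" n] finite_lists_length_eq[of "{..M}" n] by auto
  \<comment> \<open>The numerator of the product over the common denominator
    \<open>D^(n * M)\<close>.\<close>
  define Q where "Q e = (\<Prod>i<n. P i ^ (e ! i) * D ^ (M - e ! i))" for e
  let ?\<beta> = "n * (M * \<delta>)"
  have keysQ: "mkeys (Q e) \<subseteq> degree_box ?\<beta>" if e: "e \<in> A" for e
  proof -
    have "mkeys (P i ^ (e ! i) * D ^ (M - e ! i)) \<subseteq> degree_box (M * \<delta>)" if "i < n" for i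
    proof -
      have "e ! i \<in> {..M}" by (rule subsetD[of "set e"]) (use e that in \<open>auto simp: A_def\<close>)
      then have "e ! i * \<delta> + (M - e ! i) * \<delta> = M * \<delta>" by (simp flip: add_mult_distrib)
      moreover have "mkeys (P i ^ (e ! i) * D ^ (M - e ! i)) \<subseteq> degree_box (e ! i * \<delta> + (M - e ! i) * \<delta>)"
        using \<delta> that by (intro degree_box_mult degree_box_power) (auto simp: n_def)
      ultimately show ?thesis by simp
    qed
    then have "mkeys (Q e) \<subseteq> degree_box (card {..<n} * (M * \<delta>))"
      unfolding Q_def by (intro degree_box_prod) auto
    then show ?thesis by simp
  qed
  have "card (degree_box ?\<beta> :: 'k monomial set) < card A"
  proof -
    have "card (degree_box ?\<beta> :: 'k monomial set) \<le> (?\<beta> + 1) ^ ?K" by (rule degree_box_card)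
    also have "\<dots> \<le> ((M + 1) * (\<delta> * n + 1)) ^ ?K" by (intro power_mono) (auto simp: algebra_simps)
    also have "\<dots> = (M + 1) ^ ?K * M" by (simp only: power_mult_distrib M_def[symmetric])
    also have "\<dots> < (M + 1) ^ n" by (simp add: n_def)
    finally show ?thesis using A by simp
  qed
  from homogeneous_system_solution[OF degree_box_card(1) A(1) this, of "\<lambda>e. lk (Q e)"]
  obtain c where c: "\<exists>e\<in>A. c e \<noteq> 0" "\<forall>u\<in>degree_box ?\<beta>. (\<Sum>e\<in>A. c e * lk (Q e) u) = 0" by auto
  define E where "E = {e \<in> A. c e \<noteq> 0}"
  have "(\<Sum>e\<in>E. c e * pprod g e p) = 0" if p: "evalp (($) p) D \<noteq> 0" for p
  proof -
    have eQ: "evalp (($) p) (Q e) = pprod g e p * evalp (($) p) D ^ (n * M)" if e: "e \<in> A" for e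
    proof -
      have "evalp (($) p) (Q e) = (\<Prod>i<n. g i p ^ (e ! i) * evalp (($) p) D ^ M)"
        unfolding Q_def evalp_prod
      proof (rule prod.cong[OF refl])
        fix i assume i: "i \<in> {..<n}"
        have "e ! i \<in> {..M}" by (rule subsetD[of "set e"]) (use e i in \<open>auto simp: A_def\<close>)
        then have "evalp (($) p) D ^ M = evalp (($) p) D ^ (e ! i) * evalp (($) p) D ^ (M - e ! i)"
          by (simp flip: power_add)
        moreover have "evalp (($) p) (P i) = g i p * evalp (($) p) D"
          using assms[OF _ p, of i] i by (simp add: n_def)
        ultimately show "evalp (($) p) (P i ^ (e ! i) * D ^ (M - e ! i)) = g i p ^ (e ! i) * evalp (($) p) D ^ M"
          by (simp add: evalp_mult evalp_power power_mult_distrib)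
      qed
      also have "\<dots> = pprod g e p * evalp (($) p) D ^ (n * M)"
        using e by (simp add: prod.distrib pprod_def A_def power_mult mult.commute flip: power_mult)
      finally show ?thesis .
    qed
    have "(\<Sum>e\<in>A. c e * evalp (($) p) (Q e)) = (\<Sum>e\<in>A. c e * (\<Sum>u\<in>degree_box ?\<beta>. lk (Q e) u * monev (($) p) u))"
      by (rule sum.cong) (auto simp: evalp_linf linf_superset[OF degree_box_card(1) keysQ])
    also have "\<dots> = (\<Sum>u\<in>degree_box ?\<beta>. (\<Sum>e\<in>A. c e * lk (Q e) u) * monev (($) p) u)"
      unfolding sum_distrib_left sum_distrib_right mult.assoc by (rule sum.swap)
    also have "\<dots> = 0" using c(2) by simp
    finally have "(\<Sum>e\<in>A. c e * pprod g e p) * evalp (($) p) D ^ (n * M) = 0"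
      by (simp add: sum_distrib_right mult.assoc eQ)
    then have "(\<Sum>e\<in>A. c e * pprod g e p) = 0" using p by simp
    moreover have "(\<Sum>e\<in>E. c e * pprod g e p) = (\<Sum>e\<in>A. c e * pprod g e p)"
      using A(1) by (intro sum.mono_neutral_left) (auto simp: E_def)
    ultimately show ?thesis by simp
  qed
  moreover have "finite E" using A(1) by (simp add: E_def)
  moreover have "E \<noteq> {}" "\<forall>e\<in>E. length e = Suc ?K \<and> c e \<noteq> 0"
    using c(1) by (auto simp: E_def A_def n_def)
  ultimately show ?thesis by blast
qed

section \<open>Chains of irreducible closed sets in the component\<close>

context cyclic
begin

abbreviation main_top where "main_top \<equiv> subtopology (zariski_Hilb N) main_component"

lemma fun_alg_chart: "fun_alg (range (chart_fun B))"
  using fun_alg_polys[of "chart_coord B"] by (simp add: chart_fun_def[abs_def])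

lemma main_component_chart_gid:
  assumes sec: "section_of B" and bs: "\<And>j. j < N \<Longrightarrow> bs j \<in> B \<and> wt (bs j) = j"
    and I: "I \<in> main_component" "I \<in> Hilb_chart N B"
  shows "cluster (\<lambda>u. chart_coord B I (u, bs (wt u)))" "gid (\<lambda>u. chart_coord B I (u, bs (wt u))) = I"
  using fixed_eq_gid[OF _ I(2) sec bs] I(1) main_component_subset by auto

text \<open>The part of the component in the chart is its own family: \<open>\<phi>\<close> is given
  by the chart coordinates, so \<open>family_open\<close> produces a chart function.\<close>

lemma closed_separation:
  assumes C: "closedin main_top C" and J: "J \<in> main_component" "J \<in> Hilb_chart N B" "J \<notin> C"
  shows "\<exists>F. chart_fun B F J \<noteq> 0 \<and> (\<forall>J'\<in>C \<inter> Hilb_chart N B. chart_fun B F J' = 0)"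
proof -
  have sec: "section_of B" by (rule main_component_chart_section[OF J(1,2)])
  obtain bs where bs: "\<And>j. j < N \<Longrightarrow> bs j \<in> B \<and> wt (bs j) = j" using section_choice[OF sec] by auto
  have top: "topspace main_top = main_component" using main_component_subset by auto
  have CZ: "C \<subseteq> main_component" using closedin_subset[OF C] top by simp
  have "openin main_top (main_component - C)" using C top by (simp add: closedin_def)
  then obtain W where W: "openin (zariski_Hilb N) W" "main_component - C = W \<inter> main_component"
    by (auto simp: openin_subtopology)
  let ?S = "main_component \<inter> Hilb_chart N B"
  let ?\<phi> = "\<lambda>J u. chart_coord B J (u, bs (wt u))"
  have \<phi>R: "(\<lambda>J. ?\<phi> J u) \<in> range (chart_fun B)" for u
    by (rule range_eqI[of _ _ "varp (u, bs (wt u))"]) (simp add: chart_fun_def monev_single fun_eq_iff)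
  have "\<exists>r\<in>range (chart_fun B). r J \<noteq> 0 \<and> (\<forall>t\<in>?S. r t \<noteq> 0 \<longrightarrow> gid (?\<phi> t) \<in> W)"
  proof (rule family_open[OF W(1) fun_alg_chart])
    show "J \<in> ?S" using J by simp
    show "gid (?\<phi> J) \<in> W" using main_component_chart_gid(2)[OF sec bs J(1,2)] J W(2) by auto
    show "cluster (?\<phi> s)" if "s \<in> ?S" for s
      using main_component_chart_gid(1)[OF sec bs, of s] that by auto
  qed (rule \<phi>R)
  then obtain F where F: "chart_fun B F J \<noteq> 0" "\<forall>t\<in>?S. chart_fun B F t \<noteq> 0 \<longrightarrow> gid (?\<phi> t) \<in> W" by auto
  have "chart_fun B F J' = 0" if "J' \<in> C \<inter> Hilb_chart N B" for J'
  proof (rule ccontr)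
    assume "chart_fun B F J' \<noteq> 0"
    then have "gid (?\<phi> J') \<in> W" using F(2) that CZ by blast
    then have "J' \<in> W" using main_component_chart_gid(2)[OF sec bs, of J'] that CZ by auto
    then show False using W(2) that CZ by auto
  qed
  then show ?thesis using F(1) by blast
qed

lemma openin_main_chart: "openin main_top (main_component \<inter> {I \<in> Hilb_chart N B. chart_fun B F I \<noteq> 0})"
  by (rule openin_subtopology_Int2[OF openin_Hilb_chart])

lemma irreducible_prime:
  assumes T: "irreducible_in main_top T" and z: "\<And>s. s \<in> T \<inter> Hilb_chart N B \<Longrightarrow> chart_fun B F s * chart_fun B F' s = 0"
  shows "(\<forall>s\<in>T \<inter> Hilb_chart N B. chart_fun B F s = 0) \<or> (\<forall>s\<in>T \<inter> Hilb_chart N B. chart_fun B F' s = 0)"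
proof (rule ccontr)
  assume n: "\<not> ?thesis"
  let ?U = "\<lambda>F. main_component \<inter> {I \<in> Hilb_chart N B. chart_fun B F I \<noteq> 0}"
  have TZ: "T \<subseteq> main_component" using T main_component_subset by (auto simp: irreducible_in_def)
  have "?U F \<inter> T \<noteq> {}" "?U F' \<inter> T \<noteq> {}" using n TZ by auto
  from irreducible_in_meet[OF T openin_main_chart openin_main_chart this]
  obtain s where "s \<in> T \<inter> Hilb_chart N B" "chart_fun B F s \<noteq> 0" "chart_fun B F' s \<noteq> 0" by auto
  then show False using z by auto
qed

text \<open>\<open>T\<close> is contained in the closure of its part in the chart, so this part does
  not fit into the smaller closed set \<open>C\<close>.\<close>

lemma chain_step:
  assumes "closedin main_top C" "irreducible_in main_top T" "C \<subset> T" "I \<in> T" "I \<in> Hilb_chart N B"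
  shows "\<exists>F. (\<forall>s\<in>C \<inter> Hilb_chart N B. chart_fun B F s = 0) \<and> (\<exists>s\<in>T \<inter> Hilb_chart N B. chart_fun B F s \<noteq> 0)"
proof -
  have TZ: "T \<subseteq> main_component" using assms(2) main_component_subset by (auto simp: irreducible_in_def)
  have "\<not> T \<inter> Hilb_chart N B \<subseteq> C"
  proof
    assume sub: "T \<inter> Hilb_chart N B \<subseteq> C"
    have op: "openin main_top (main_component \<inter> Hilb_chart N B)"
      by (rule openin_subtopology_Int2[OF openin_Hilb_chart_1])
    have "T \<subseteq> main_top closure_of (T \<inter> (main_component \<inter> Hilb_chart N B))"
      using irreducible_in_subset_closure_of[OF assms(2) op] assms(4,5) TZ by auto
    also have "\<dots> \<subseteq> C" using sub assms(1) by (intro closure_of_minimal) auto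
    finally show False using assms(3) by auto
  qed
  then obtain J where J: "J \<in> T" "J \<in> Hilb_chart N B" "J \<notin> C" by auto
  then show ?thesis using closed_separation[OF assms(1) _ J(2,3)] TZ by blast
qed

text \<open>The relation is found on the parameter space of \<open>xchart\<close>, where chart
  functions are rational. It is itself a chart function, with open nonvanishing locus, so its
  vanishing extends to the closure.\<close>

lemma chart_fun_dependence:
  assumes "section_of B"
  shows "\<exists>E c. finite E \<and> E \<noteq> {} \<and> (\<forall>e\<in>E. length e = Suc CARD('n) \<and> c e \<noteq> 0) \<and>
    (\<forall>s\<in>main_component \<inter> Hilb_chart N B. (\<Sum>e\<in>E. c e * pprod (\<lambda>i. chart_fun B (F i)) e s) = 0)"
proof -
  let ?D = "\<lambda>p :: complex^'n. \<Prod>b\<in>B. xfam p b"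
  have fin: "finite B" using assms by (simp add: section_of_def)
  have "?D \<in> range (\<lambda>f p. evalp (($) p) f)"
    by (intro fun_alg_prod[OF fun_alg_polys] xfam_poly)
  then obtain D0 where D0: "\<And>p. ?D p = evalp (($) p) D0" by (auto simp: fun_eq_iff)
  have "\<exists>k P. \<forall>p. ?D p \<noteq> 0 \<longrightarrow> chart_fun B (F i) (gid (xfam p)) * ?D p ^ k = evalp (($) p) P" for i
    using chart_fun_family[OF fun_alg_polys xfam_poly assms, where F = "F i"] by fastforce
  then obtain k P where kP: "\<And>i p. ?D p \<noteq> 0 \<Longrightarrow> chart_fun B (F i) (gid (xfam p)) * ?D p ^ k i = evalp (($) p) (P i)"
    by metis
  define l where "l = (\<Sum>i\<le>CARD('n). k i)"
  define P' where "P' i = P i * D0 ^ (l - k i)" for i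
  let ?g = "\<lambda>i p. chart_fun B (F i) (gid (xfam p))"
  have "?g i p * evalp (($) p) (D0 ^ l) = evalp (($) p) (P' i)"
    if i: "i \<le> CARD('n)" and p: "evalp (($) p) (D0 ^ l) \<noteq> 0 \<and> evalp (($) p) D0 \<noteq> 0" for i p
  proof -
    have "k i \<le> l" unfolding l_def using i by (intro member_le_sum) auto
    then have "evalp (($) p) (D0 ^ l) = evalp (($) p) D0 ^ k i * evalp (($) p) D0 ^ (l - k i)"
      by (simp add: evalp_power flip: power_add)
    then show ?thesis using kP[of p i] p by (simp add: D0 P'_def evalp_mult evalp_power)
  qed
  \<comment> \<open>The additional factor \<open>D0\<close> excludes the zeros of \<open>D0\<close>
    even when \<open>l = 0\<close>.\<close>
  then have "?g i p * evalp (($) p) (D0 ^ l * D0) = evalp (($) p) (P' i * D0)"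
    if "i \<le> CARD('n)" "evalp (($) p) (D0 ^ l * D0) \<noteq> 0" for i p
    using that by (simp add: evalp_mult)
  from algebraic_dependence[of "D0 ^ l * D0" ?g "\<lambda>i. P' i * D0", OF this]
  obtain E c where E: "finite E" "E \<noteq> {}" "\<forall>e\<in>E. length e = Suc CARD('n) \<and> c e \<noteq> 0"
    and rel: "\<And>p. evalp (($) p) (D0 ^ l * D0) \<noteq> 0 \<Longrightarrow> (\<Sum>e\<in>E. c e * pprod ?g e p) = 0" by blast
  have "(\<lambda>s. \<Sum>e\<in>E. c e * pprod (\<lambda>i. chart_fun B (F i)) e s) \<in> range (chart_fun B)"
    by (intro fun_alg_sum fun_alg_mult fun_alg_const fun_alg_pprod fun_alg_chart) auto
  then obtain Q where Q: "\<And>s. (\<Sum>e\<in>E. c e * pprod (\<lambda>i. chart_fun B (F i)) e s) = chart_fun B Q s"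
    by (auto simp: fun_eq_iff)
  have "chart_fun B Q s = 0" if s: "s \<in> main_component \<inter> Hilb_chart N B" for s
  proof (rule ccontr)
    assume "chart_fun B Q s \<noteq> 0"
    then have sU: "s \<in> Hilb_fixed grp \<inter> {I \<in> Hilb_chart N B. chart_fun B Q I \<noteq> 0}"
      using s main_component_subset by auto
    have op: "openin fixed_top (Hilb_fixed grp \<inter> {I \<in> Hilb_chart N B. chart_fun B Q I \<noteq> 0})"
      by (rule openin_subtopology_Int2[OF openin_Hilb_chart])
    have "s \<in> fixed_top closure_of xchart" using s by (simp add: main_component_def)
    from closure_of_meets[OF this op sU] obtain J where J: "J \<in> xchart" "J \<in> Hilb_chart N B" "chart_fun B Q J \<noteq> 0"
      by auto
    then obtain p where p: "J = gid (xfam p)" unfolding xchart_eq by auto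
    have "?D p \<noteq> 0" using J(2) gid_chart_iff[OF cluster_xfam] fin unfolding p by auto
    then have "evalp (($) p) (D0 ^ l * D0) \<noteq> 0" by (simp add: D0 evalp_mult evalp_power)
    from rel[OF this] have "(\<Sum>e\<in>E. c e * pprod (\<lambda>i. chart_fun B (F i)) e J) = 0"
      unfolding p by (simp add: pprod_def)
    then show False using J(3) unfolding Q by simp
  qed
  then have "\<forall>s\<in>main_component \<inter> Hilb_chart N B. (\<Sum>e\<in>E. c e * pprod (\<lambda>i. chart_fun B (F i)) e s) = 0"
    unfolding Q by (rule ballI)
  then show ?thesis by (intro exI[of _ E] exI[of _ c] conjI E)
qed

text \<open>A chain longer than the number of variables would provide one separating function more
  than there are variables; these satisfy a relation by \<open>chart_fun_dependence\<close>, which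
  \<open>chain_no_relation\<close> excludes.\<close>

theorem local_dim_main_component:
  assumes "I \<in> main_component" "I \<in> Hilb_chart N B"
  shows "local_dim main_top I \<le> enat CARD('n)"
  unfolding local_dim_def
proof (rule Sup_least)
  let ?n = "Suc CARD('n)"
  fix x assume "x \<in> {enat k |k. \<exists>Z :: nat \<Rightarrow> 'n cpoly set set.
    (\<forall>i\<le>k. closedin main_top (Z i) \<and> irreducible_in main_top (Z i) \<and> I \<in> Z i) \<and> (\<forall>i<k. Z i \<subset> Z (Suc i))}"
  then obtain k and Z :: "nat \<Rightarrow> 'n cpoly set set" where x: "x = enat k"
    and Z: "\<And>i. i \<le> k \<Longrightarrow> closedin main_top (Z i) \<and> irreducible_in main_top (Z i) \<and> I \<in> Z i"
    and Zs: "\<And>i. i < k \<Longrightarrow> Z i \<subset> Z (Suc i)" by auto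
  show "x \<le> enat CARD('n)"
  proof (rule ccontr)
    assume "\<not> ?thesis"
    then have k: "?n \<le> k" using x by simp
    let ?H = "Hilb_chart N B"
    \<comment> \<open>The chain is read from its largest set downwards and restricted to the
      chart.\<close>
    define T where "T i = Z (k - i) \<inter> ?H" for i
    have "\<exists>F. (\<forall>s\<in>T (Suc i). chart_fun B F s = 0) \<and> (\<exists>s\<in>T i. chart_fun B F s \<noteq> 0)" if "i < ?n" for i
    proof -
      have "Suc (k - Suc i) = k - i" using that k by auto
      then have "Z (k - Suc i) \<subset> Z (k - i)" using Zs[of "k - Suc i"] that k by auto
      then show ?thesis unfolding T_def
        using Z[of "k - Suc i"] Z[of "k - i"] assms(2) by (intro chain_step) auto
    qed
    then obtain F where F: "\<And>i. i < ?n \<Longrightarrow> (\<forall>s\<in>T (Suc i). chart_fun B (F i) s = 0) \<and> (\<exists>s\<in>T i. chart_fun B (F i) s \<noteq> 0)"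
      by metis
    obtain E c where E: "finite E" "E \<noteq> {}" "\<forall>e\<in>E. length e = ?n \<and> c e \<noteq> 0"
      and rel: "\<forall>s\<in>main_component \<inter> ?H. (\<Sum>e\<in>E. c e * pprod (\<lambda>i. chart_fun B (F i)) e s) = 0"
      using chart_fun_dependence[OF main_component_chart_section[OF assms], of F] by blast
    show False
    proof (rule chain_no_relation[OF fun_alg_chart, of "\<lambda>i. chart_fun B (F i)" B ?n T E c])
      show "(\<forall>s\<in>T i. g s = 0) \<or> (\<forall>s\<in>T i. h s = 0)"
        if ghs: "i \<le> ?n" "g \<in> range (chart_fun B)" "h \<in> range (chart_fun B)" "\<forall>s\<in>T i. g s * h s = 0" for i g h
      proof -
        obtain F1 F2 where gh: "g = chart_fun B F1" "h = chart_fun B F2"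
          using imageE[OF ghs(2)] imageE[OF ghs(3)] by metis
        have "irreducible_in main_top (Z (k - i))" using Z[of "k - i"] by simp
        from irreducible_prime[OF this, of B F1 F2] show ?thesis using ghs(4) unfolding gh T_def by auto
      qed
      show "T (Suc i) \<subseteq> T i" if "i < ?n" for i
      proof -
        have "Suc (k - Suc i) = k - i" using that k by auto
        then show ?thesis using Zs[of "k - Suc i"] that k unfolding T_def by auto
      qed
      have "I \<in> T ?n" using Z[of "k - ?n"] assms(2) by (auto simp: T_def)
      then show "T ?n \<noteq> {}" by auto
      show "(\<Sum>e\<in>E. c e * pprod (\<lambda>i. chart_fun B (F i)) e s) = 0" if "s \<in> T 0" for s
      proof -
        have "Z k \<subseteq> main_component" using Z[of k] closedin_subset[of main_top] by auto
        then show ?thesis using rel that by (auto simp: T_def)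
      qed
    qed (use F E in auto)
  qed
qed

end

section \<open>The group 1/2m(1, 2m-1, m, m)\<close>

definition weight4 :: "nat \<Rightarrow> 4 \<Rightarrow> nat"
  where "weight4 m i = (if i = 1 then 1 else if i = 2 then 2 * m - 1 else m)"

datatype param = S1 | S2 | T1 | T2 | C0

lemma UNIV_param: "UNIV = {S1, S2, T1, T2, C0}"
  using param.exhaust by auto

instance param :: finite
  by standard (simp add: UNIV_param)

text \<open>Writing \<open>x, y, z, w\<close> for the variables, the ideals with quotient basis
  \<open>x^r, y^r (r < m), z\<close> are given by \<open>x^m = a z, y^m = b z, w = c z, z x = f y^(m-1), z y = h x^(m-1)\<close>
  subject to \<open>a h = b f\<close>. The parametrization \<open>a = s1 t1, b = s1 t2, f = s2 t1, h = s2 t2\<close> makes all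
  structure constants monomials in the parameters. \<open>pexp m t i\<close> is \<open>2m\<close> times the (rational) exponent
  of the parameter \<open>t\<close> in the \<open>i\<close>-th variable, and \<open>bexp m t r\<close> the one in the basis element of weight \<open>r\<close>.\<close>

definition pexp :: "nat \<Rightarrow> param \<Rightarrow> 4 \<Rightarrow> nat"
  where "pexp m t i =
    (if i = 1 then (case t of S1 \<Rightarrow> m | S2 \<Rightarrow> m | T1 \<Rightarrow> m + 1 | T2 \<Rightarrow> m - 1 | C0 \<Rightarrow> 0)
     else if i = 2 then (case t of S1 \<Rightarrow> m | S2 \<Rightarrow> m | T1 \<Rightarrow> m - 1 | T2 \<Rightarrow> m + 1 | C0 \<Rightarrow> 0)
     else (case t of S1 \<Rightarrow> m * (m - 2) | S2 \<Rightarrow> m * m | T1 \<Rightarrow> m * (m - 1) | T2 \<Rightarrow> m * (m - 1)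
       | C0 \<Rightarrow> if i = 3 then 0 else 2 * m))"

definition bexp :: "nat \<Rightarrow> param \<Rightarrow> nat \<Rightarrow> nat"
  where "bexp m t r = (if r < m then r * pexp m t 1 else if r = m then pexp m t 3 else (2 * m - r) * pexp m t 2)"

text \<open>Multiplying the basis monomial of weight r by a variable gives a parameter monomial
  times the basis monomial of the new weight; \<open>n t\<close> is the exponent of
  \<open>t\<close>. In the witnesses, \<open>case_param\<close> lists the exponents of s1, s2, t1,
  t2, c.\<close>

lemma bexp_step:
  assumes m: "m \<ge> 2" and r: "r < 2 * m"
  shows "\<exists>n. \<forall>t. bexp m t r + pexp m t i = bexp m t ((r + weight4 m i) mod (2 * m)) + 2 * m * n t"
proof -
  obtain q where q: "m = Suc (Suc q)" using m by (metis Suc_le_D numeral_2_eq_2 Suc_le_mono)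
  have x: "\<exists>n. \<forall>t. bexp m t r + pexp m t 1 = bexp m t ((r + 1) mod (2 * m)) + 2 * m * n t"
  proof -
    consider "r + 1 < m" | "r + 1 = m" | "r = m" | "m < r" "r + 1 < 2 * m" | "m < r" "r + 1 = 2 * m"
      using r by linarith
    then show ?thesis
    proof cases
      case 1
      then show ?thesis by (intro exI[of _ "\<lambda>_. 0"]) (simp add: bexp_def)
    next
      case 2
      then have "r = Suc q" using q by simp
      \<comment> \<open>This is \<open>x^m = a z\<close> with \<open>a = s1 t1\<close>; the next
        case is \<open>z x = f y^(m-1)\<close>, and the last two use
        \<open>x y = s1 s2 t1 t2\<close>.\<close>
      then show ?thesis
        by (intro exI[of _ "case_param 1 0 1 0 0"]) (auto simp: bexp_def pexp_def q algebra_simps split: param.split)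
    next
      case 3
      then show ?thesis
        by (intro exI[of _ "case_param 0 1 1 0 0"]) (auto simp: bexp_def pexp_def q algebra_simps split: param.split)
    next
      case 4
      then obtain s where s: "2 * m = r + Suc s" using less_imp_Suc_add[of r "2 * m"] r by auto
      then have "2 * m - r = Suc s" "2 * m - (r + 1) = s" by auto
      then show ?thesis using 4
        by (intro exI[of _ "case_param 1 1 1 1 0"]) (auto simp: bexp_def pexp_def q algebra_simps split: param.split)
    next
      case 5
      then have "2 * m - r = 1" "(r + 1) mod (2 * m) = 0" by auto
      then show ?thesis using 5
        by (intro exI[of _ "case_param 1 1 1 1 0"]) (auto simp: bexp_def pexp_def q algebra_simps split: param.split)
    qed
  qed
  have y: "\<exists>n. \<forall>t. bexp m t r + pexp m t 2 = bexp m t ((r + (2 * m - 1)) mod (2 * m)) + 2 * m * n t"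
  proof (cases "r = 0")
    case True
    moreover have "\<not> 2 * m - 1 < m" "2 * m - 1 \<noteq> m" using m by auto
    ultimately show ?thesis using m by (intro exI[of _ "\<lambda>_. 0"]) (simp add: bexp_def)
  next
    case False
    then obtain r' where r': "r = Suc r'" by (cases r) auto
    have "r + (2 * m - 1) = r' + 2 * m" using r' m by simp
    then have md: "(r + (2 * m - 1)) mod (2 * m) = r'" using r r' by simp
    consider "r < m" | "r = m" | "r = Suc m" | "Suc m < r" by linarith
    then show ?thesis unfolding md
    proof cases
      case 1
      then show "\<exists>n. \<forall>t. bexp m t r + pexp m t 2 = bexp m t r' + 2 * m * n t" using r'
        by (intro exI[of _ "case_param 1 1 1 1 0"]) (auto simp: bexp_def pexp_def q algebra_simps split: param.split)
    next
      case 2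
      then have "r' = Suc q" using r' q by simp
      with 2 show "\<exists>n. \<forall>t. bexp m t r + pexp m t 2 = bexp m t r' + 2 * m * n t"
        by (intro exI[of _ "case_param 0 1 0 1 0"]) (auto simp: bexp_def pexp_def q algebra_simps split: param.split)
    next
      case 3
      then have "2 * m - r = Suc q" "r' = m" using r' q by auto
      with 3 show "\<exists>n. \<forall>t. bexp m t r + pexp m t 2 = bexp m t r' + 2 * m * n t"
        by (intro exI[of _ "case_param 1 0 0 1 0"]) (auto simp: bexp_def pexp_def q algebra_simps split: param.split)
    next
      case 4
      then have "2 * m - r' = Suc (2 * m - r)" using r r' by auto
      with 4 r' show "\<exists>n. \<forall>t. bexp m t r + pexp m t 2 = bexp m t r' + 2 * m * n t"
        by (intro exI[of _ "\<lambda>_. 0"]) (auto simp: bexp_def)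
    qed
  qed
  have z: "\<exists>n. \<forall>t. bexp m t r + pexp m t 3 = bexp m t ((r + m) mod (2 * m)) + 2 * m * n t"
  proof -
    consider "r = 0" | "0 < r" "r < m" | "r = m" | "m < r" by linarith
    then show ?thesis
    proof cases
      case 1
      then show ?thesis using m by (intro exI[of _ "\<lambda>_. 0"]) (simp add: bexp_def)
    next
      case 2
      then obtain r' where r': "r = Suc r'" by (cases r) auto
      obtain k where k: "m = r + Suc k" using less_imp_Suc_add[OF 2(2)] by auto
      have "(r + m) mod (2 * m) = r + m" "2 * m - (r + m) = Suc k" using 2 k by auto
      \<comment> \<open>Here \<open>x^r z = s1^(r-1) s2^r t1^r t2^(r-1) y^(m-r)\<close>.\<close>
      then show ?thesis using 2
        by (intro exI[of _ "case_param r' r r r' 0"])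
          (auto simp: bexp_def pexp_def k r' algebra_simps split: param.split)
    next
      case 3
      have "r + m = 2 * m" using 3 by simp
      then have "(r + m) mod (2 * m) = 0" by (simp only: mod_self)
      \<comment> \<open>The product z^2; the exponent \<open>m - 2\<close> of s1 is not a truncated
        subtraction because \<open>m \<ge> 2\<close>.\<close>
      then show ?thesis using 3 m
        by (intro exI[of _ "case_param (m - 2) m (m - 1) (m - 1) 0"])
          (auto simp: bexp_def pexp_def q algebra_simps split: param.split)
    next
      case 4
      then obtain r' where r': "r = m + Suc r'" using less_imp_Suc_add[OF 4] by auto
      obtain s where s: "2 * m = r + Suc s" using less_imp_Suc_add[OF r] by auto
      have ms: "m = Suc r' + Suc s" using r' s by simp
      have *: "r + m = Suc r' + 2 * m" using r' by simp
      have "(r + m) mod (2 * m) = Suc r'"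
        unfolding * mod_add_self2 using ms by (intro mod_less) auto
      moreover have "2 * m - r = Suc s" using s by simp
      ultimately show ?thesis using 4
        by (intro exI[of _ "case_param s (Suc s) s (Suc s) 0"])
          (auto simp: bexp_def pexp_def ms algebra_simps split: param.split)
    qed
  qed
  have w: "\<exists>n. \<forall>t. bexp m t r + pexp m t 4 = bexp m t ((r + m) mod (2 * m)) + 2 * m * n t"
  proof -
    obtain n where n: "\<And>t. bexp m t r + pexp m t 3 = bexp m t ((r + m) mod (2 * m)) + 2 * m * n t" using z by auto
    \<comment> \<open>The variable w behaves as c z, so only the exponent of c changes.\<close>
    have p4: "pexp m t 4 = pexp m t 3 + 2 * m * (if t = C0 then 1 else 0)" for t
      by (auto simp: pexp_def split: param.split)
    have "bexp m t r + pexp m t 4 =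
        bexp m t ((r + m) mod (2 * m)) + 2 * m * (n t + (if t = C0 then 1 else 0))" for t
      unfolding p4 add_mult_distrib2 using n[of t] by linarith
    then show ?thesis by (intro exI[of _ "\<lambda>t. n t + (if t = C0 then 1 else 0)"] allI)
  qed
  have wt: "weight4 m 1 = 1" "weight4 m 2 = 2 * m - 1" "weight4 m 3 = m" "weight4 m 4 = m"
    by (simp_all add: weight4_def)
  show ?thesis using exhaust_4[of i] by (elim disjE) (simp_all only: wt x y z w)
qed

section \<open>The five-parameter family of ideals\<close>

locale quotient_2m =
  fixes m :: nat and \<epsilon> :: complex
  assumes m2: "m \<ge> 2" and eps: "primitive_root_of_unity (2 * m) \<epsilon>"

sublocale quotient_2m \<subseteq> cyclic "2 * m" "weight4 m" \<epsilon> 1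
  using m2 eps by unfold_locales (auto simp: weight4_def)

context quotient_2m
begin

abbreviation e where "e i k \<equiv> mterm (i :: 4) (k :: nat)"

definition plin :: "param \<Rightarrow> 4 monomial \<Rightarrow> nat" where "plin t u = (\<Sum>i\<in>UNIV. lk u i * pexp m t i)"

lemma plin_add: "plin t (u + v) = plin t u + plin t v"
  by (simp add: plin_def lookup_add algebra_simps sum.distrib)

lemma plin_single: "plin t (e i k) = k * pexp m t i"
  by (simp add: plin_def lookup_single when_def if_distrib[of "\<lambda>x. x * _"] cong: if_cong)

text \<open>The exponent of the parameter \<open>t\<close> in the coefficient of \<open>u\<close>
  with respect to the basis monomial of its weight. By \<open>nexp_eq\<close> the subtraction and
  the division are exact.\<close>

definition nexp :: "param \<Rightarrow> 4 monomial \<Rightarrow> nat"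
  where "nexp t u = (plin t u - bexp m t (wt u)) div (2 * m)"

lemma wt_single: "wt (e i k) = (k * weight4 m i) mod (2 * m)"
  by (simp add: wt_def)

lemma nexp_eq: "plin t u = bexp m t (wt u) + 2 * m * nexp t u"
proof -
  have "\<exists>n. \<forall>t. plin t u = bexp m t (wt u) + 2 * m * n t"
  proof (induction u rule: monomial_induct)
    case zero
    show ?case using m2 by (intro exI[of _ "\<lambda>_. 0"]) (simp add: plin_def bexp_def)
  next
    case (add u i)
    then obtain n where n: "\<And>t. plin t u = bexp m t (wt u) + 2 * m * n t" by auto
    obtain n' where n': "\<And>t. bexp m t (wt u) + pexp m t i =
        bexp m t ((wt u + weight4 m i) mod (2 * m)) + 2 * m * n' t"
      using bexp_step[OF m2 wt_less[of u], of i] by auto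
    have "wt (u + e i 1) = (wt u + weight4 m i) mod (2 * m)"
      by (simp add: wt_add wt_single mod_add_right_eq)
    then have "plin t (u + e i 1) = bexp m t (wt (u + e i 1)) + 2 * m * (n t + n' t)" for t
      using n[of t] n'[of t] by (simp add: plin_add plin_single add_mult_distrib2)
    then show ?case by (intro exI[of _ "\<lambda>t. n t + n' t"]) simp
  qed
  then obtain n where n: "\<And>t. plin t u = bexp m t (wt u) + 2 * m * n t" by auto
  then show ?thesis using m2 by (simp add: nexp_def)
qed

lemma nexp_eqI: "plin t u = bexp m t (wt u) + 2 * m * n \<Longrightarrow> nexp t u = n"
  using m2 by (simp add: nexp_def)

definition fam :: "complex^param \<Rightarrow> 4 monomial \<Rightarrow> complex"
  where "fam p u = (\<Prod>t\<in>UNIV. p $ t ^ nexp t u)"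

definition bas :: "nat \<Rightarrow> 4 monomial"
  where "bas r = (if r < m then e 1 r else if r = m then e 3 1 else e 2 (2 * m - r))"

lemma wt_bas: "r < 2 * m \<Longrightarrow> wt (bas r) = r"
proof -
  assume r: "r < 2 * m"
  consider "r < m" | "r = m" | "r > m" by linarith
  then show ?thesis
  proof cases
    case 3
    define s where "s = 2 * m - r"
    have s: "r = 2 * m - s" "0 < s" "s < 2 * m" using r 3 by (auto simp: s_def)
    have "s * (2 * m - 1) = (s - 1) * (2 * m) + (2 * m - s)"
    proof -
      obtain k where k: "s = Suc k" using s by (cases s) auto
      obtain l where l: "2 * m = s + Suc l" using less_imp_Suc_add[OF s(3)] by auto
      show ?thesis unfolding l k by (simp add: algebra_simps)
    qed
    then have "(s * (2 * m - 1)) mod (2 * m) = (2 * m - s) mod (2 * m)" by simp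
    also have "\<dots> = r" using s by simp
    finally show ?thesis using 3 by (simp add: bas_def wt_single weight4_def s_def)
  qed (auto simp: bas_def wt_single weight4_def)
qed

lemma nexp_bas: "r < 2 * m \<Longrightarrow> nexp t (bas r) = 0"
  by (rule nexp_eqI) (simp add: wt_bas, simp add: bas_def bexp_def plin_single)

lemma fam_bas: "r < 2 * m \<Longrightarrow> fam p (bas r) = 1"
  by (simp add: fam_def nexp_bas)

definition basis :: "4 monomial set" where "basis = bas ` {..<2 * m}"

lemma section_basis: "section_of basis"
proof -
  have "inj_on bas {..<2 * m}" using wt_bas by (metis inj_onI lessThan_iff)
  then show ?thesis unfolding section_of_def basis_def using wt_bas by (auto simp: card_image inj_on_def)
qed

text \<open>\<open>plin\<close> is additive and \<open>bexp\<close> depends only on the weight, so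
  the contributions of the basis monomials cancel.\<close>

lemma nexp_cocycle:
  assumes "wt u = wt v"
  shows "nexp t u + nexp t (v + s) = nexp t v + nexp t (u + s)"
proof -
  have "plin t u + plin t (v + s) = plin t v + plin t (u + s)" by (simp add: plin_add)
  then have "2 * m * (nexp t u + nexp t (v + s)) = 2 * m * (nexp t v + nexp t (u + s))"
    unfolding nexp_eq[of t] using assms wt_add_cong[OF assms, of s] by (simp add: algebra_simps)
  then show ?thesis using m2 by simp
qed

lemma cluster_fam: "cluster (fam p)"
  unfolding cluster_def
proof (intro conjI allI impI)
  fix u v s assume uv: "wt u = wt v"
  show "fam p u * fam p (v + s) = fam p v * fam p (u + s)"
    unfolding fam_def prod.distrib[symmetric] power_add[symmetric] nexp_cocycle[OF uv] ..
next
  fix j assume "j < 2 * m"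
  then show "\<exists>u. wt u = j \<and> fam p u \<noteq> 0"
    by (intro exI[of _ "bas j"]) (simp add: wt_bas fam_bas)
qed

lemma fam_poly: "(\<lambda>p. fam p u) \<in> range (\<lambda>f p. evalp (($) p) f)"
  unfolding fam_def
  by (intro fun_alg_power[OF fun_alg_polys] fun_alg_prod[OF fun_alg_polys] coordinate_poly)

text \<open>If all parameters are nonzero, no value of \<open>fam\<close> vanishes and the ideal
  lies in \<open>xchart\<close>. Such parameters are dense, so continuity brings every member of the
  family into the closure.\<close>

lemma fam_main_component: "gid (fam p) \<in> main_component"
  unfolding main_component_def in_closure_of
proof (intro conjI allI impI)
  have cont: "continuous_map zariski_affine fixed_top (\<lambda>p. gid (fam p))"
    by (rule continuous_gid_fixed[OF cluster_fam fam_poly])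
  then show "gid (fam p) \<in> topspace fixed_top" by (auto simp: continuous_map_def)
  fix W assume W: "gid (fam p) \<in> W \<and> openin fixed_top W"
  have "openin zariski_affine {q \<in> topspace zariski_affine. gid (fam q) \<in> W}"
    using W by (intro openin_continuous_map_preimage[OF cont]) simp
  from openin_zariski_affine_nonvanishing[OF this, of p] obtain f where
    f: "evalp (($) p) f \<noteq> 0" "\<forall>q. evalp (($) q) f \<noteq> 0 \<longrightarrow> gid (fam q) \<in> W" using W by auto
  define one :: "complex^param" where "one = (\<chi> t. 1)"
  have "evalp (($) one) (\<Prod>t\<in>UNIV. varp t) \<noteq> 0" by (simp add: one_def evalp_prod monev_single)
  from evalp_common_nonvanishing[OF f(1) this] obtain r :: "complex^param" where
    r: "evalp (($) r) f \<noteq> 0" "evalp (($) r) (\<Prod>t\<in>UNIV. varp t) \<noteq> 0" by auto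
  have "r $ t \<noteq> 0" for t using r(2) by (simp add: evalp_prod monev_single)
  then have "fam r u \<noteq> 0" for u by (simp add: fam_def)
  then have "gid (fam r) \<in> xchart" by (intro xchart_gidI cluster_fam)
  then show "\<exists>y. y \<in> xchart \<and> y \<in> W" using f(2) r(1) by auto
qed

lemma fam_chart: "gid (fam p) \<in> Hilb_chart (2 * m) basis"
  unfolding gid_chart_iff[OF cluster_fam] using section_basis fam_bas by (auto simp: basis_def)

lemma chart_coord_fam:
  "chart_coord basis (gid (fam p)) = (\<lambda>(u, b). if b \<in> basis \<and> wt u = wt b then fam p u else 0)"
proof (rule ext)
  fix ub show "chart_coord basis (gid (fam p)) ub = (\<lambda>(u, b). if b \<in> basis \<and> wt u = wt b then fam p u else 0) ub"
    using chart_coord_gid[OF section_basis, of "fam p" "fst ub" "snd ub"] fam_bas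
    by (auto simp: basis_def split: prod.splits)
qed

subsection \<open>The singular point\<close>

text \<open>Five lines through the point with all parameters 0, along the axes \<open>a, b, f, h, c\<close>.\<close>

definition line :: "nat \<Rightarrow> complex \<Rightarrow> complex^param"
  where "line k z = (\<chi> t. case t of S1 \<Rightarrow> if k \<in> {0, 1} then 1 else 0 | S2 \<Rightarrow> if k \<in> {2, 3} then 1 else 0
    | T1 \<Rightarrow> if k \<in> {0, 2} then z else 0 | T2 \<Rightarrow> if k \<in> {1, 3} then z else 0 | C0 \<Rightarrow> if k = 4 then z else 0)"

text \<open>The coordinates a, b, f, h, c in this order, with pullbacks s1 t1, s1 t2, s2 t1, s2 t2
  and c; \<open>bas (m + 1)\<close> is \<open>y^(m-1)\<close> and \<open>bas (m - 1)\<close> is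
  \<open>x^(m-1)\<close>.\<close>

definition coord :: "nat \<Rightarrow> 4 monomial \<times> 4 monomial"
  where "coord k = (if k = 0 then (e 1 m, bas m) else if k = 1 then (e 2 m, bas m)
    else if k = 2 then (e 3 1 + e 1 1, bas (m + 1)) else if k = 3 then (e 3 1 + e 2 1, bas (m - 1))
    else (e 4 1, bas m))"

lemma fam_expand: "fam p u = p $ S1 ^ nexp S1 u * p $ S2 ^ nexp S2 u * p $ T1 ^ nexp T1 u * p $ T2 ^ nexp T2 u * p $ C0 ^ nexp C0 u"
  by (simp add: fam_def UNIV_param mult_ac)

text \<open>Scaling s1, s2 by a number and t1, t2 by its inverse fixes a, b, f, h, so every
  coefficient has the same degree in the s as in the t.\<close>

lemma nexp_balanced: "nexp S1 u + nexp S2 u = nexp T1 u + nexp T2 u"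
proof -
  obtain q where q: "m = Suc (Suc q)" using m2 by (metis Suc_le_D numeral_2_eq_2 Suc_le_mono)
  have pb: "pexp m S1 i + pexp m S2 i = pexp m T1 i + pexp m T2 i" for i
    unfolding pexp_def q by (simp add: algebra_simps)
  then have "plin S1 u + plin S2 u = plin T1 u + plin T2 u"
    unfolding plin_def sum.distrib[symmetric] distrib_left[symmetric] by simp
  moreover have "bexp m S1 (wt u) + bexp m S2 (wt u) = bexp m T1 (wt u) + bexp m T2 (wt u)"
    using pb unfolding bexp_def by (simp flip: distrib_left)
  ultimately have "2 * m * (nexp S1 u + nexp S2 u) = 2 * m * (nexp T1 u + nexp T2 u)"
    unfolding distrib_left
    using nexp_eq[of S1 u] nexp_eq[of S2 u] nexp_eq[of T1 u] nexp_eq[of T2 u] by linarith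
  then show ?thesis using m2 by simp
qed

text \<open>Except along c, the line starts at a parameter with s1 or s2 equal to 1 and t1 = t2 = 0,
  not at the origin. By the balance of degrees it still yields the same ideal as the parameter
  0.\<close>

lemma fam_line_0: "fam (line k 0) u = fam 0 u"
  using nexp_balanced[of u]
  by (auto simp: fam_expand line_def power_0_left)

lemma coord_data:
  assumes "k < 5"
  shows "snd (coord k) \<in> basis" "wt (fst (coord k)) = wt (snd (coord k))"
    "\<And>t. nexp t (fst (coord k)) = (case t of S1 \<Rightarrow> if k \<in> {0, 1} then 1 else 0
      | S2 \<Rightarrow> if k \<in> {2, 3} then 1 else 0 | T1 \<Rightarrow> if k \<in> {0, 2} then 1 else 0
      | T2 \<Rightarrow> if k \<in> {1, 3} then 1 else 0 | C0 \<Rightarrow> if k = 4 then 1 else 0)"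
proof -
  obtain q where q: "m = Suc (Suc q)" using m2 by (metis Suc_le_D numeral_2_eq_2 Suc_le_mono)
  have k: "k = 0 \<or> k = 1 \<or> k = 2 \<or> k = 3 \<or> k = 4" using assms by auto
  show "snd (coord k) \<in> basis" using k m2 by (auto simp: coord_def basis_def)
  have b: "wt (bas m) = m" "wt (bas (m + 1)) = m + 1" "wt (bas (m - 1)) = m - 1"
    using m2 by (auto intro!: wt_bas)
  have "m * (2 * m - 1) = m + (m - 1) * (2 * m)" unfolding q by (simp add: algebra_simps)
  then have y: "(m * (2 * m - 1)) mod (2 * m) = m" using m2 by simp
  have *: "3 * m - Suc 0 = (m - Suc 0) + 2 * m" using m2 by simp
  have zy: "(3 * m - Suc 0) mod (2 * m) = m - Suc 0"
    unfolding * mod_add_self2 using m2 by (intro mod_less) auto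
  have w: "wt (e 1 m) = m" "wt (e 2 m) = m" "wt (e 3 1 + e 1 1) = m + 1" "wt (e 3 1 + e 2 1) = m - 1"
    "wt (e 4 1) = m"
    using m2 y zy by (simp_all add: wt_def wdeg_add weight4_def)
  show "wt (fst (coord k)) = wt (snd (coord k))" using k by (auto simp only: coord_def b w fst_conv snd_conv split: if_splits)
  have x: "m * pexp m t 1 = pexp m t 3 + 2 * m * (case t of S1 \<Rightarrow> 1 | S2 \<Rightarrow> 0 | T1 \<Rightarrow> 1 | T2 \<Rightarrow> 0 | C0 \<Rightarrow> 0)"
    "m * pexp m t 2 = pexp m t 3 + 2 * m * (case t of S1 \<Rightarrow> 1 | S2 \<Rightarrow> 0 | T1 \<Rightarrow> 0 | T2 \<Rightarrow> 1 | C0 \<Rightarrow> 0)"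
    "pexp m t 3 + pexp m t 1 = (m - 1) * pexp m t 2 +
      2 * m * (case t of S1 \<Rightarrow> 0 | S2 \<Rightarrow> 1 | T1 \<Rightarrow> 1 | T2 \<Rightarrow> 0 | C0 \<Rightarrow> 0)"
    "pexp m t 3 + pexp m t 2 = (m - 1) * pexp m t 1 +
      2 * m * (case t of S1 \<Rightarrow> 0 | S2 \<Rightarrow> 1 | T1 \<Rightarrow> 0 | T2 \<Rightarrow> 1 | C0 \<Rightarrow> 0)"
    "pexp m t 4 = pexp m t 3 + 2 * m * (case t of S1 \<Rightarrow> 0 | S2 \<Rightarrow> 0 | T1 \<Rightarrow> 0 | T2 \<Rightarrow> 0 | C0 \<Rightarrow> 1)" for t
    unfolding pexp_def q by (cases t; simp add: algebra_simps)+
  have bx: "bexp m t m = pexp m t 3" "bexp m t (m + 1) = (m - 1) * pexp m t 2"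
    "bexp m t (m - 1) = (m - 1) * pexp m t 1" for t
    using m2 by (auto simp: bexp_def)
  have n: "nexp t (e 1 m) = (case t of S1 \<Rightarrow> 1 | S2 \<Rightarrow> 0 | T1 \<Rightarrow> 1 | T2 \<Rightarrow> 0 | C0 \<Rightarrow> 0)"
    "nexp t (e 2 m) = (case t of S1 \<Rightarrow> 1 | S2 \<Rightarrow> 0 | T1 \<Rightarrow> 0 | T2 \<Rightarrow> 1 | C0 \<Rightarrow> 0)"
    "nexp t (e 3 1 + e 1 1) = (case t of S1 \<Rightarrow> 0 | S2 \<Rightarrow> 1 | T1 \<Rightarrow> 1 | T2 \<Rightarrow> 0 | C0 \<Rightarrow> 0)"
    "nexp t (e 3 1 + e 2 1) = (case t of S1 \<Rightarrow> 0 | S2 \<Rightarrow> 1 | T1 \<Rightarrow> 0 | T2 \<Rightarrow> 1 | C0 \<Rightarrow> 0)"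
    "nexp t (e 4 1) = (case t of S1 \<Rightarrow> 0 | S2 \<Rightarrow> 0 | T1 \<Rightarrow> 0 | T2 \<Rightarrow> 0 | C0 \<Rightarrow> 1)" for t
    by (rule nexp_eqI, simp only: w bx plin_add plin_single mult_1 x)+
  show "nexp t (fst (coord k)) = (case t of S1 \<Rightarrow> if k \<in> {0, 1} then 1 else 0
      | S2 \<Rightarrow> if k \<in> {2, 3} then 1 else 0 | T1 \<Rightarrow> if k \<in> {0, 2} then 1 else 0
      | T2 \<Rightarrow> if k \<in> {1, 3} then 1 else 0 | C0 \<Rightarrow> if k = 4 then 1 else 0)" for t
    using k by (elim disjE; cases t; simp add: coord_def n[simplified])
qed

lemma coord_line:
  assumes "k < 5" "l < 5"
  shows "chart_coord basis (gid (fam (line l z))) (coord k) = (if k = l then z else 0)"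
proof -
  have k: "k = 0 \<or> k = 1 \<or> k = 2 \<or> k = 3 \<or> k = 4" and l: "l = 0 \<or> l = 1 \<or> l = 2 \<or> l = 3 \<or> l = 4"
    using assms by auto
  have "chart_coord basis (gid (fam (line l z))) (coord k) = fam (line l z) (fst (coord k))"
    unfolding chart_coord_fam using coord_data(1,2)[OF assms(1)] by (simp add: case_prod_unfold)
  also have "\<dots> = (if k = l then z else 0)"
    using k l unfolding fam_expand coord_data(3)[OF assms(1)] by (elim disjE) (simp_all add: line_def)
  finally show ?thesis .
qed

text \<open>Functions with a derivative at 0 form a function algebra, and it contains the parameters
  along \<open>line l\<close>.\<close>

lemma differentiable_line: "\<exists>D. ((\<lambda>z. chart_fun basis F (gid (fam (line l z)))) has_field_derivative D) (at 0)"
proof -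
  let ?R = "{g :: complex \<Rightarrow> complex. \<exists>D. (g has_field_derivative D) (at 0)}"
  have R: "fun_alg ?R"
    unfolding fun_alg_def by (auto intro: DERIV_const DERIV_add DERIV_mult)
  have "(\<lambda>z. if P then z else 0) \<in> ?R" for P
    by (cases P) (auto intro: DERIV_const DERIV_ident)
  then have line: "(\<lambda>z. line l z $ t) \<in> ?R" for t
    by (cases t) (simp_all only: line_def vec_lambda_beta param.case fun_alg_const[OF R])
  have "(\<lambda>z. chart_coord basis (gid (fam (line l z))) (u, b)) \<in> ?R" for u b
  proof (cases "b \<in> basis \<and> wt u = wt b")
    case True
    have "(\<lambda>z. \<Prod>t\<in>UNIV. line l z $ t ^ nexp t u) \<in> ?R"
      by (intro fun_alg_prod[OF R] fun_alg_power[OF R] line)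
    then show ?thesis unfolding chart_coord_fam fam_def using True by (simp only: case_prod_conv simp_thms if_True)
  next
    case False
    then show ?thesis unfolding chart_coord_fam using fun_alg_const[OF R, of 0] by auto
  qed
  then have "(\<lambda>z. chart_coord basis (gid (fam (line l z))) ub) \<in> ?R" for ub by (cases ub) auto
  then have "(\<lambda>z. evalp (chart_coord basis (gid (fam (line l z)))) F) \<in> ?R" by (rule fun_alg_evalp[OF R])
  then show ?thesis unfolding chart_fun_def by (rule CollectD)
qed

lemma gid_line_0: "gid (fam (line l 0)) = gid (fam 0)"
proof -
  have "fam (line l 0) = fam 0" using fam_line_0 by auto
  then show ?thesis by simp
qed

lemma cotangent_dim_ge:
  assumes "has_cotangent_dim (2 * m) main_component basis (gid (fam 0)) d"
  shows "5 \<le> d"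
proof (rule ccontr)
  assume d5: "\<not> 5 \<le> d"
  define M where "M = {F. chart_fun basis F (gid (fam 0)) = 0}"
  define J where "J = {F. \<forall>I' \<in> main_component \<inter> Hilb_chart (2 * m) basis. chart_fun basis F I' = 0}"
  define W where "W = ideal_generated ({F * F' | F F'. F \<in> M \<and> F' \<in> M} \<union> J)"
  obtain Q where Q: "quotient_basis M W Q" "card Q = d"
    using assms unfolding has_cotangent_dim_def Let_def has_quotient_dim_def M_def J_def W_def by blast
  have idW: "ideal_of_polys W" unfolding W_def by (rule module.subspace_span[OF module_mult])
  let ?h = "\<lambda>l F z. chart_fun basis F (gid (fam (line l z)))"
  \<comment> \<open>Functions vanishing to second order along line l. This is an ideal; it contains
    products of two elements of \<open>M\<close> by the Leibniz rule, and \<open>J\<close> because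
    the line stays in the component.\<close>
  define K where "K l = {F. ?h l F 0 = 0 \<and> (?h l F has_field_derivative 0) (at 0)}" for l
  have W_sub: "W \<subseteq> K l" for l
    unfolding W_def
  proof (rule module.span_minimal[OF module_mult])
    show "{F * F' |F F'. F \<in> M \<and> F' \<in> M} \<union> J \<subseteq> K l"
    proof
      fix G assume "G \<in> {F * F' |F F'. F \<in> M \<and> F' \<in> M} \<union> J"
      then consider F F' where "G = F * F'" "F \<in> M" "F' \<in> M" | "G \<in> J" by blast
      then show "G \<in> K l"
      proof cases
        case 1
        obtain D D' where D: "(?h l F has_field_derivative D) (at 0)" "(?h l F' has_field_derivative D') (at 0)"
          using differentiable_line by blast
        have "?h l F 0 = 0" "?h l F' 0 = 0" using 1 by (simp_all add: M_def gid_line_0)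
        then show ?thesis using DERIV_mult[OF D] by (simp add: K_def 1 chart_fun_def evalp_mult)
      next
        case 2
        then have "?h l G z = 0" for z using fam_main_component fam_chart by (auto simp: J_def)
        then show ?thesis by (simp add: K_def)
      qed
    qed
    show "ideal_of_polys (K l)"
    proof (rule module.subspaceI[OF module_mult])
      show "0 \<in> K l" by (simp add: K_def chart_fun_def)
      fix F G assume FG: "F \<in> K l" "G \<in> K l"
      then show "F + G \<in> K l"
        using DERIV_add[of "?h l F" 0 0 UNIV "?h l G" 0] by (simp add: K_def chart_fun_def evalp_add)
    next
      fix c F assume F: "F \<in> K l"
      obtain D where D: "(?h l c has_field_derivative D) (at 0)" using differentiable_line by blast
      show "c * F \<in> K l"
        using DERIV_mult[OF D, of "?h l F" 0] F by (simp add: K_def chart_fun_def evalp_mult)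
    qed
  qed
  have var: "?h l (varp (coord k)) z = (if k = l then z else 0)" if "k < 5" "l < 5" for k l z
    using coord_line[OF that] by (simp add: chart_fun_def monev_single)
  have vM: "varp (coord k) \<in> M" if "k \<in> {..<5}" for k
    using var[of k k 0] that by (simp add: M_def gid_line_0)
  have "card Q < card {..<5::nat}" using d5 Q by simp
  have "\<exists>c. (\<exists>k\<in>{..<5}. c k \<noteq> 0) \<and> (\<Sum>k\<in>{..<5}. constp (c k) * varp (coord k)) \<in> W"
    by (rule quotient_basis_dependent[OF Q(1) idW finite_lessThan vM \<open>card Q < _\<close>])
  then obtain c where c: "\<exists>k\<in>{..<5}. c k \<noteq> 0" "(\<Sum>k\<in>{..<5}. constp (c k) * varp (coord k)) \<in> W"
    by (elim exE conjE)
  \<comment> \<open>Along line l the combination restricts to \<open>c l * z\<close>, whose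
    derivative at 0 must vanish.\<close>
  have "c l = 0" if l: "l < 5" for l
  proof -
    have "?h l (\<Sum>k\<in>{..<5}. constp (c k) * varp (coord k)) z = c l * z" for z
    proof -
      have "?h l (\<Sum>k\<in>{..<5}. constp (c k) * varp (coord k)) z = (\<Sum>k\<in>{..<5}. c k * ?h l (varp (coord k)) z)"
        by (simp add: chart_fun_def evalp_sum evalp_mult)
      also have "\<dots> = (\<Sum>k\<in>{..<5}. if k = l then c l * z else 0)"
        by (rule sum.cong) (use var l in auto)
      finally show ?thesis using l by simp
    qed
    moreover have "(\<Sum>k\<in>{..<5}. constp (c k) * varp (coord k)) \<in> K l" using c(2) W_sub by blast
    ultimately have "((\<lambda>z. c l * z) has_field_derivative 0) (at 0)" by (simp add: K_def)
    from DERIV_unique[OF DERIV_cmult_Id this] show ?thesis .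
  qed
  then show False using c(1) by auto
qed

theorem not_smooth: "\<not> smooth_subvariety (2 * m) main_component"
proof
  assume "smooth_subvariety (2 * m) main_component"
  then obtain d where d: "has_cotangent_dim (2 * m) main_component basis (gid (fam 0)) d"
    "local_dim main_top (gid (fam 0)) = enat d"
    unfolding smooth_subvariety_def using fam_main_component fam_chart by blast
  have "enat d \<le> enat CARD(4)"
    using local_dim_main_component[OF fam_main_component fam_chart] d(2) by metis
  then show False using cotangent_dim_ge[OF d(1)] by simp
qed

section \<open>The generated group and the conclusion\<close>

lemma det_diag: "det (diag k) = 1"
proof -
  have "det (diag k) = (\<Prod>i\<in>UNIV. \<epsilon> ^ (k * weight4 m i))"
    by (subst det_diagonal) (auto simp: diag_def)
  also have "\<dots> = \<epsilon> ^ (k * (\<Sum>i\<in>UNIV. weight4 m i))"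
    by (simp add: power_sum sum_distrib_left)
  also have "(\<Sum>i\<in>UNIV. weight4 m i) = 2 * m * 2"
    using m2 by (simp add: sum_4 weight4_def)
  finally show ?thesis by (simp add: eps_eq_1_iff)
qed

lemma generate_grp: "generate SL {diag 1} = grp"
proof
  have sub: "diag k \<in> generate SL {diag 1}" for k
  proof (induction k)
    case 0
    then show ?case using generate.one[of SL "{diag 1}"] by (simp add: SL_def diag_0)
  next
    case (Suc k)
    then show ?case
      using generate.eng[OF generate.incl[of "diag 1" "{diag 1}" SL] Suc] by (simp add: SL_def diag_mult)
  qed
  then show "grp \<subseteq> generate SL {diag 1}" by (auto simp: grp_def)
  show "generate SL {diag 1} \<subseteq> grp"
  proof
    fix g assume "g \<in> generate SL {diag 1}"
    then have "\<exists>k. g = diag k"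
    proof induction
      case one
      then show ?case by (auto simp: SL_def diag_0[symmetric])
    next
      case (incl h)
      then show ?case by auto
    next
      case (inv h)
      \<comment> \<open>The inverse in \<open>SL\<close> is a definite description over the carrier,
        so the candidate needs determinant 1; uniqueness follows from associativity.\<close>
      let ?l = "(2 * m - 1) * 1"
      have "inv\<^bsub>SL\<^esub> diag 1 = diag ?l"
        unfolding m_inv_def
      proof (rule the_equality)
        show "diag ?l \<in> carrier SL \<and> diag 1 \<otimes>\<^bsub>SL\<^esub> diag ?l = \<one>\<^bsub>SL\<^esub> \<and> diag ?l \<otimes>\<^bsub>SL\<^esub> diag 1 = \<one>\<^bsub>SL\<^esub>"
          using diag_inverse[of 1] det_diag by (simp add: SL_def)
        fix y assume y: "y \<in> carrier SL \<and> diag 1 \<otimes>\<^bsub>SL\<^esub> y = \<one>\<^bsub>SL\<^esub> \<and> y \<otimes>\<^bsub>SL\<^esub> diag 1 = \<one>\<^bsub>SL\<^esub>"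
        then have "y ** diag 1 = mat 1" by (simp add: SL_def)
        then have "(y ** diag 1) ** diag ?l = diag ?l" by simp
        then show "y = diag ?l" using diag_inverse(1)[of 1] by (simp add: matrix_mul_assoc[symmetric])
      qed
      then show ?case using inv by auto
    next
      case (eng h1 h2)
      then show ?case by (auto simp: SL_def diag_mult)
    qed
    then show "g \<in> grp" using diag_in_grp by auto
  qed
qed

end

lemma vector4_nth [simp]:
  "(vector [a, b, c, d] :: ('a::zero)^4) $ 1 = a" "(vector [a, b, c, d] :: 'a^4) $ 2 = b"
  "(vector [a, b, c, d] :: 'a^4) $ 3 = c" "(vector [a, b, c, d] :: 'a^4) $ 4 = d"
  unfolding vector_def by simp_all

theorem proposition3p3:
  fixes m :: nat and \<epsilon> :: complex and G :: "(complex^4^4) set"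
  assumes "m > 0"
    and "m \<noteq> 1"
    and "primitive_root_of_unity (2 * m) \<epsilon>"
    and "G = generate SL {diag_root \<epsilon> (vector [1, 2 * int m - 1, int m, int m])}"
  shows "\<not> smooth_subvariety (card G) (G_Hilb G)"
proof -
  interpret quotient_2m m \<epsilon> using assms(1-3) by unfold_locales auto
  \<comment> \<open>Since m > 0, the natural subtraction in \<open>weight4\<close> agrees with the
    integer entry 2m - 1, and integer powers become natural ones.\<close>
  have "(vector [1, 2 * int m - 1, int m, int m] :: int^4) $ i = int (weight4 m i)" for i
    using exhaust_4[of i] assms(1) by (auto simp: weight4_def)
  then have "diag_root \<epsilon> (vector [1, 2 * int m - 1, int m, int m]) = diag 1"
    by (simp add: diag_root_def diag_def vec_eq_iff)
  then have "G = grp" using assms(4) generate_grp by simp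
  then show ?thesis using not_smooth by (simp add: card_grp G_Hilb_eq)
qed

end
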